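(* Let $M\geq2$, let $\mathsf{A}=(A_1,\ldots,A_M)\in M_d(\mathbb{R})^M$ be irreducible, let $s>0$, and let $\mu\in\mathcal{M}_\sigma$ be the unique equilibrium state of $(\mathsf{A},s)$. Then the following three conditions are equivalent: (i) The measure $\mu$ has zero entropy. (ii) The measure $\mu$ is supported on a periodic orbit of $\sigma$. (iii) There exist $n,r\geq1$ such that $nr=d$, symbols $\omega_1,\ldots,\omega_n\in\{1,\ldots,M\}$ and a decomposition $\mathbb{R}^d=\bigoplus_{i=1}^nR_i$ of $\mathbb{R}^d$ into $r$-dimensional subspaces such that $A_iR_j=\{0\}$ when $i\neq\omega_j$, $A_{\omega_j}R_j=R_{j+1}$ when $1\leq j<n$, and $A_{\omega_n}R_n=R_1$. For each $i=1,\ldots,n$ the product $A_{\omega_{i-1}}\cdots A_{\omega_1}A_{\omega_n}\cdots A_{\omega_i}$ maps $R_i$ to itself bijectively, and for $(x_1,\ldots,x_n)\in\{1,\ldots,M\}^n$ we have $A_{x_n}\cdots A_{x_1}\neq0$ if and only if $(x_1,\ldots,x_n)$ is a cyclic permutation of $(\omega_1,\ldots,\omega_n)$.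
   Context: $\Sigma_M:=\{1,\ldots,M\}^{\mathbb{N}}$ with the product topology; $\sigma$ is the shift $\sigma[(x_n)_{n=1}^\infty]=(x_{n+1})_{n=1}^\infty$; $\mathcal{M}_\sigma$ is the set of $\sigma$-invariant Borel probability measures on $\Sigma_M$; $h(\nu)$ is the metric entropy of $\nu\in\mathcal{M}_\sigma$ with respect to $\sigma$. $M_d(\mathbb{R})$ is the set of real $d\times d$ matrices and $\|\cdot\|$ is the operator norm induced by the Euclidean norm. The top Lyapunov exponent is $\Lambda(\mathsf{A},\nu):=\lim_{n\to\infty}\frac1n\int_{\Sigma_M}\log\|A_{x_n}\cdots A_{x_1}\|\,d\nu(x)\in[-\infty,\infty)$ (with $\log 0=-\infty$). An equilibrium state of $(\mathsf{A},s)$ is a measure $\mu\in\mathcal{M}_\sigma$ attaining $\sup_{\nu\in\mathcal{M}_\sigma}\bigl(h(\nu)+s\Lambda(\mathsf{A},\nu)\bigr)$. $\mathsf{A}$ is irreducible if there is no linear subspace $U\subset\mathbb{R}^d$ with $0<\dim U<d$ and $A_iU\subseteq U$ for all $i$. It is known (Feng–Käenmäki) that if $d\geq2$ and $\mathsf{A}$ is irreducible then $(\mathsf{A},s)$ has exactly one equilibrium state. $(x_1,\ldots,x_n)$ is a cyclic permutation of $(\omega_1,\ldots,\omega_n)$ if $(x_1,\ldots,x_n)=(\omega_{i+1},\ldots,\omega_n,\omega_1,\ldots,\omega_i)$ for some $i\in\{1,\ldots,n\}$. For $i=1$ the product $A_{\omega_{i-1}}\cdots A_{\omega_1}A_{\omega_n}\cdots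 A_{\omega_i}$ means $A_{\omega_n}\cdots A_{\omega_1}$. Both sentences of (iii) form part of condition (iii). *)

theory Defs
  imports "HOL-Probability.Probability"
begin

text \<open>Sequences are indexed from \<open>0\<close>: \<open>x n\<close> stands for the coordinate
  \<open>x\<^sub>n\<^sub>+\<^sub>1\<close>. The symbols themselves are \<open>1, \<dots>, M\<close>.\<close>

definition full_shift :: "nat \<Rightarrow> (nat \<Rightarrow> nat) set" where
  "full_shift M = {x. \<forall>n. x n \<in> {1..M}}"

definition shift_map :: "(nat \<Rightarrow> 'a) \<Rightarrow> nat \<Rightarrow> 'a" where
  "shift_map x = (\<lambda>n. x (Suc n))"

text \<open>Here \<^term>\<open>borel\<close> is the Borel sigma-algebra of the product topology on
  \<^typ>\<open>nat \<Rightarrow> nat\<close> with discrete factors, so its restriction is the Borel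
  sigma-algebra of the subspace \<^term>\<open>full_shift M\<close>.\<close>

definition invariant_measures :: "nat \<Rightarrow> (nat \<Rightarrow> nat) measure set" where
  "invariant_measures M = {\<nu>. prob_space \<nu> \<and>
     sets \<nu> = sets (restrict_space borel (full_shift M)) \<and>
     (\<forall>B\<in>sets \<nu>. emeasure \<nu> (shift_map -` B \<inter> space \<nu>) = emeasure \<nu> B)}"

definition supported_on_periodic_orbit :: "nat \<Rightarrow> (nat \<Rightarrow> nat) measure \<Rightarrow> bool" where
  "supported_on_periodic_orbit M \<nu> \<longleftrightarrow>
     (\<exists>x\<in>full_shift M. \<exists>p\<ge>1. (shift_map ^^ p) x = x \<and> measure \<nu> {(shift_map ^^ k) x | k. True} = 1)"

text \<open>The convention \<open>0 log 0 = 0\<close> is automatic.\<close>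

definition partition_entropy :: "'a measure \<Rightarrow> 'a set set \<Rightarrow> real" where
  "partition_entropy \<nu> P = - (\<Sum>B\<in>P. measure \<nu> B * ln (measure \<nu> B))"

definition pullback_partition :: "'a measure \<Rightarrow> ('a \<Rightarrow> 'a) \<Rightarrow> 'a set set \<Rightarrow> 'a set set" where
  "pullback_partition \<nu> T P = (\<lambda>B. T -` B \<inter> space \<nu>) ` P - {{}}"

definition iterated_partition :: "'a measure \<Rightarrow> ('a \<Rightarrow> 'a) \<Rightarrow> 'a set set \<Rightarrow> nat \<Rightarrow> 'a set set" where
  "iterated_partition \<nu> T P n =
     common_refinement ((\<lambda>i. pullback_partition \<nu> (T ^^ i) P) ` {..<n})"

definition metric_entropy :: "'a measure \<Rightarrow> ('a \<Rightarrow> 'a) \<Rightarrow> ereal" where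
  "metric_entropy \<nu> T =
     (SUP P\<in>{P. finite P \<and> partition_on (space \<nu>) P \<and> P \<subseteq> sets \<nu>}.
        ereal (lim (\<lambda>n. partition_entropy \<nu> (iterated_partition \<nu> T P n) / real n)))"

text \<open>The letters of a word act from left to right, so that
  \<open>word_prod A [x\<^sub>1, \<dots>, x\<^sub>n] = A x\<^sub>n ** \<dots> ** A x\<^sub>1\<close>.\<close>

fun word_prod :: "(nat \<Rightarrow> real^'d^'d) \<Rightarrow> nat list \<Rightarrow> real^'d^'d" where
  "word_prod A [] = mat 1"
| "word_prod A (i # w) = word_prod A w ** A i"

definition elog :: "real \<Rightarrow> ereal" where
  "elog t = (if t \<le> 0 then - \<infinity> else ereal (ln t))"

text \<open>Extended-valued integral as positive part minus negative part; \<^const>\<open>e2ennreal\<close> sends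
  negative arguments to \<open>0\<close>. It is only applied to functions that are bounded above, so the
  difference is never of the form \<open>\<infinity> - \<infinity>\<close>.\<close>

definition ereal_integral :: "'a measure \<Rightarrow> ('a \<Rightarrow> ereal) \<Rightarrow> ereal" where
  "ereal_integral \<nu> f =
     enn2ereal (\<integral>\<^sup>+ x. e2ennreal (f x) \<partial>\<nu>) - enn2ereal (\<integral>\<^sup>+ x. e2ennreal (- f x) \<partial>\<nu>)"

definition lyapunov_exponent ::
    "(nat \<Rightarrow> real^'d^'d) \<Rightarrow> (nat \<Rightarrow> nat) measure \<Rightarrow> ereal" where
  "lyapunov_exponent A \<nu> =
     lim (\<lambda>n. ereal (1 / real n) *
       ereal_integral \<nu> (\<lambda>x. elog (onorm ((*v) (word_prod A (map x [0..<n]))))))"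

definition free_energy ::
    "(nat \<Rightarrow> real^'d^'d) \<Rightarrow> real \<Rightarrow> (nat \<Rightarrow> nat) measure \<Rightarrow> ereal" where
  "free_energy A s \<nu> = metric_entropy \<nu> shift_map + ereal s * lyapunov_exponent A \<nu>"

definition equilibrium_state ::
    "nat \<Rightarrow> (nat \<Rightarrow> real^'d^'d) \<Rightarrow> real \<Rightarrow> (nat \<Rightarrow> nat) measure \<Rightarrow> bool" where
  "equilibrium_state M A s \<mu> \<longleftrightarrow> \<mu> \<in> invariant_measures M \<and>
     free_energy A s \<mu> = (SUP \<nu>\<in>invariant_measures M. free_energy A s \<nu>)"

definition irreducible_tuple :: "nat \<Rightarrow> (nat \<Rightarrow> real^'d^'d) \<Rightarrow> bool" where
  "irreducible_tuple M A \<longleftrightarrow>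
     \<not> (\<exists>U :: (real^'d) set. subspace U \<and> 0 < dim U \<and> dim U < CARD('d) \<and>
          (\<forall>i\<in>{1..M}. (*v) (A i) ` U \<subseteq> U))"

definition direct_sum_decomposition :: "'i set \<Rightarrow> ('i \<Rightarrow> 'v::real_vector set) \<Rightarrow> bool" where
  "direct_sum_decomposition I R \<longleftrightarrow>
     (\<forall>i\<in>I. subspace (R i)) \<and> (\<forall>v. \<exists>!f. f \<in> (\<Pi>\<^sub>E i\<in>I. R i) \<and> v = (\<Sum>i\<in>I. f i))"

end

theory Submission
  imports Defs
begin

text \<open>
  Write \<open>a w = \<parallel>A\<^sub>w\<parallel>\<^sup>s\<close> for a word \<open>w\<close> and \<open>Z n\<close> for the sum of \<open>a\<close> over all words of length \<open>n\<close>.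
  The cycle of implications is (ii) \<open>\<Rightarrow>\<close> (i) \<open>\<Rightarrow>\<close> (iii) \<open>\<Rightarrow>\<close> (ii), and the middle one carries the weight.

  Zero entropy is very restrictive because of the variational principle. Its lower half says that
  some invariant measure has free energy at least the exponential growth rate of \<open>Z\<close>
  (\<open>variational_lower_bound\<close>, \<open>growth_rate_le_free_energy\<close>). When the equilibrium state has no entropy,
  its free energy is \<open>s\<close> times its exponent \<open>L\<close>, so \<open>Z\<close> grows no faster than \<open>exp (n s L)\<close>. On the other
  hand a word of length \<open>n\<close> with \<open>a w \<ge> exp (n s L)\<close> always exists, since an exponent is at most an
  average of logarithms of norms. Thus a single word already accounts for all of \<open>Z\<close> up to a constant:
  irreducibility makes \<open>Z\<close> supermultiplicative up to a constant, because any two words can be joined by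
  a bounded connecting word at a bounded loss (\<open>irreducible_quasi_multiplicative\<close>), and this
  removes every subexponential factor from the upper bound.

  After normalising the growth rate to \<open>1\<close>, the number of words of a given length with
  weight above a fixed threshold is bounded. An infinite word with heavy prefixes therefore has only
  boundedly many factors of each length and is eventually periodic. A nonzero word that is not a factor of this
  periodic word \<open>y\<close> could be inserted into \<open>y\<close> at arbitrarily many places and would produce too many heavy
  words. So the words with nonzero product are exactly the factors of \<open>y\<close>
  (\<open>positive_words_are_periodic_subwords\<close>).

  Let \<open>n\<close> be the least period of \<open>y\<close>, and let \<open>B\<^sub>i\<close> be the product along the period that starts at
  position \<open>i\<close>. Its range is the summand \<open>R\<^sub>i\<close>. Products of two different \<open>B\<^sub>i\<close> vanish because they spell
  words that are not factors of \<open>y\<close>, and irreducibility forces the common kernel of the \<open>B\<^sub>i\<close> to be trivial;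
  the whole structure in (iii) follows (\<open>periodic_language_decomposition\<close>).

  For (iii) \<open>\<Rightarrow>\<close> (ii), the exponent of the equilibrium state is finite, so this measure gives no mass to
  words with zero product, and all windows of almost every sequence are rotations of one word
  (\<open>unique_equilibrium_periodic\<close>). Both finiteness statements that this needs, of entropy and of the exponent,
  come from uniqueness: if either failed, a second equilibrium state could be written down. For (ii) \<open>\<Rightarrow>\<close> (i),
  a partition refined along a finite orbit has boundedly many atoms of positive mass.

  All entropies and exponents are computed from the masses of cylinders, that is from a
  nonnegative function on words that is consistent under extension on either side
  (\<open>stationary_weight\<close>).
\<close>

section \<open>Words and the entropy of finite distributions\<close>

definition words :: "'b set \<Rightarrow> nat \<Rightarrow> 'b list set" where
  "words S n = {l. set l \<subseteq> S \<and> length l = n}"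

lemma finite_words [simp]: "finite S \<Longrightarrow> finite (words S n)"
  unfolding words_def by (rule finite_lists_length_eq)

lemma words_0 [simp]: "words S 0 = {[]}"
  by (auto simp: words_def)

lemma sum_words_append:
  assumes "finite S"
  shows "(\<Sum>l\<in>words S (n + m). F l) = (\<Sum>u\<in>words S n. \<Sum>v\<in>words S m. F (u @ v) :: 'a::comm_monoid_add)"
proof -
  have "bij_betw (\<lambda>(u, v). u @ v) (words S n \<times> words S m) (words S (n + m))"
  proof (rule bij_betw_byWitness[where f' = "\<lambda>l. (take n l, drop n l)"])
    show "(\<lambda>l. (take n l, drop n l)) ` words S (n + m) \<subseteq> words S n \<times> words S m"
      by (auto simp: words_def dest: in_set_takeD in_set_dropD)
  qed (auto simp: words_def)
  from sum.reindex_bij_betw[OF this, of F] show ?thesis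
    by (simp add: sum.cartesian_product case_prod_unfold)
qed

lemma sum_words_1: "(\<Sum>l\<in>words S (Suc 0). F l) = (\<Sum>i\<in>S. F [i])"
proof -
  have "bij_betw (\<lambda>i. [i]) S (words S (Suc 0))"
    by (rule bij_betw_byWitness[where f' = hd]) (auto simp: words_def length_Suc_conv)
  from sum.reindex_bij_betw[OF this, of F] show ?thesis by simp
qed

definition eta :: "real \<Rightarrow> real" where
  "eta t = - (t * ln t)"

lemma eta_0 [simp]: "eta 0 = 0" and eta_1 [simp]: "eta 1 = 0"
  by (auto simp: eta_def)

lemma eta_nonneg: "0 \<le> t \<Longrightarrow> t \<le> 1 \<Longrightarrow> 0 \<le> eta t"
  by (cases "t = 0") (auto simp: eta_def mult_nonneg_nonpos)

text \<open>The graph of the concave function \<open>eta\<close> lies below its tangents. All entropy inequalities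
  below are sums of this one.\<close>

lemma eta_tangent:
  assumes "0 \<le> b" "0 < a"
  shows "eta b \<le> - b * ln a + a - b"
proof (cases "b = 0")
  case False
  then have b: "0 < b" using assms by simp
  have "b * ln (a / b) \<le> b * (a / b - 1)"
    using b assms by (intro mult_left_mono ln_le_minus_one) auto
  then show ?thesis using b assms by (simp add: eta_def ln_div algebra_simps)
qed (use assms in auto)

lemma eta_le_1: "0 \<le> t \<Longrightarrow> t \<le> 1 \<Longrightarrow> eta t \<le> 1"
  using eta_tangent[of t 1] by simp

lemma eta_concave_sum:
  assumes "finite I" "I \<noteq> {}" "\<And>i. i \<in> I \<Longrightarrow> 0 \<le> b i"
  shows "(\<Sum>i\<in>I. eta (b i)) \<le> card I * eta ((\<Sum>i\<in>I. b i) / card I)"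
proof -
  define a where "a = (\<Sum>i\<in>I. b i) / card I"
  have cpos: "0 < real (card I)" using assms by (simp add: card_gt_0_iff)
  have sb: "(\<Sum>i\<in>I. b i) = card I * a" using cpos by (simp add: a_def)
  have "0 \<le> a" unfolding a_def by (intro divide_nonneg_nonneg sum_nonneg assms) auto
  show ?thesis
  proof (cases "a = 0")
    case True
    then have "\<forall>i\<in>I. b i = 0" using sb assms by (simp add: sum_nonneg_eq_0_iff)
    then show ?thesis by simp
  next
    case False
    with \<open>0 \<le> a\<close> have a: "0 < a" by simp
    have "(\<Sum>i\<in>I. eta (b i)) \<le> (\<Sum>i\<in>I. - b i * ln a + a - b i)"
      by (intro sum_mono eta_tangent assms a)
    also have "\<dots> = card I * eta a"
      by (simp add: sum.distrib sum_subtractf sum_negf sum_distrib_right[symmetric] sb eta_def)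
    finally show ?thesis by (simp add: a_def)
  qed
qed

lemma continuous_eta: "continuous_on {0..} eta"
proof -
  have "isCont eta t" if "t > 0" for t
    unfolding eta_def using that by (intro continuous_intros) auto
  moreover have "(eta \<longlongrightarrow> eta 0) (at 0 within {0..})"
  proof -
    have "((\<lambda>t::real. - (t * ln t)) \<longlongrightarrow> 0) (at_right 0)" by real_asymp
    moreover have "at (0::real) within {0..} = at_right 0"
      by (metis at_within_Ici_at_right)
    ultimately show ?thesis by (simp add: eta_def[abs_def])
  qed
  ultimately show ?thesis
    unfolding continuous_on_def
    by (metis atLeast_iff continuous_at_imp_continuous_at_within continuous_within less_eq_real_def)
qed

text \<open>Joint entropy is at most the sum of the marginal entropies: bound each term by the
  tangent of \<open>eta\<close> at the product of the two marginals. The linear parts cancel in the sum, because the joint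
  distribution and the product of its marginals both have total mass \<open>1\<close>.\<close>

lemma eta_pair_subadditive:
  fixes q :: "'a \<Rightarrow> 'b \<Rightarrow> real"
  assumes fin: "finite U" "finite V" and nn: "\<And>u v. u \<in> U \<Longrightarrow> v \<in> V \<Longrightarrow> 0 \<le> q u v"
    and total: "(\<Sum>u\<in>U. \<Sum>v\<in>V. q u v) = 1"
  shows "(\<Sum>u\<in>U. \<Sum>v\<in>V. eta (q u v)) \<le>
    (\<Sum>u\<in>U. eta (\<Sum>v\<in>V. q u v)) + (\<Sum>v\<in>V. eta (\<Sum>u\<in>U. q u v))"
proof -
  define a where "a u = (\<Sum>v\<in>V. q u v)" for u
  define b where "b v = (\<Sum>u\<in>U. q u v)" for v
  have suma: "sum a U = 1" using total by (simp add: a_def)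
  have sumb: "sum b V = 1" using total unfolding b_def by (subst sum.swap) simp
  have pt: "eta (q u v) \<le> (- q u v * ln (a u) - q u v * ln (b v)) + (a u * b v - q u v)"
    if uv: "u \<in> U" "v \<in> V" for u v
  proof -
    have "q u v \<le> a u" unfolding a_def using uv by (intro member_le_sum nn fin) auto
    moreover have "q u v \<le> b v" unfolding b_def
      using uv by (intro member_le_sum[of u U "\<lambda>u. q u v"] nn fin) auto
    moreover have "0 \<le> q u v" using uv nn by auto
    ultimately consider "q u v = 0" "0 \<le> a u" "0 \<le> b v" | "0 < q u v" "0 < a u" "0 < b v"
      by linarith
    then show ?thesis
    proof cases
      case 2
      then have "eta (q u v) \<le> - q u v * ln (a u * b v) + a u * b v - q u v"
        by (intro eta_tangent) auto
      then show ?thesis using 2 by (simp add: ln_mult algebra_simps)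
    qed simp
  qed
  have "(\<Sum>u\<in>U. \<Sum>v\<in>V. eta (q u v)) \<le>
    (\<Sum>u\<in>U. \<Sum>v\<in>V. (- q u v * ln (a u) - q u v * ln (b v)) + (a u * b v - q u v))"
    by (intro sum_mono pt)
  also have "\<dots> = (\<Sum>u\<in>U. \<Sum>v\<in>V. - q u v * ln (a u)) + (\<Sum>u\<in>U. \<Sum>v\<in>V. - q u v * ln (b v))
     + ((\<Sum>u\<in>U. \<Sum>v\<in>V. a u * b v) - (\<Sum>u\<in>U. \<Sum>v\<in>V. q u v))"
    by (simp add: sum.distrib sum_subtractf sum_negf)
  also have "(\<Sum>u\<in>U. \<Sum>v\<in>V. - q u v * ln (a u)) = (\<Sum>u\<in>U. eta (a u))"
    by (simp add: eta_def a_def sum_distrib_right sum_negf)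
  also have "(\<Sum>u\<in>U. \<Sum>v\<in>V. - q u v * ln (b v)) = (\<Sum>v\<in>V. eta (b v))"
    by (subst sum.swap) (simp add: eta_def b_def sum_distrib_right sum_negf)
  also have "(\<Sum>u\<in>U. \<Sum>v\<in>V. a u * b v) = sum a U * sum b V"
    by (simp add: sum_product)
  finally show ?thesis using suma sumb total by (simp add: a_def b_def)
qed

text \<open>The Shannon entropy of the random variable \<open>X\<close> on the finite probability space \<open>(\<Omega>, p)\<close>.\<close>

definition law_entropy :: "'a set \<Rightarrow> ('a \<Rightarrow> real) \<Rightarrow> ('a \<Rightarrow> 'b) \<Rightarrow> real" where
  "law_entropy \<Omega> p X = (\<Sum>v\<in>X ` \<Omega>. eta (\<Sum>\<omega>\<in>{\<omega>\<in>\<Omega>. X \<omega> = v}. p \<omega>))"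

lemma law_entropy_superset:
  assumes "finite V" "X ` \<Omega> \<subseteq> V"
  shows "law_entropy \<Omega> p X = (\<Sum>v\<in>V. eta (\<Sum>\<omega>\<in>{\<omega>\<in>\<Omega>. X \<omega> = v}. p \<omega>))"
  unfolding law_entropy_def
proof (rule sum.mono_neutral_left)
  show "\<forall>v\<in>V - X ` \<Omega>. eta (\<Sum>\<omega>\<in>{\<omega>\<in>\<Omega>. X \<omega> = v}. p \<omega>) = 0"
  proof
    fix v assume "v \<in> V - X ` \<Omega>"
    then have "{\<omega>\<in>\<Omega>. X \<omega> = v} = {}" by auto
    then show "eta (\<Sum>\<omega>\<in>{\<omega>\<in>\<Omega>. X \<omega> = v}. p \<omega>) = 0" by (simp only: sum.empty eta_0)
  qed
qed (use assms in auto)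

lemma law_entropy_comp_inj:
  assumes "inj_on f (X ` \<Omega>)"
  shows "law_entropy \<Omega> p (\<lambda>\<omega>. f (X \<omega>)) = law_entropy \<Omega> p X"
proof -
  have "law_entropy \<Omega> p (\<lambda>\<omega>. f (X \<omega>)) =
      (\<Sum>v\<in>f ` X ` \<Omega>. eta (\<Sum>\<omega>\<in>{\<omega>\<in>\<Omega>. f (X \<omega>) = v}. p \<omega>))"
    by (simp add: law_entropy_def image_image)
  also have "\<dots> = (\<Sum>v\<in>X ` \<Omega>. eta (\<Sum>\<omega>\<in>{\<omega>\<in>\<Omega>. f (X \<omega>) = f v}. p \<omega>))"
    by (simp add: sum.reindex[OF assms])
  also have "\<dots> = (\<Sum>v\<in>X ` \<Omega>. eta (\<Sum>\<omega>\<in>{\<omega>\<in>\<Omega>. X \<omega> = v}. p \<omega>))"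
  proof (rule sum.cong)
    fix v assume "v \<in> X ` \<Omega>"
    then have "{\<omega>\<in>\<Omega>. f (X \<omega>) = f v} = {\<omega>\<in>\<Omega>. X \<omega> = v}"
      using assms by (auto dest: inj_onD)
    then show "eta (\<Sum>\<omega>\<in>{\<omega>\<in>\<Omega>. f (X \<omega>) = f v}. p \<omega>) = eta (\<Sum>\<omega>\<in>{\<omega>\<in>\<Omega>. X \<omega> = v}. p \<omega>)"
      by simp
  qed simp
  finally show ?thesis by (simp add: law_entropy_def)
qed

lemma law_entropy_inj:
  assumes "inj_on X \<Omega>"
  shows "law_entropy \<Omega> p X = (\<Sum>\<omega>\<in>\<Omega>. eta (p \<omega>))"
proof -
  have "law_entropy \<Omega> p (\<lambda>\<omega>. X (id \<omega>)) = law_entropy \<Omega> p id"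
    by (rule law_entropy_comp_inj) (use assms in simp)
  also have "\<dots> = (\<Sum>\<omega>\<in>\<Omega>. eta (p \<omega>))"
    unfolding law_entropy_def
  proof (rule sum.cong)
    fix v assume "v \<in> \<Omega>"
    then have "{\<omega>\<in>\<Omega>. id \<omega> = v} = {v}" by auto
    then show "eta (\<Sum>\<omega>\<in>{\<omega>\<in>\<Omega>. id \<omega> = v}. p \<omega>) = eta (p v)" by simp
  qed simp
  finally show ?thesis by simp
qed

lemma law_entropy_pair:
  assumes fin: "finite \<Omega>" and nn: "\<And>\<omega>. \<omega> \<in> \<Omega> \<Longrightarrow> 0 \<le> p \<omega>" and total: "sum p \<Omega> = 1"
  shows "law_entropy \<Omega> p (\<lambda>\<omega>. (X \<omega>, Y \<omega>)) \<le> law_entropy \<Omega> p X + law_entropy \<Omega> p Y"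
proof -
  define q where "q u v = (\<Sum>\<omega>\<in>{\<omega>\<in>\<Omega>. X \<omega> = u \<and> Y \<omega> = v}. p \<omega>)" for u v
  have X: "(\<Sum>v\<in>Y ` \<Omega>. q u v) = (\<Sum>\<omega>\<in>{\<omega>\<in>\<Omega>. X \<omega> = u}. p \<omega>)" for u
  proof -
    have "(\<Sum>v\<in>Y ` \<Omega>. q u v) = (\<Sum>v\<in>Y ` \<Omega>. \<Sum>\<omega>\<in>{\<omega>\<in>{\<omega>\<in>\<Omega>. X \<omega> = u}. Y \<omega> = v}. p \<omega>)"
      by (simp add: q_def conj_assoc)
    also have "\<dots> = (\<Sum>\<omega>\<in>{\<omega>\<in>\<Omega>. X \<omega> = u}. p \<omega>)"
      by (rule sum.group) (use fin in auto)
    finally show ?thesis .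
  qed
  have Y: "(\<Sum>u\<in>X ` \<Omega>. q u v) = (\<Sum>\<omega>\<in>{\<omega>\<in>\<Omega>. Y \<omega> = v}. p \<omega>)" for v
  proof -
    have "(\<Sum>u\<in>X ` \<Omega>. q u v) = (\<Sum>u\<in>X ` \<Omega>. \<Sum>\<omega>\<in>{\<omega>\<in>{\<omega>\<in>\<Omega>. Y \<omega> = v}. X \<omega> = u}. p \<omega>)"
      by (intro sum.cong refl arg_cong[where f = "sum p"]) (auto simp: q_def intro!: sum.cong)
    also have "\<dots> = (\<Sum>\<omega>\<in>{\<omega>\<in>\<Omega>. Y \<omega> = v}. p \<omega>)"
      by (rule sum.group) (use fin in auto)
    finally show ?thesis .
  qed
  have "law_entropy \<Omega> p (\<lambda>\<omega>. (X \<omega>, Y \<omega>)) =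
     (\<Sum>uv\<in>X ` \<Omega> \<times> Y ` \<Omega>. eta (q (fst uv) (snd uv)))"
    by (subst law_entropy_superset[where V = "X ` \<Omega> \<times> Y ` \<Omega>"])
      (use fin in \<open>auto simp: q_def intro!: sum.cong arg_cong[where f = eta]\<close>)
  also have "\<dots> = (\<Sum>u\<in>X ` \<Omega>. \<Sum>v\<in>Y ` \<Omega>. eta (q u v))"
    by (simp add: sum.cartesian_product case_prod_unfold)
  also have "\<dots> \<le> (\<Sum>u\<in>X ` \<Omega>. eta (\<Sum>v\<in>Y ` \<Omega>. q u v)) + (\<Sum>v\<in>Y ` \<Omega>. eta (\<Sum>u\<in>X ` \<Omega>. q u v))"
  proof (rule eta_pair_subadditive)
    show "0 \<le> q u v" for u v unfolding q_def by (intro sum_nonneg nn) auto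
    have "(\<Sum>u\<in>X ` \<Omega>. \<Sum>v\<in>Y ` \<Omega>. q u v) = (\<Sum>u\<in>X ` \<Omega>. \<Sum>\<omega>\<in>{\<omega>\<in>\<Omega>. X \<omega> = u}. p \<omega>)"
      by (simp add: X)
    also have "\<dots> = 1" using total by (subst sum.group) (use fin in auto)
    finally show "(\<Sum>u\<in>X ` \<Omega>. \<Sum>v\<in>Y ` \<Omega>. q u v) = 1" .
  qed (use fin in auto)
  finally show ?thesis by (simp add: X Y law_entropy_def)
qed

lemma law_entropy_list:
  assumes fin: "finite \<Omega>" and nn: "\<And>\<omega>. \<omega> \<in> \<Omega> \<Longrightarrow> 0 \<le> p \<omega>" and total: "sum p \<Omega> = 1"
  shows "law_entropy \<Omega> p (\<lambda>\<omega>. map (\<lambda>i. X i \<omega>) [0..<m]) \<le> (\<Sum>i<m. law_entropy \<Omega> p (X i))"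
proof (induction m)
  case 0
  have "\<Omega> \<noteq> {}" using total by auto
  then show ?case using total by (simp add: law_entropy_def image_constant_conv)
next
  case (Suc m)
  have "law_entropy \<Omega> p (\<lambda>\<omega>. map (\<lambda>i. X i \<omega>) [0..<Suc m]) =
      law_entropy \<Omega> p (\<lambda>\<omega>. (\<lambda>(l, y). l @ [y]) (map (\<lambda>i. X i \<omega>) [0..<m], X m \<omega>))"
    by simp
  also have "\<dots> = law_entropy \<Omega> p (\<lambda>\<omega>. (map (\<lambda>i. X i \<omega>) [0..<m], X m \<omega>))"
    by (rule law_entropy_comp_inj) (auto simp: inj_on_def)
  also have "\<dots> \<le> law_entropy \<Omega> p (\<lambda>\<omega>. map (\<lambda>i. X i \<omega>) [0..<m]) + law_entropy \<Omega> p (X m)"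
    by (rule law_entropy_pair[OF fin nn total])
  finally show ?case using Suc.IH by simp
qed


section \<open>Stationary weights on words\<close>

text \<open>The abstract form of the cylinder masses of a shift-invariant probability measure: summing out
  the last letter expresses consistency, summing out the first one expresses invariance.\<close>

definition stationary_weight :: "'b set \<Rightarrow> ('b list \<Rightarrow> real) \<Rightarrow> bool" where
  "stationary_weight S g \<longleftrightarrow> finite S \<and> (\<forall>l. 0 \<le> g l) \<and> g [] = 1 \<and>
     (\<forall>l. set l \<subseteq> S \<longrightarrow> (\<Sum>i\<in>S. g (l @ [i])) = g l \<and> (\<Sum>i\<in>S. g (i # l)) = g l)"

definition block_entropy :: "'b set \<Rightarrow> ('b list \<Rightarrow> real) \<Rightarrow> nat \<Rightarrow> real" where
  "block_entropy S g n = (\<Sum>l\<in>words S n. eta (g l))"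

lemma stationary_weight_append:
  assumes "stationary_weight S g" "set u \<subseteq> S"
  shows "(\<Sum>v\<in>words S m. g (u @ v)) = g u"
  using assms(2)
proof (induction m arbitrary: u)
  case (Suc m)
  have "(\<Sum>v\<in>words S (m + 1). g (u @ v)) = (\<Sum>v\<in>words S m. \<Sum>i\<in>S. g ((u @ v) @ [i]))"
    using assms(1) by (subst sum_words_append) (auto simp: stationary_weight_def sum_words_1)
  also have "\<dots> = (\<Sum>v\<in>words S m. g (u @ v))"
  proof (rule sum.cong)
    fix v assume "v \<in> words S m"
    then have "set (u @ v) \<subseteq> S" using Suc.prems by (auto simp: words_def)
    then show "(\<Sum>i\<in>S. g ((u @ v) @ [i])) = g (u @ v)"
      using assms(1) unfolding stationary_weight_def by blast
  qed simp
  finally show ?case using Suc by simp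
qed simp

lemma stationary_weight_prepend:
  assumes "stationary_weight S g" "set v \<subseteq> S"
  shows "(\<Sum>u\<in>words S m. g (u @ v)) = g v"
  using assms(2)
proof (induction m arbitrary: v)
  case (Suc m)
  have "(\<Sum>u\<in>words S (m + 1). g (u @ v)) = (\<Sum>u\<in>words S m. \<Sum>i\<in>S. g (u @ [i] @ v))"
    using assms(1) by (subst sum_words_append) (auto simp: stationary_weight_def sum_words_1)
  also have "\<dots> = (\<Sum>i\<in>S. \<Sum>u\<in>words S m. g (u @ [i] @ v))"
    by (rule sum.swap)
  also have "\<dots> = (\<Sum>i\<in>S. g ([i] @ v))"
    using Suc by (intro sum.cong) auto
  also have "\<dots> = g v"
    using assms(1) Suc.prems by (auto simp: stationary_weight_def)
  finally show ?case by simp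
qed simp

lemma stationary_weight_total:
  assumes "stationary_weight S g"
  shows "(\<Sum>u\<in>words S m. g u) = 1"
  using stationary_weight_append[OF assms, of "[]" m] assms by (simp add: stationary_weight_def)

lemma stationary_weight_le_1:
  assumes "stationary_weight S g" "set u \<subseteq> S"
  shows "g u \<le> 1"
proof -
  have "g u \<le> (\<Sum>v\<in>words S (length u). g v)"
    using assms by (intro member_le_sum) (auto simp: stationary_weight_def words_def finite_lists_length_eq)
  then show ?thesis using stationary_weight_total[OF assms(1)] by simp
qed

lemma block_entropy_nonneg:
  assumes "stationary_weight S g"
  shows "0 \<le> block_entropy S g n"
  unfolding block_entropy_def
  using assms stationary_weight_le_1[OF assms]
  by (intro sum_nonneg eta_nonneg) (auto simp: stationary_weight_def words_def)

lemma block_entropy_subadditive: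
  assumes "stationary_weight S g"
  shows "block_entropy S g (n + m) \<le> block_entropy S g n + block_entropy S g m"
proof -
  have fin: "finite S" and nn: "\<And>l. 0 \<le> g l" using assms by (auto simp: stationary_weight_def)
  have 1: "(\<Sum>v\<in>words S m. g (u @ v)) = g u" if "u \<in> words S n" for u
    using that by (intro stationary_weight_append[OF assms]) (auto simp: words_def)
  have 2: "(\<Sum>u\<in>words S n. g (u @ v)) = g v" if "v \<in> words S m" for v
    using that by (intro stationary_weight_prepend[OF assms]) (auto simp: words_def)
  have "block_entropy S g (n + m) = (\<Sum>u\<in>words S n. \<Sum>v\<in>words S m. eta (g (u @ v)))"
    by (simp add: block_entropy_def sum_words_append[OF fin])
  also have "\<dots> \<le> (\<Sum>u\<in>words S n. eta (\<Sum>v\<in>words S m. g (u @ v)))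
      + (\<Sum>v\<in>words S m. eta (\<Sum>u\<in>words S n. g (u @ v)))"
    using fin nn stationary_weight_total[OF assms, of n]
    by (intro eta_pair_subadditive) (auto simp: 1)
  also have "\<dots> = block_entropy S g n + block_entropy S g m"
    by (simp add: block_entropy_def 1 2)
  finally show ?thesis .
qed

text \<open>The limit is taken in the extended reals because Lyapunov exponents, unlike entropies, may be
  \<open>- \<infinity>\<close>.\<close>

lemma fekete:
  fixes u :: "nat \<Rightarrow> real"
  assumes sub: "\<And>m n. u (m + n) \<le> u m + u n"
  shows "(\<lambda>n. ereal (u n / real n)) \<longlonglongrightarrow> (INF n\<in>{1..}. ereal (u n / real n))"
proof -
  define L where "L = (INF n\<in>{1..}. ereal (u n / real n))"
  have mult: "u (k * q + r) \<le> real k * u q + u r" for k q r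
  proof (induction k)
    case (Suc k)
    have "u (Suc k * q + r) = u (q + (k * q + r))" by (simp add: add.assoc)
    also have "\<dots> \<le> u q + u (k * q + r)" by (rule sub)
    finally show ?case using Suc by (simp add: algebra_simps)
  qed simp
  have up: "limsup (\<lambda>n. ereal (u n / real n)) \<le> ereal (u q / real q)" if q: "1 \<le> q" for q
  proof -
    define C where "C = (\<Sum>r<q. \<bar>u r\<bar>) + \<bar>u q\<bar>"
    have bd: "u n / real n \<le> u q / real q + C / real n" if n: "1 \<le> n" for n
    proof -
      have nd: "real n = real (n div q) * real q + real (n mod q)"
        by (metis div_mult_mod_eq of_nat_add of_nat_mult)
      have m: "n mod q < q" using q by simp
      have "u n \<le> real (n div q) * u q + u (n mod q)"
        using mult[of "n div q" q "n mod q"] by simp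
      moreover have "real (n div q) * u q = real n * (u q / real q) - real (n mod q) / real q * u q"
        using q nd by (simp add: field_simps)
      moreover have "- (real (n mod q) / real q * u q) \<le> \<bar>u q\<bar>"
      proof -
        have "\<bar>real (n mod q) / real q * u q\<bar> = real (n mod q) / real q * \<bar>u q\<bar>"
          by (simp add: abs_mult)
        also have "\<dots> \<le> 1 * \<bar>u q\<bar>"
          using m by (intro mult_right_mono) auto
        finally show ?thesis by linarith
      qed
      moreover have "u (n mod q) \<le> (\<Sum>r<q. \<bar>u r\<bar>)"
        using m member_le_sum[of "n mod q" "{..<q}" "\<lambda>r. \<bar>u r\<bar>"] by force
      ultimately have "u n \<le> real n * (u q / real q) + C" unfolding C_def by linarith
      then have "u n / real n \<le> (real n * (u q / real q) + C) / real n"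
        by (intro divide_right_mono) auto
      also have "\<dots> = u q / real q + C / real n" using n by (simp add: add_divide_distrib)
      finally show ?thesis .
    qed
    have "limsup (\<lambda>n. ereal (u n / real n)) \<le> limsup (\<lambda>n. ereal (u q / real q + C / real n))"
      by (intro Limsup_mono eventually_sequentiallyI[of 1]) (use bd in auto)
    also have "\<dots> = ereal (u q / real q)"
    proof (rule lim_imp_Limsup)
      have "(\<lambda>n. u q / real q + C / real n) \<longlonglongrightarrow> u q / real q" by real_asymp
      then show "(\<lambda>n. ereal (u q / real q + C / real n)) \<longlonglongrightarrow> ereal (u q / real q)" by simp
    qed simp
    finally show ?thesis .
  qed
  have "limsup (\<lambda>n. ereal (u n / real n)) \<le> L"
    unfolding L_def by (intro INF_greatest) (use up in auto)
  moreover have "L \<le> liminf (\<lambda>n. ereal (u n / real n))"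
    by (intro Liminf_bounded eventually_sequentiallyI[of 1]) (auto simp: L_def intro: INF_lower)
  ultimately have "(\<lambda>n. ereal (u n / real n)) \<longlonglongrightarrow> L"
    by (intro Liminf_eq_Limsup)
      (use Liminf_le_Limsup[of sequentially "\<lambda>n. ereal (u n / real n)"] in \<open>auto intro: antisym order_trans\<close>)
  then show ?thesis by (simp add: L_def)
qed

lemma block_entropy_rate:
  assumes "stationary_weight S g"
  obtains h where "(\<lambda>n. block_entropy S g n / real n) \<longlonglongrightarrow> h"
    and "\<And>n. 1 \<le> n \<Longrightarrow> h \<le> block_entropy S g n / real n" and "0 \<le> h"
proof -
  define L where "L = (INF n\<in>{1..}. ereal (block_entropy S g n / real n))"
  have lim: "(\<lambda>n. ereal (block_entropy S g n / real n)) \<longlonglongrightarrow> L"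
    unfolding L_def by (rule fekete[OF block_entropy_subadditive[OF assms]])
  have "0 \<le> L" unfolding L_def
    by (intro INF_greatest) (use block_entropy_nonneg[OF assms] in auto)
  moreover have le: "L \<le> ereal (block_entropy S g n / real n)" if "1 \<le> n" for n
    unfolding L_def using that by (intro INF_lower) auto
  ultimately obtain h where h: "L = ereal h" "0 \<le> h"
    using le[of 1] by (cases L) auto
  show ?thesis
    by (rule that[of h]) (use lim le h in auto)
qed

section \<open>Matrix products along words\<close>

lemma word_prod_append: "word_prod A (u @ v) = word_prod A v ** word_prod A u"
  by (induction u) (auto simp: matrix_mul_assoc)

lemma word_prod_snoc: "word_prod A (u @ [i]) = A i ** word_prod A u"
  by (simp add: word_prod_append)

abbreviation mnorm :: "real^'n^'m \<Rightarrow> real" where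
  "mnorm B \<equiv> onorm ((*v) B)"

lemma mnorm_mult_le: "mnorm (B ** C) \<le> mnorm B * mnorm C"
proof -
  have "(*v) (B ** C) = (*v) B \<circ> (*v) C"
    by (simp add: fun_eq_iff matrix_vector_mul_assoc)
  then show ?thesis
    by (metis onorm_compose matrix_vector_mul_bounded_linear)
qed

lemma mnorm_nonneg: "0 \<le> mnorm B"
  by (rule onorm_pos_le[OF matrix_vector_mul_bounded_linear])

lemma mnorm_eq_0: "mnorm B = 0 \<longleftrightarrow> B = 0"
  by (metis onorm_eq_0 matrix_vector_mul_bounded_linear matrix_eq matrix_vector_mult_0)

lemma irreducible_invariant_cases:
  fixes A :: "nat \<Rightarrow> real^'d^'d"
  assumes "irreducible_tuple M A" "subspace U" "\<And>i. i \<in> {1..M} \<Longrightarrow> (*v) (A i) ` U \<subseteq> U"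
  shows "U = {0} \<or> U = UNIV"
proof -
  have "dim U = 0 \<or> CARD('d) \<le> dim U"
    using assms unfolding irreducible_tuple_def by (metis not_gr_zero not_less)
  then show ?thesis
  proof
    assume "dim U = 0"
    then show ?thesis using subspace_0[OF assms(2)] by (auto simp: dim_eq_0)
  next
    assume "CARD('d) \<le> dim U"
    moreover have "dim U \<le> CARD('d)" using dim_subset_UNIV[of U] by simp
    ultimately have "dim U = DIM(real^'d)" by simp
    then have "span U = UNIV" by (metis dim_eq_full)
    then show ?thesis using assms(2) by (metis span_eq_iff)
  qed
qed

text \<open>The orbit of \<open>x\<close> under all products spans an invariant subspace, hence everything.\<close>

lemma irreducible_some_pairing_nonzero:
  fixes A :: "nat \<Rightarrow> real^'d^'d" and x y :: "real^'d"
  assumes "irreducible_tuple M A" "x \<noteq> 0" "y \<noteq> 0"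
  shows "\<exists>w. set w \<subseteq> {1..M} \<and> y \<bullet> (word_prod A w *v x) \<noteq> 0"
proof (rule ccontr)
  assume "\<not> ?thesis"
  then have orth: "\<And>w. set w \<subseteq> {1..M} \<Longrightarrow> y \<bullet> (word_prod A w *v x) = 0" by blast
  define U where "U = span {word_prod A w *v x | w. set w \<subseteq> {1..M}}"
  have "(*v) (A i) ` U \<subseteq> U" if i: "i \<in> {1..M}" for i
  proof -
    have "(*v) (A i) ` U = span ((*v) (A i) ` {word_prod A w *v x | w. set w \<subseteq> {1..M}})"
      unfolding U_def by (rule linear_span_image[symmetric]) simp
    also have "\<dots> \<subseteq> U" unfolding U_def
    proof (rule span_mono, safe)
      fix w assume "set w \<subseteq> {1..M}"
      then show "\<exists>w'. A i *v (word_prod A w *v x) = word_prod A w' *v x \<and> set w' \<subseteq> {1..M}"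
        using i by (intro exI[of _ "w @ [i]"]) (auto simp: word_prod_snoc matrix_vector_mul_assoc)
    qed
    finally show ?thesis .
  qed
  then have "U = {0} \<or> U = UNIV"
    by (intro irreducible_invariant_cases[OF assms(1)]) (auto simp: U_def)
  moreover have "x \<in> U" unfolding U_def
    by (rule span_base) (auto intro!: exI[of _ "[]"])
  ultimately have "y \<in> U" using \<open>x \<noteq> 0\<close> by auto
  then have "orthogonal y y" unfolding U_def
    by (rule orthogonal_to_span) (auto simp: orthogonal_def orth)
  then show False using \<open>y \<noteq> 0\<close> by (simp add: orthogonal_def)
qed

text \<open>Half of the operator norm suffices below, which avoids a compactness argument for attainment.\<close>

lemma mnorm_nearly_attained:
  fixes B :: "real^'n^'m"
  assumes "B \<noteq> 0"
  obtains e where "e \<noteq> 0" "mnorm B / 2 * norm e \<le> norm (B *v e)"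
proof -
  have "0 < mnorm B" using assms mnorm_nonneg[of B] mnorm_eq_0[of B] by linarith
  then have "\<not> mnorm B \<le> mnorm B / 2" by simp
  then obtain e where "\<not> norm (B *v e) \<le> mnorm B / 2 * norm e"
    using onorm_le[of "(*v) B" "mnorm B / 2"] by blast
  then show ?thesis by (intro that[of e]) auto
qed

text \<open>Compactness makes the previous lemma uniform: finitely many words serve all pairs of unit
  vectors, and the sum of the corresponding pairings is a positive continuous function on a compact set.\<close>

lemma irreducible_uniform_pairing:
  fixes A :: "nat \<Rightarrow> real^'d^'d"
  assumes "irreducible_tuple M A"
  obtains c k where "0 < c" and
    "\<And>x y. \<exists>w. set w \<subseteq> {1..M} \<and> length w \<le> k \<and> c * (norm x * norm y) \<le> \<bar>y \<bullet> (word_prod A w *v x)\<bar>"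
proof -
  define K where "K = sphere (0::real^'d) 1 \<times> sphere (0::real^'d) 1"
  define O' where "O' w = {z :: (real^'d) \<times> (real^'d). snd z \<bullet> (word_prod A w *v fst z) \<noteq> 0}" for w
  have cont: "continuous_on T (\<lambda>z :: (real^'d) \<times> (real^'d). snd z \<bullet> (word_prod A w *v fst z))" for w T
    by (intro continuous_intros linear_continuous_on_compose[OF _ matrix_vector_mul_linear])
  have "compact K" unfolding K_def by (intro compact_Times) auto
  moreover have "open (O' w)" for w
    unfolding O'_def using open_Collect_neq[OF cont continuous_on_const] by simp
  moreover have "K \<subseteq> (\<Union>w\<in>{w. set w \<subseteq> {1..M}}. O' w)"
  proof
    fix z assume "z \<in> K"
    then have "fst z \<noteq> 0" "snd z \<noteq> 0" by (auto simp: K_def)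
    from irreducible_some_pairing_nonzero[OF assms this]
    show "z \<in> (\<Union>w\<in>{w. set w \<subseteq> {1..M}}. O' w)" by (auto simp: O'_def)
  qed
  ultimately obtain W where W: "W \<subseteq> {w. set w \<subseteq> {1..M}}" "finite W" "K \<subseteq> (\<Union>w\<in>W. O' w)"
    by (rule compactE_image) auto
  define \<phi> where "\<phi> z = (\<Sum>w\<in>W. \<bar>snd z \<bullet> (word_prod A w *v fst z)\<bar>)" for z
  have ne: "K \<noteq> {}" unfolding K_def by simp
  have "continuous_on K \<phi>" unfolding \<phi>_def by (intro continuous_intros cont)
  from continuous_attains_inf[OF \<open>compact K\<close> ne this]
  obtain z0 where z0: "z0 \<in> K" "\<And>z. z \<in> K \<Longrightarrow> \<phi> z0 \<le> \<phi> z" by blast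
  have "0 < \<phi> z0"
  proof -
    from z0(1) W(3) obtain w where "w \<in> W" "z0 \<in> O' w" by blast
    then show ?thesis unfolding \<phi>_def using W(2)
      by (intro sum_pos2[of W w]) (auto simp: O'_def)
  qed
  define c where "c = \<phi> z0 / (card W + 1)"
  have "0 < c" using \<open>0 < \<phi> z0\<close> by (simp add: c_def)
  have unit: "\<exists>w\<in>W. c \<le> \<bar>snd z \<bullet> (word_prod A w *v fst z)\<bar>" if "z \<in> K" for z
  proof (rule ccontr)
    assume "\<not> ?thesis"
    then have "\<phi> z \<le> (\<Sum>w\<in>W. c)" unfolding \<phi>_def by (intro sum_mono) auto
    also have "\<dots> = card W * c" by simp
    also have "\<dots> < (card W + 1) * c" using \<open>0 < c\<close> by (simp add: algebra_simps)
    also have "\<dots> = \<phi> z0" by (simp add: c_def)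
    finally show False using z0(2)[OF that] by simp
  qed
  define k where "k = Max (insert 0 (length ` W))"
  show ?thesis
  proof (rule that[OF \<open>0 < c\<close>])
    fix x y :: "real^'d"
    show "\<exists>w. set w \<subseteq> {1..M} \<and> length w \<le> k \<and> c * (norm x * norm y) \<le> \<bar>y \<bullet> (word_prod A w *v x)\<bar>"
    proof (cases "x = 0 \<or> y = 0")
      case True
      then show ?thesis by (intro exI[of _ "[]"]) auto
    next
      case False
      then have xy: "0 < norm x * norm y" by simp
      from False have "(x /\<^sub>R norm x, y /\<^sub>R norm y) \<in> K" by (auto simp: K_def)
      from unit[OF this] obtain w where w: "w \<in> W"
        "c \<le> \<bar>(y /\<^sub>R norm y) \<bullet> (word_prod A w *v (x /\<^sub>R norm x))\<bar>" by auto
      have "\<bar>(y /\<^sub>R norm y) \<bullet> (word_prod A w *v (x /\<^sub>R norm x))\<bar> =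
          \<bar>y \<bullet> (word_prod A w *v x)\<bar> / (norm x * norm y)"
        by (simp add: matrix_vector_mult_scaleR abs_mult divide_inverse mult_ac)
      with w(2) xy have "c * (norm x * norm y) \<le> \<bar>y \<bullet> (word_prod A w *v x)\<bar>"
        by (simp add: pos_le_divide_eq)
      moreover have "length w \<le> k" unfolding k_def using w W by (intro Max_ge) auto
      ultimately show ?thesis using w W by blast
    qed
  qed
qed

text \<open>The connecting word joins a direction that the first product stretches to a direction that
  the transpose of the second product stretches.\<close>

lemma irreducible_quasi_multiplicative:
  fixes A :: "nat \<Rightarrow> real^'d^'d"
  assumes "irreducible_tuple M A"
  obtains c k where "0 < c" and
    "\<And>u v. \<exists>w. set w \<subseteq> {1..M} \<and> length w \<le> k \<and>
       c * (mnorm (word_prod A u) * mnorm (word_prod A v)) \<le> mnorm (word_prod A (u @ w @ v))"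
proof -
  obtain c k where c: "0 < c" and ck:
    "\<And>x y. \<exists>w. set w \<subseteq> {1..M} \<and> length w \<le> k \<and> c * (norm x * norm y) \<le> \<bar>y \<bullet> (word_prod A w *v x)\<bar>"
    using irreducible_uniform_pairing[OF assms] by blast
  show ?thesis
  proof (rule that[of "c / 4" k])
    fix u v
    define G where "G = word_prod A u"
    define H where "H = word_prod A v"
    show "\<exists>w. set w \<subseteq> {1..M} \<and> length w \<le> k \<and>
       c / 4 * (mnorm (word_prod A u) * mnorm (word_prod A v)) \<le> mnorm (word_prod A (u @ w @ v))"
    proof (cases "G = 0 \<or> H = 0")
      case True
      then have "mnorm G * mnorm H = 0" using mnorm_eq_0 by auto
      then show ?thesis by (intro exI[of _ "[]"]) (auto simp: G_def H_def mnorm_nonneg)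
    next
      case False
      then have "G \<noteq> 0" "H \<noteq> 0" by auto
      obtain e where e: "e \<noteq> 0" "mnorm G / 2 * norm e \<le> norm (G *v e)"
        using mnorm_nearly_attained[OF \<open>G \<noteq> 0\<close>] .
      obtain g where g: "g \<noteq> 0" "mnorm H / 2 * norm g \<le> norm (H *v g)"
        using mnorm_nearly_attained[OF \<open>H \<noteq> 0\<close>] .
      define f where "f = H *v g"
      \<comment> \<open>the row vector \<open>y\<close> is the functional whose pairing with \<open>z\<close> is the component of \<open>H z\<close> along \<open>f\<close>\<close>
      define y where "y = f v* H"
      have ydot: "y \<bullet> z = f \<bullet> (H *v z)" for z by (simp add: y_def dot_lmul_matrix)
      have "norm f * norm f = y \<bullet> g" unfolding ydot by (simp add: f_def dot_square_norm power2_eq_square)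
      also have "\<dots> \<le> norm y * norm g" by (rule norm_cauchy_schwarz)
      finally have ff: "norm f * norm f \<le> norm y * norm g" .
      have "norm f * (mnorm H / 2 * norm g) \<le> norm f * norm f"
        using g(2) by (intro mult_left_mono) (auto simp: f_def)
      with ff have "(norm f * (mnorm H / 2)) * norm g \<le> norm y * norm g" by (simp add: mult_ac)
      then have ny: "norm f * (mnorm H / 2) \<le> norm y" using g(1) by simp
      obtain w where w: "set w \<subseteq> {1..M}" "length w \<le> k"
        "c * (norm (G *v e) * norm y) \<le> \<bar>y \<bullet> (word_prod A w *v (G *v e))\<bar>" using ck by blast
      define P where "P = word_prod A (u @ w @ v)"
      have P: "P *v e = H *v (word_prod A w *v (G *v e))"
        by (simp add: P_def G_def H_def word_prod_append matrix_vector_mul_assoc matrix_mul_assoc)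
      have "0 < mnorm H" using \<open>H \<noteq> 0\<close> mnorm_nonneg[of H] mnorm_eq_0[of H] by linarith
      then have "0 < norm (H *v g)" using g by (intro less_le_trans[OF _ g(2)]) auto
      then have f0: "0 < norm f" by (simp add: f_def)
      have "c * ((mnorm G / 2 * norm e) * (norm f * (mnorm H / 2))) \<le> c * (norm (G *v e) * norm y)"
        using c e(2) ny mnorm_nonneg[of H]
        by (intro mult_left_mono mult_mono) auto
      also have "\<dots> \<le> \<bar>f \<bullet> (P *v e)\<bar>" using w(3) by (simp add: ydot P)
      also have "\<dots> \<le> norm f * norm (P *v e)" by (rule Cauchy_Schwarz_ineq2)
      also have "\<dots> \<le> norm f * (mnorm P * norm e)"
        by (intro mult_left_mono onorm matrix_vector_mul_bounded_linear) auto
      finally have "(norm f * norm e) * (c / 4 * (mnorm G * mnorm H)) \<le> (norm f * norm e) * mnorm P"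
        by (simp add: mult_ac)
      then have "c / 4 * (mnorm G * mnorm H) \<le> mnorm P"
        using f0 e(1) by simp
      then show ?thesis using w by (auto simp: P_def G_def H_def)
    qed
  qed (use c in auto)
qed

section \<open>Rigidity of tight word weights\<close>

text \<open>The situation reached by an equilibrium state of zero entropy after normalisation: the weights
  of the words of any given length have bounded sum although one of them is at least \<open>1\<close>.\<close>

locale tight_word_weight =
  fixes S :: "'b set" and a :: "'b list \<Rightarrow> real" and c C :: real and k :: nat
  assumes finite_S: "finite S"
    and nonneg: "0 \<le> a w"
    and submult: "a (u @ v) \<le> a u * a v"
    and c_pos: "0 < c"
    and quasi_mult: "\<exists>w. set w \<subseteq> S \<and> length w \<le> k \<and> c * (a u * a v) \<le> a (u @ w @ v)"
    and total_le: "(\<Sum>w\<in>words S n. a w) \<le> C"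
    and large: "\<exists>w\<in>words S n. 1 \<le> a w"
begin

lemma a_le_C: "set w \<subseteq> S \<Longrightarrow> a w \<le> C"
  using member_le_sum[of w "words S (length w)" a] finite_S nonneg total_le[of "length w"]
  by (auto simp: words_def finite_lists_length_eq)

lemma C_ge_1: "1 \<le> C"
  using large[of 0] total_le[of 0] by simp

lemma card_heavy_words:
  assumes "W \<subseteq> words S n" "\<And>w. w \<in> W \<Longrightarrow> e \<le> a w" "0 < e"
  shows "real (card W) \<le> C / e"
proof -
  have "real (card W) * e = (\<Sum>w\<in>W. e)" by simp
  also have "\<dots> \<le> (\<Sum>w\<in>W. a w)" by (intro sum_mono assms)
  also have "\<dots> \<le> (\<Sum>w\<in>words S n. a w)"
    using assms finite_S nonneg by (intro sum_mono2) auto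
  also have "\<dots> \<le> C" by (rule total_le)
  finally show ?thesis using assms(3) by (simp add: pos_le_divide_eq)
qed

lemma prefix_lower_bound:
  assumes "set v \<subseteq> S" "e \<le> a (u @ v)"
  shows "e / C \<le> a u"
proof -
  have "e \<le> a u * a v" using assms(2) submult[of u v] by linarith
  also have "\<dots> \<le> a u * C" using a_le_C[OF assms(1)] nonneg by (intro mult_left_mono) auto
  finally show ?thesis using C_ge_1 by (simp add: pos_divide_le_eq)
qed

lemma suffix_lower_bound:
  assumes "set u \<subseteq> S" "e \<le> a (u @ v)"
  shows "e / C \<le> a v"
proof -
  have "e \<le> a u * a v" using assms(2) submult[of u v] by linarith
  also have "\<dots> \<le> C * a v" using a_le_C[OF assms(1)] nonneg by (intro mult_right_mono) auto
  finally show ?thesis using C_ge_1 by (simp add: pos_divide_le_eq mult.commute)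
qed

text \<open>Koenig's lemma in the tree of words that have arbitrarily long extensions of weight at least
  \<open>1\<close>. Such words are themselves heavy, because the extension costs at most the factor \<open>C\<close>.\<close>

lemma heavy_sequence:
  obtains x :: "nat \<Rightarrow> 'b" where "\<And>i. x i \<in> S" "\<And>n. 1 / C \<le> a (map x [0..<n])"
proof -
  define good where "good w \<longleftrightarrow> set w \<subseteq> S \<and>
    (\<forall>N. \<exists>v. set v \<subseteq> S \<and> N \<le> length v \<and> 1 \<le> a (w @ v))" for w
  have good0: "good []"
    unfolding good_def
  proof (intro conjI allI)
    fix N
    from large[of N] obtain v where "v \<in> words S N" "1 \<le> a v" by blast
    then show "\<exists>v. set v \<subseteq> S \<and> N \<le> length v \<and> 1 \<le> a ([] @ v)"
      by (intro exI[of _ v]) (auto simp: words_def)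
  qed simp
  have step: "\<exists>i\<in>S. good (w @ [i])" if "good w" for w
  proof (rule ccontr)
    assume "\<not> ?thesis"
    then have "\<forall>i\<in>S. \<exists>N. \<forall>v. set v \<subseteq> S \<and> N \<le> length v \<longrightarrow> \<not> 1 \<le> a (w @ i # v)"
      using that unfolding good_def by (auto simp: conj_commute imp_conjL)
    then obtain N where N: "\<And>i v. i \<in> S \<Longrightarrow> set v \<subseteq> S \<Longrightarrow> N i \<le> length v \<Longrightarrow> \<not> 1 \<le> a (w @ i # v)"
      by metis
    from that obtain v where v: "set v \<subseteq> S" "Suc (\<Sum>i\<in>S. N i) \<le> length v" "1 \<le> a (w @ v)"
      unfolding good_def by blast
    then obtain i v' where iv: "v = i # v'" by (cases v) auto
    have "N i \<le> (\<Sum>i\<in>S. N i)" using v iv finite_S by (intro member_le_sum) auto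
    then show False using N[of i v'] v iv by auto
  qed
  define f where "f n = ((\<lambda>w. w @ [SOME i. i \<in> S \<and> good (w @ [i])]) ^^ n) []" for n
  define x where "x n = (SOME i. i \<in> S \<and> good (f n @ [i]))" for n
  have fS: "f (Suc n) = f n @ [x n]" for n by (simp add: f_def x_def)
  have some: "x n \<in> S \<and> good (f n @ [x n])" if "good (f n)" for n
    unfolding x_def by (rule someI_ex) (use step[OF that] in blast)
  have g: "good (f n)" for n
  proof (induction n)
    case 0 then show ?case using good0 by (simp add: f_def)
  next
    case (Suc n) then show ?case unfolding fS using some by blast
  qed
  have fx: "f n = map x [0..<n]" for n
    by (induction n) (simp_all add: fS, simp add: f_def)
  show ?thesis
  proof (rule that[of x])
    fix n
    from g[of n] obtain v where v: "set v \<subseteq> S" "1 \<le> a (map x [0..<n] @ v)"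
      unfolding good_def fx by blast
    then show "1 / C \<le> a (map x [0..<n])"
      by (rule prefix_lower_bound)
  qed (use g some in auto)
qed

text \<open>Only boundedly many words of each length have weight at least \<open>e\<close>. So among sufficiently many
  shifts of \<open>x\<close> two must coincide: otherwise long prefixes would separate all of them.\<close>

lemma heavy_sequence_eventually_periodic:
  assumes xS: "\<And>i. x i \<in> S" and e: "0 < e" "\<And>i m. e \<le> a (map x [i..<i+m])"
  obtains i j where "i < j" "\<And>t. x (i + t) = x (j + t)"
proof -
  define N where "N = nat \<lceil>C / e\<rceil>"
  have "\<not> inj_on (\<lambda>i t. x (i + t)) {..N}"
  proof
    assume inj: "inj_on (\<lambda>i t. x (i + t)) {..N}"
    define d where "d i j = (LEAST t. x (i + t) \<noteq> x (j + t))" for i j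
    have d: "x (i + d i j) \<noteq> x (j + d i j)" if ij: "i \<le> N" "j \<le> N" "i \<noteq> j" for i j
    proof -
      have "(\<lambda>t. x (i + t)) \<noteq> (\<lambda>t. x (j + t))" using inj_onD[OF inj, of i j] ij by auto
      then have "\<exists>t. x (i + t) \<noteq> x (j + t)" by (auto simp: fun_eq_iff)
      then show ?thesis unfolding d_def by (rule LeastI_ex)
    qed
    define L where "L = Suc (\<Sum>i\<le>N. \<Sum>j\<le>N. d i j)"
    have dL: "d i j < L" if "i \<le> N" "j \<le> N" for i j
    proof -
      have "d i j \<le> (\<Sum>j\<le>N. d i j)" using that by (intro member_le_sum) auto
      also have "\<dots> \<le> (\<Sum>i\<le>N. \<Sum>j\<le>N. d i j)"
        using that member_le_sum[of i "{..N}" "\<lambda>i. \<Sum>j\<le>N. d i j"] by auto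
      finally show ?thesis by (simp add: L_def)
    qed
    have inj': "inj_on (\<lambda>i. map x [i..<i+L]) {..N}"
    proof (rule inj_onI, rule ccontr)
      fix i j assume ij: "i \<in> {..N}" "j \<in> {..N}" "map x [i..<i+L] = map x [j..<j+L]" "i \<noteq> j"
      have "map x [l..<l+L] ! d i j = x (l + d i j)" for l using dL[of i j] ij by simp
      then show False using d[of i j] ij by (metis atMost_iff)
    qed
    have "real (card ((\<lambda>i. map x [i..<i+L]) ` {..N})) \<le> C / e"
      by (rule card_heavy_words[where n = L]) (use xS e in \<open>auto simp: words_def\<close>)
    then have "real (Suc N) \<le> C / e" by (simp add: card_image[OF inj'])
    moreover have "C / e \<le> real N" unfolding N_def by linarith
    ultimately show False by simp
  qed
  then obtain i j where "i < j" "(\<lambda>t. x (i + t)) = (\<lambda>t. x (j + t))"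
    unfolding inj_on_def by (metis nat_neq_iff)
  then show ?thesis by (intro that[of i j]) (auto simp: fun_eq_iff)
qed

text \<open>Suppose that \<open>w\<close> has positive weight but never occurs in \<open>y\<close>. Quasi-multiplicativity inserts
  \<open>w\<close> after any prefix of \<open>y\<close> and continues with a long stretch of \<open>y\<close>, with a weight that is bounded below
  independently of the place. Insertions at places that are far apart give different words, since the word
  with the later insertion copies \<open>y\<close> across the place of the earlier one. This contradicts the bound on
  the number of heavy words.\<close>

lemma positive_word_is_subword:
  assumes yS: "\<And>i. y i \<in> S" and e: "0 < e" "\<And>n. e \<le> a (map y [0..<n])"
    and w: "set w \<subseteq> S" "0 < a w"
  shows "\<exists>i. w = map y [i..<i + length w]"
proof (rule ccontr)
  assume not_sub: "\<not> ?thesis"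
  define \<eta> where "\<eta> = c * (e * (c * (a w * e))) / C"
  have \<eta>: "0 < \<eta>" unfolding \<eta>_def using c_pos e w C_ge_1 by auto
  define N where "N = nat \<lceil>C / \<eta>\<rceil>"
  \<comment> \<open>an insertion at \<open>j * q\<close>, connecting word included, is complete by position \<open>Suc j * q\<close>\<close>
  define q where "q = k + length w"
  define L where "L = Suc N * q"
  have "\<exists>u v. set v \<subseteq> S \<and> set u \<subseteq> S \<and> length u \<le> k \<and> \<eta> * C \<le> a (map y [0..<n] @ u @ w @ v) \<and>
     L \<le> length v" for n
  proof -
    let ?Y = "map y [0..<L]" and ?X = "map y [0..<n]"
    obtain u' where u': "set u' \<subseteq> S" "c * (a w * a ?Y) \<le> a (w @ u' @ ?Y)"
      using quasi_mult[of w ?Y] by blast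
    obtain u where u: "set u \<subseteq> S" "length u \<le> k"
      "c * (a ?X * a (w @ u' @ ?Y)) \<le> a (?X @ u @ w @ u' @ ?Y)"
      using quasi_mult[of ?X "w @ u' @ ?Y"] by blast
    have "c * (a w * e) \<le> c * (a w * a ?Y)"
      using e c_pos nonneg by (intro mult_left_mono) auto
    then have "c * (a w * e) \<le> a (w @ u' @ ?Y)" using u' by linarith
    then have "c * (e * (c * (a w * e))) \<le> c * (a ?X * a (w @ u' @ ?Y))"
      using c_pos e nonneg w by (intro mult_left_mono mult_mono) auto
    then have "\<eta> * C \<le> a (?X @ u @ w @ u' @ ?Y)" using u C_ge_1 by (simp add: \<eta>_def)
    then show ?thesis
      by (intro exI[of _ u] exI[of _ "u' @ ?Y"]) (use u u' yS in auto)
  qed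
  then obtain u v where uv: "\<And>n. set (v n) \<subseteq> S" "\<And>n. set (u n) \<subseteq> S" "\<And>n. length (u n) \<le> k"
    "\<And>n. \<eta> * C \<le> a (map y [0..<n] @ u n @ w @ v n)" "\<And>n. L \<le> length (v n)"
    by metis
  define full where "full n = map y [0..<n] @ u n @ w @ v n" for n
  define z where "z j = take L (full (j * q))" for j
  have fullS: "set (full n) \<subseteq> S" for n using uv(1,2)[of n] yS w by (auto simp: full_def)
  have zW: "z j \<in> words S L" for j
  proof -
    have "L \<le> length (full (j * q))" using uv(5)[of "j * q"] by (simp add: full_def)
    then show ?thesis
      using fullS[of "j * q"] set_take_subset[of L "full (j * q)"] by (auto simp: z_def words_def)
  qed
  have za: "\<eta> \<le> a (z j)" for j
  proof -
    have "\<eta> * C \<le> a (z j @ drop L (full (j * q)))"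
      using uv(4)[of "j * q"] unfolding z_def full_def append_take_drop_id .
    from prefix_lower_bound[OF _ this] show ?thesis
      using fullS[of "j * q"] set_drop_subset[of L "full (j * q)"] C_ge_1 by auto
  qed
  have occ: "take (length w) (drop (j * q + length (u (j * q))) (z j)) = w" if "j \<le> N" for j
  proof -
    have "j * q + (length (u (j * q)) + length w) \<le> j * q + q"
      using uv(3)[of "j * q"] by (simp add: q_def)
    also have "\<dots> \<le> L" using that by (simp add: L_def)
    finally show ?thesis
      unfolding z_def full_def drop_take by (simp add: take_take min_def)
  qed
  have neq: "z i \<noteq> z j" if ij: "i < j" "j \<le> N" for i j
  proof
    assume eq: "z i = z j"
    define p where "p = i * q + length (u (i * q))"
    have "p + length w \<le> i * q + q" using uv(3)[of "i * q"] by (simp add: p_def q_def)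
    also have "\<dots> = Suc i * q" by simp
    also have "\<dots> \<le> j * q" using ij by (intro mult_le_mono1) auto
    finally have pj: "p + length w \<le> j * q" .
    have jL: "j * q \<le> L" unfolding L_def using ij by (intro mult_le_mono1) auto
    have "w = take (length w) (drop p (z j))"
      using occ[of i] ij by (simp add: eq p_def)
    also have "\<dots> = take (length w) (drop p (take (j * q) (z j)))"
      using pj by (simp add: drop_take take_take min_def)
    also have "take (j * q) (z j) = map y [0..<j * q]"
      using jL by (simp add: z_def full_def take_take min_def)
    also have "take (length w) (drop p (map y [0..<j * q])) = map y [p..<p + length w]"
      using pj by (simp add: drop_map take_map)
    finally show False using not_sub by blast
  qed
  have inj: "inj_on z {..N}"
    by (rule inj_onI) (metis atMost_iff neq nat_neq_iff)
  have "real (card (z ` {..N})) \<le> C / \<eta>"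
    by (rule card_heavy_words[where n = L]) (use zW za \<eta> in auto)
  then have "real (Suc N) \<le> C / \<eta>" by (simp add: card_image[OF inj])
  moreover have "C / \<eta> \<le> real N" unfolding N_def by linarith
  ultimately show False by simp
qed

theorem positive_words_are_periodic_subwords:
  "\<exists>y p. 1 \<le> p \<and> (\<forall>i. y i \<in> S) \<and> (\<forall>i. y (i + p) = y i) \<and>
    (\<forall>w. set w \<subseteq> S \<longrightarrow> (0 < a w \<longleftrightarrow> (\<exists>i. w = map y [i..<i + length w])))"
proof -
  obtain x where x: "\<And>i. x i \<in> S" "\<And>n. 1 / C \<le> a (map x [0..<n])"
    using heavy_sequence by blast
  define e where "e = 1 / C / C"
  have e0: "0 < e" using C_ge_1 by (simp add: e_def)
  have e: "e \<le> a (map x [i..<i + m])" for i m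
  proof -
    have "map x [0..<i + m] = map x [0..<i] @ map x [i..<i + m]"
      by (metis map_append upt_add_eq_append zero_le)
    then have "1 / C \<le> a (map x [0..<i] @ map x [i..<i + m])" using x(2)[of "i + m"] by simp
    from suffix_lower_bound[OF _ this] show ?thesis using x(1) by (auto simp: e_def)
  qed
  obtain i j where ij: "i < j" "\<And>t. x (i + t) = x (j + t)"
    using heavy_sequence_eventually_periodic[OF x(1) e0 e] by blast
  define y where "y t = x (i + t)" for t
  have ymap: "map y [l..<l + m] = map x [i + l..<i + l + m]" for l m
    by (rule nth_equalityI) (auto simp: y_def add.assoc)
  show ?thesis
  proof (intro exI[of _ y] exI[of _ "j - i"] conjI allI impI)
    show "y (l + (j - i)) = y l" for l
      using ij(1) ij(2)[of l] by (simp add: y_def add.commute)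
    fix w assume w: "set w \<subseteq> S"
    show "0 < a w \<longleftrightarrow> (\<exists>i. w = map y [i..<i + length w])"
    proof
      assume "0 < a w"
      then show "\<exists>i. w = map y [i..<i + length w]"
        using e[of i] ymap[of 0] x(1) e0
        by (intro positive_word_is_subword[OF _ e0 _ w]) (auto simp: y_def)
    next
      assume "\<exists>i. w = map y [i..<i + length w]"
      then obtain l where l: "w = map y [l..<l + length w]" by blast
      have "e \<le> a (map y [l..<l + length w])" unfolding ymap by (rule e)
      then show "0 < a w" using e0 l by simp
    qed
  qed (use ij x(1) in \<open>auto simp: y_def\<close>)
qed

end

section \<open>Linear algebra of a periodic language\<close>

lemma periodic_mult:
  fixes y :: "nat \<Rightarrow> 'b"
  assumes "\<And>i. y (i + n) = y i"
  shows "y (j + k * n) = y j"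
proof (induction k)
  case (Suc k)
  have "j + Suc k * n = (j + k * n) + n" by simp
  then show ?case using Suc assms by metis
qed simp

lemma periodic_mod:
  fixes y :: "nat \<Rightarrow> 'b"
  assumes "\<And>i. y (i + n) = y i"
  shows "y (i mod n) = y i"
  using periodic_mult[of y n "i mod n" "i div n", OF assms] by simp

lemma rotate_periodic_window:
  fixes y :: "nat \<Rightarrow> 'b"
  assumes "1 \<le> n" and per: "\<And>i. y (i + n) = y i"
  shows "rotate i (map y [0..<n]) = map y [i..<i + n]"
proof (rule nth_equalityI)
  note mod = periodic_mod[of y n, OF per]
  fix t assume "t < length (rotate i (map y [0..<n]))"
  then show "rotate i (map y [0..<n]) ! t = map y [i..<i + n] ! t"
    using assms(1) mod[of "i + t"] by (simp add: nth_rotate)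
qed simp

text \<open>For the least period the windows of one full period are pairwise distinct: two equal windows would
  make their distance a smaller period.\<close>

lemma minimal_period:
  fixes y :: "nat \<Rightarrow> 'b"
  assumes "1 \<le> p" "\<And>i. y (i + p) = y i"
  obtains n where "1 \<le> n" "\<And>i. y (i + n) = y i"
    "\<And>i j. i < j \<Longrightarrow> j < n \<Longrightarrow> map y [i..<i + n] \<noteq> map y [j..<j + n]"
proof -
  define n where "n = (LEAST n. 1 \<le> n \<and> (\<forall>i. y (i + n) = y i))"
  have "1 \<le> n \<and> (\<forall>i. y (i + n) = y i)"
    unfolding n_def by (rule LeastI[of _ p]) (use assms in auto)
  then have n: "1 \<le> n" "\<And>i. y (i + n) = y i" by auto
  note mult = periodic_mult[of y n, OF n(2)]
  show ?thesis
  proof (rule that[OF n])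
    fix i j assume ij: "i < j" "j < n"
    show "map y [i..<i + n] \<noteq> map y [j..<j + n]"
    proof
      assume eq: "map y [i..<i + n] = map y [j..<j + n]"
      have small: "y (i + t) = y (j + t)" if "t < n" for t
        using arg_cong[OF eq, of "\<lambda>l. l ! t"] that by simp
      have all: "y (i + t) = y (j + t)" for t
      proof -
        have "y (l + t) = y (l + t mod n)" for l
          using mult[of "l + t mod n" "t div n"] by (simp add: add.assoc)
        then show ?thesis using small[of "t mod n"] n(1) by simp
      qed
      have "y (l + (j - i)) = y l" for l
      proof -
        obtain m d where "n = Suc m" "j = i + d"
          using n(1) ij(1) by (metis Suc_le_D One_nat_def less_imp_add_positive)
        then have e: "i + (l + i * (n - 1)) = l + i * n" "j + (l + i * (n - 1)) = l + (j - i) + i * n"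
          by simp_all
        show ?thesis using all[of "l + i * (n - 1)"] mult[of l i] mult[of "l + (j - i)" i]
          unfolding e by metis
      qed
      then have "n \<le> j - i" unfolding n_def by (intro Least_le) (use ij in auto)
      then show False using ij by simp
    qed
  qed
qed

text \<open>The summands are the ranges of the products \<open>B i\<close> along one full period. The key point is that
  a vector killed by all \<open>B i\<close> is zero: such vectors form the space killed by all words of length
  \<open>n\<close>, which is invariant. Together with \<open>B j ** B i = 0\<close> for \<open>i \<noteq> j\<close> this makes each \<open>B i\<close> injective on
  its own range and gives both existence and uniqueness of the decomposition of a vector. The letters of the
  period map each summand injectively into the next, so around the cycle all dimensions agree.\<close>

theorem periodic_language_decomposition:
  fixes A :: "nat \<Rightarrow> real^'d^'d" and y :: "nat \<Rightarrow> nat"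
  assumes irr: "irreducible_tuple M A"
    and p: "1 \<le> p" "\<And>i. y (i + p) = y i" and yS: "\<And>i. y i \<in> {1..M}"
    and lang: "\<And>w. set w \<subseteq> {1..M} \<Longrightarrow> word_prod A w \<noteq> 0 \<longleftrightarrow> (\<exists>i. w = map y [i..<i + length w])"
  shows "\<exists>n r (w :: nat list) (R :: nat \<Rightarrow> (real^'d) set).
         n \<ge> 1 \<and> r \<ge> 1 \<and> n * r = CARD('d) \<and>
         length w = n \<and> set w \<subseteq> {1..M} \<and>
         direct_sum_decomposition {..<n} R \<and> (\<forall>j<n. dim (R j) = r) \<and>
         (\<forall>i\<in>{1..M}. \<forall>j<n. i \<noteq> w ! j \<longrightarrow> (*v) (A i) ` R j = {0}) \<and>
         (\<forall>j. j + 1 < n \<longrightarrow> (*v) (A (w ! j)) ` R j = R (j + 1)) \<and>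
         (*v) (A (w ! (n - 1))) ` R (n - 1) = R 0 \<and>
         (\<forall>i<n. bij_betw ((*v) (word_prod A (rotate i w))) (R i) (R i)) \<and>
         (\<forall>x. length x = n \<and> set x \<subseteq> {1..M} \<longrightarrow>
            (word_prod A x \<noteq> 0 \<longleftrightarrow> (\<exists>i\<in>{1..n}. x = rotate i w)))"
proof -
  obtain n where n: "1 \<le> n" "\<And>i. y (i + n) = y i"
    and distinct: "\<And>i j. i < j \<Longrightarrow> j < n \<Longrightarrow> map y [i..<i + n] \<noteq> map y [j..<j + n]"
    using minimal_period[of p y] p by blast
  define win where "win i = map y [i..<i + n]" for i
  have win_len: "length (win i) = n" and win_set: "set (win i) \<subseteq> {1..M}" for i
    using yS by (auto simp: win_def)
  have win_inj: "win i = win j \<Longrightarrow> i < n \<Longrightarrow> j < n \<Longrightarrow> i = j" for i j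
    using distinct[of i j] distinct[of j i] by (cases i j rule: linorder_cases) (auto simp: win_def)
  have win_per: "win (i + n) = win i" for i
  proof -
    have "win (i + n) = map (\<lambda>t. y (t + n)) [i..<i + n]"
      unfolding win_def by (rule nth_equalityI) (auto simp: ac_simps)
    then show ?thesis by (simp add: n(2) win_def)
  qed
  define B where "B i = word_prod A (win i)" for i
  define R where "R i = range ((*v) (B i))" for i
  have B_nz: "B i \<noteq> 0" for i
    unfolding B_def by (subst lang[OF win_set]) (auto simp: win_def)
  have subR: "subspace (R i)" for i
    unfolding R_def by (intro linear_subspace_image subspace_UNIV) simp
  have cycle: "A (y i) ** B i = B (Suc i) ** A (y i)" for i
  proof -
    have "win i @ [y i] = map y [i..<Suc (i + n)]" using n by (simp add: win_def)
    also have "\<dots> = y i # win (Suc i)" unfolding win_def by (subst upt_conv_Cons) auto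
    finally have "word_prod A (win i @ [y i]) = word_prod A (y i # win (Suc i))" by simp
    then show ?thesis by (simp add: B_def word_prod_snoc)
  qed
  have other: "A a ** B i = 0" if a: "a \<in> {1..M}" "a \<noteq> y i" for a i
  proof (rule ccontr)
    assume "A a ** B i \<noteq> 0"
    then have "word_prod A (win i @ [a]) \<noteq> 0" by (simp add: B_def word_prod_snoc)
    then obtain j where j: "win i @ [a] = map y [j..<j + Suc n]"
      using lang[of "win i @ [a]"] win_set[of i] win_len[of i] a by auto
    have "y i = map y [j..<j + Suc n] ! 0"
      unfolding j[symmetric] using n(1) by (simp add: win_def nth_append)
    moreover have "a = map y [j..<j + Suc n] ! n"
      unfolding j[symmetric] by (simp add: win_len nth_append)
    ultimately show False using n a by (simp del: upt_Suc)
  qed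
  have BB: "B j ** B i = 0" if "i < n" "j < n" "i \<noteq> j" for i j
  proof (rule ccontr)
    assume "B j ** B i \<noteq> 0"
    then have "word_prod A (win i @ win j) \<noteq> 0" by (simp add: B_def word_prod_append)
    then obtain l where l: "win i @ win j = map y [l..<l + (n + n)]"
      using lang[of "win i @ win j"] win_set win_len by auto
    \<comment> \<open>two consecutive full periods of \<open>y\<close> spell the same word\<close>
    have "map y [l..<l + (n + n)] = win l @ win (l + n)"
      unfolding win_def by (metis add.assoc le_add1 map_append upt_add_eq_append)
    then have "win i = win l" "win j = win (l + n)"
      using l win_len by auto
    then show False using win_per win_inj that by metis
  qed
  have ker0: "v = 0" if v: "\<And>i. i < n \<Longrightarrow> B i *v v = 0" for v
  proof -
    define K where "K = {v. \<forall>w. set w \<subseteq> {1..M} \<and> length w = n \<longrightarrow> word_prod A w *v v = 0}"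
    have "subspace K" unfolding K_def subspace_def
      by (auto simp: matrix_vector_right_distrib matrix_vector_mult_scaleR)
    moreover have "(*v) (A a) ` K \<subseteq> K" if "a \<in> {1..M}" for a
    proof safe
      fix v assume "v \<in> K"
      show "A a *v v \<in> K" unfolding K_def
      proof safe
        fix w assume w: "set w \<subseteq> {1..M}" "n = length w"
        then obtain u b where ub: "w = u @ [b]" using n(1) by (cases w rule: rev_cases) auto
        have "word_prod A w *v (A a *v v) = word_prod A ((a # u) @ [b]) *v v"
          by (simp add: ub matrix_vector_mul_assoc)
        also have "\<dots> = A b *v (word_prod A (a # u) *v v)"
          by (simp only: word_prod_snoc matrix_vector_mul_assoc)
        also have "word_prod A (a # u) *v v = 0"
          using \<open>v \<in> K\<close> w that ub unfolding K_def by (simp del: word_prod.simps)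
        finally show "word_prod A w *v (A a *v v) = 0" by simp
      qed
    qed
    ultimately have "K = {0} \<or> K = UNIV" by (intro irreducible_invariant_cases[OF irr])
    moreover have "K \<noteq> UNIV"
    proof
      assume "K = UNIV"
      then have "B 0 *v v = 0" for v using win_set[of 0] win_len[of 0] by (auto simp: K_def B_def)
      then show False using B_nz[of 0] by (metis matrix_eq matrix_vector_mult_0)
    qed
    moreover have "v \<in> K" unfolding K_def
    proof safe
      fix w assume w: "set w \<subseteq> {1..M}" "n = length w"
      show "word_prod A w *v v = 0"
      proof (cases "word_prod A w = 0")
        case False
        then obtain i where "w = win i" using lang[OF w(1)] w by (auto simp: win_def)
        also have "win i = win (i mod n)"
          by (rule periodic_mod[of win, OF win_per, symmetric])
        finally show ?thesis using v[of "i mod n"] n(1) by (simp add: B_def)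
      qed simp
    qed
    ultimately show "v = 0" by auto
  qed
  have BR0: "B j *v v = 0" if "v \<in> R i" "i < n" "j < n" "i \<noteq> j" for i j v
    using that BB[of i j] by (auto simp: R_def matrix_vector_mul_assoc)
  have R_per: "R (i + n) = R i" for i by (simp add: R_def B_def win_per)
  have inj_small: "v = 0" if "v \<in> R i" "i < n" "B i *v v = 0" for i v
    by (rule ker0) (metis BR0 that)
  have inj_zero: "v = 0" if "v \<in> R i" "i \<le> n" "B i *v v = 0" for i v
  proof (cases "i = n")
    case True
    then show ?thesis
      using that inj_small[of v 0] n(1) R_per[of 0] win_per[of 0] by (simp add: B_def)
  qed (use that inj_small in auto)
  have linj: "inj_on ((*v) C) (R i)" if "\<And>v. v \<in> R i \<Longrightarrow> C *v v = 0 \<Longrightarrow> v = 0"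
    for i and C :: "real^'d^'d"
    using linear_injective_on_subspace_0[of "(*v) C" "R i"] subR that by auto
  have eq_dim: "T1 = T2" if "subspace T1" "subspace T2" "T1 \<subseteq> T2" "dim T2 \<le> dim T1"
    for T1 T2 :: "(real^'d) set"
    using subspace_dim_equal[OF that] .
  have Bself: "(*v) (B i) ` R i = R i" and Binj: "inj_on ((*v) (B i)) (R i)" if "i < n" for i
  proof -
    show inj: "inj_on ((*v) (B i)) (R i)"
      using inj_small that by (intro linj)
    have "dim ((*v) (B i) ` R i) = dim (R i)"
      by (rule dim_image_eq) (use inj subR in \<open>auto simp: span_eq_iff[THEN iffD2]\<close>)
    then show "(*v) (B i) ` R i = R i"
      by (intro eq_dim linear_subspace_image subR) (auto simp: R_def)
  qed
  have Asub: "(*v) (A (y i)) ` R i \<subseteq> R (Suc i)" for i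
    using cycle[of i] by (auto simp: R_def matrix_vector_mul_assoc) (metis matrix_vector_mul_assoc rangeI)
  have Adim: "dim ((*v) (A (y i)) ` R i) = dim (R i)" if "i < n" for i
  proof -
    have "v = 0" if v: "v \<in> R i" "A (y i) *v v = 0" for v
    proof -
      have "win i = y i # map y [Suc i..<i + n]"
        unfolding win_def using n(1) by (subst upt_conv_Cons) auto
      then have "B i = word_prod A (map y [Suc i..<i + n]) ** A (y i)" by (simp add: B_def)
      then have "B i *v v = 0" using v by (simp flip: matrix_vector_mul_assoc)
      then show "v = 0" using inj_small v \<open>i < n\<close> by blast
    qed
    then have "inj_on ((*v) (A (y i))) (R i)" by (intro linj)
    then show ?thesis by (intro dim_image_eq) (use subR in \<open>auto simp: span_eq_iff[THEN iffD2]\<close>)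
  qed
  define r where "r = dim (R 0)"
  have mono: "dim (R i) \<le> dim (R (Suc i))" if "i < n" for i
    using Adim[OF that] dim_subset[OF Asub[of i]] by simp
  have le: "i \<le> j \<Longrightarrow> j \<le> n \<Longrightarrow> dim (R i) \<le> dim (R j)" for i j
    by (induction j rule: dec_induct) (use mono in \<open>auto intro: order_trans\<close>)
  have dimR: "dim (R i) = r" if "i \<le> n" for i
    using le[of 0 i] le[of i n] that R_per[of 0] by (simp add: r_def)
  have Aeq: "(*v) (A (y i)) ` R i = R (Suc i)" if "i < n" for i
    using Asub Adim[OF that] dimR that
    by (intro eq_dim linear_subspace_image subR) auto
  have r1: "1 \<le> r"
  proof (rule ccontr)
    assume "\<not> 1 \<le> r"
    then have "dim (R 0) = 0" unfolding r_def by linarith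
    then have "R 0 \<subseteq> {0}" by (simp only: dim_eq_0)
    then have "B 0 *v v = 0" for v by (auto simp: R_def)
    then show False using B_nz[of 0] by (metis matrix_eq matrix_vector_mult_0)
  qed
  have Bsum: "B j *v (\<Sum>i<k. f i) = (if j < k then B j *v f j else 0)"
    if f: "\<And>i. i < k \<Longrightarrow> f i \<in> R i" and "k \<le> n" "j < n" for f k j
  proof -
    have "B j *v (\<Sum>i<k. f i) = (\<Sum>i<k. B j *v f i)"
      using linear_sum[OF matrix_vector_mul_linear] by blast
    also have "\<dots> = (\<Sum>i<k. if i = j then B j *v f j else 0)"
      using that BR0[OF f] by (intro sum.cong) auto
    finally show ?thesis by simp
  qed
  have exist: "\<exists>f. (\<forall>i<n. f i \<in> R i) \<and> v = (\<Sum>i<n. f i)" for v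
  proof -
    have "\<forall>i. \<exists>g. i < n \<longrightarrow> g \<in> R i \<and> B i *v g = B i *v v"
      using Bself by (metis R_def imageE rangeI)
    then obtain f where f: "\<And>i. i < n \<Longrightarrow> f i \<in> R i" "\<And>i. i < n \<Longrightarrow> B i *v f i = B i *v v"
      by metis
    have "v - (\<Sum>i<n. f i) = 0"
      by (rule ker0) (simp add: matrix_vector_mult_diff_distrib Bsum f)
    then show ?thesis using f by auto
  qed
  have direct: "direct_sum_decomposition {..<n} R"
    unfolding direct_sum_decomposition_def
  proof (intro conjI ballI allI subR)
    fix v
    obtain f where f: "\<forall>i<n. f i \<in> R i" "v = (\<Sum>i<n. f i)" using exist by blast
    show "\<exists>!f. f \<in> (\<Pi>\<^sub>E i\<in>{..<n}. R i) \<and> v = (\<Sum>i<n. f i)"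
    proof (rule ex1I[of _ "restrict f {..<n}"])
      show "restrict f {..<n} \<in> (\<Pi>\<^sub>E i\<in>{..<n}. R i) \<and> v = (\<Sum>i<n. restrict f {..<n} i)"
        using f by auto
      fix g assume g: "g \<in> (\<Pi>\<^sub>E i\<in>{..<n}. R i) \<and> v = (\<Sum>i<n. g i)"
      show "g = restrict f {..<n}"
      proof (rule extensionalityI[of _ "{..<n}"])
        fix i assume "i \<in> {..<n}"
        then have i: "i < n" by simp
        have "B i *v g i = B i *v f i"
          using Bsum[of n g i] Bsum[of n f i] f g i by (auto simp: PiE_iff)
        then have "g i = f i" using Binj[OF i] g f i by (auto simp: PiE_iff dest: inj_onD)
        then show "g i = restrict f {..<n} i" using i by simp
      qed (use g in \<open>auto simp: PiE_iff\<close>)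
    qed
  qed
  have sums: "subspace {\<Sum>i<k. f i | f. \<forall>i<k. f i \<in> R i} \<and>
      dim {\<Sum>i<k. f i | f. \<forall>i<k. f i \<in> R i} = k * r" if "k \<le> n" for k
    using that
  proof (induction k)
    case 0
    then show ?case by (auto simp: subspace_0 dim_eq_0)
  next
    case (Suc k)
    let ?D = "{\<Sum>i<k. f i | f. \<forall>i<k. f i \<in> R i}"
    have eq: "{\<Sum>i<Suc k. f i | f. \<forall>i<Suc k. f i \<in> R i} = {x + z | x z. x \<in> ?D \<and> z \<in> R k}" (is "?L = ?P")
    proof
      show "?L \<subseteq> ?P" by fastforce
      show "?P \<subseteq> ?L"
      proof safe
        fix f z assume "\<forall>i<k. f i \<in> R i" "z \<in> R k"
        then show "\<exists>g. (\<Sum>i<k. f i) + z = (\<Sum>i<Suc k. g i) \<and> (\<forall>i<Suc k. g i \<in> R i)"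
          by (intro exI[of _ "f(k := z)"]) (auto simp: less_Suc_eq)
      qed
    qed
    have "?D \<inter> R k \<subseteq> {0}"
    proof safe
      fix f assume f: "\<forall>i<k. f i \<in> R i" "(\<Sum>i<k. f i) \<in> R k"
      have "B k *v (\<Sum>i<k. f i) = 0" using Bsum[of k f k] f Suc.prems by simp
      then show "(\<Sum>i<k. f i) = 0" using inj_small[OF f(2)] Suc.prems by auto
    qed
    then have int: "dim (?D \<inter> R k) = 0" by (simp only: dim_eq_0)
    have IH: "subspace ?D" "dim ?D = k * r" using Suc by auto
    have "dim ?P + 0 = k * r + r"
      using dim_sums_Int[OF IH(1) subR[of k]] dimR[of k] Suc.prems unfolding int IH(2) by simp
    then show ?case
      unfolding eq using subspace_sums[OF IH(1) subR[of k]] by (auto simp: add.commute)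
  qed
  have nr: "n * r = CARD('d)"
  proof -
    have "{\<Sum>i<n. f i | f. \<forall>i<n. f i \<in> R i} = UNIV" using exist by blast
    then show ?thesis using sums[of n] by simp
  qed
  define w where "w = map y [0..<n]"
  have rot: "rotate i w = win i" for i
    unfolding w_def win_def by (rule rotate_periodic_window) (use n in auto)
  have wnth: "w ! i = y i" if "i < n" for i using that by (simp add: w_def)
  have words: "word_prod A x \<noteq> 0 \<longleftrightarrow> (\<exists>i\<in>{1..n}. x = rotate i w)"
    if x: "length x = n" "set x \<subseteq> {1..M}" for x
  proof
    assume "word_prod A x \<noteq> 0"
    then obtain i where i: "x = win i" using lang[OF x(2)] x by (auto simp: win_def)
    have rm: "rotate i w = rotate (i mod n) w" by (metis rotate_conv_mod length_map length_upt diff_zero w_def)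
    show "\<exists>i\<in>{1..n}. x = rotate i w"
    proof (cases "i mod n = 0")
      case True
      then show ?thesis using i rot rm n(1) win_per[of 0] by (intro bexI[of _ n]) (auto simp: w_def win_def)
    next
      case False
      have "i mod n < n" using n(1) by simp
      with False show ?thesis using i rot rm
        by (intro bexI[of _ "i mod n"]) auto
    qed
  next
    assume "\<exists>i\<in>{1..n}. x = rotate i w"
    then show "word_prod A x \<noteq> 0" using B_nz by (auto simp: rot B_def)
  qed
  show ?thesis
  proof (intro exI conjI)
    show "\<forall>i\<in>{1..M}. \<forall>j<n. i \<noteq> w ! j \<longrightarrow> (*v) (A i) ` R j = {0}"
    proof (intro ballI allI impI)
      fix a j assume a: "a \<in> {1..M}" "j < n" "a \<noteq> w ! j"
      then have "A a ** B j = 0" using other wnth by auto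
      then have "A a *v v = 0" if "v \<in> R j" for v
        using that by (auto simp: R_def matrix_vector_mul_assoc)
      then show "(*v) (A a) ` R j = {0}" using subspace_0[OF subR[of j]] by force
    qed
    show "\<forall>j. j + 1 < n \<longrightarrow> (*v) (A (w ! j)) ` R j = R (j + 1)"
      using Aeq wnth by auto
    show "(*v) (A (w ! (n - 1))) ` R (n - 1) = R 0"
      using Aeq[of "n - 1"] wnth[of "n - 1"] n(1) R_per[of 0] by auto
    show "\<forall>i<n. bij_betw ((*v) (word_prod A (rotate i w))) (R i) (R i)"
      using Bself Binj by (auto simp: bij_betw_def rot B_def)
    show "\<forall>j<n. dim (R j) = r" using dimR by auto
    show "\<forall>x. length x = n \<and> set x \<subseteq> {1..M} \<longrightarrow>
            (word_prod A x \<noteq> 0 \<longleftrightarrow> (\<exists>i\<in>{1..n}. x = rotate i w))"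
      using words by blast
    show "set w \<subseteq> {1..M}" using yS by (auto simp: w_def)
  qed (use n r1 nr direct in \<open>auto simp: w_def\<close>)
qed

section \<open>Coding a measure-preserving map by a partition\<close>

locale measure_preserving = prob_space \<nu> for \<nu> :: "'a measure" +
  fixes T :: "'a \<Rightarrow> 'a"
  assumes T_measurable [measurable]: "T \<in> measurable \<nu> \<nu>"
    and T_preserving: "B \<in> sets \<nu> \<Longrightarrow> emeasure \<nu> (T -` B \<inter> space \<nu>) = emeasure \<nu> B"
begin

text \<open>The atoms of the iterated partition of a partition \<open>P\<close> are the nonempty sets
  \<open>itinerary_set l\<close>, with \<open>l\<close> a list of blocks of \<open>P\<close>. The dynamical entropy of \<open>P\<close> thus becomes the block entropy of a
  stationary weight on words over the alphabet \<open>P\<close>.\<close>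

definition itinerary_set :: "'a set list \<Rightarrow> 'a set" where
  "itinerary_set l = {x \<in> space \<nu>. \<forall>i<length l. (T ^^ i) x \<in> l ! i}"

definition coding_weight :: "'a set list \<Rightarrow> real" where
  "coding_weight l = measure \<nu> (itinerary_set l)"

lemma funpow_space: "x \<in> space \<nu> \<Longrightarrow> (T ^^ i) x \<in> space \<nu>"
  by (induction i) (auto intro: measurable_space[OF T_measurable])

lemma itinerary_set_Nil: "itinerary_set [] = space \<nu>"
  by (simp add: itinerary_set_def)

lemma itinerary_set_Cons: "itinerary_set (B # l) = B \<inter> (T -` itinerary_set l \<inter> space \<nu>)"
proof -
  have "(\<forall>i<length (B # l). (T ^^ i) x \<in> (B # l) ! i) \<longleftrightarrow>
      x \<in> B \<and> (\<forall>i<length l. (T ^^ i) (T x) \<in> l ! i)" for x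
    by (simp add: All_less_Suc2 funpow_swap1)
  then show ?thesis
    using measurable_space[OF T_measurable] by (auto simp: itinerary_set_def)
qed

lemma itinerary_set_snoc: "itinerary_set (l @ [B]) = {x \<in> itinerary_set l. (T ^^ length l) x \<in> B}"
  by (auto simp: itinerary_set_def nth_append less_Suc_eq)

lemma itinerary_set_measurable:
  assumes "set l \<subseteq> sets \<nu>"
  shows "itinerary_set l \<in> sets \<nu>"
  using assms
proof (induction l)
  case (Cons B l)
  then have "T -` itinerary_set l \<inter> space \<nu> \<in> sets \<nu>"
    by (intro measurable_sets[OF T_measurable]) simp
  then show ?case using Cons.prems by (simp add: itinerary_set_Cons sets.Int)
qed (simp add: itinerary_set_Nil)

end

locale finite_partition = measure_preserving +
  fixes P :: "'a set set"
  assumes finite_P: "finite P" and partition_P: "partition_on (space \<nu>) P" and P_sets: "P \<subseteq> sets \<nu>"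
begin

lemma ex1_block:
  assumes "x \<in> space \<nu>"
  shows "\<exists>!B. B \<in> P \<and> x \<in> B"
proof -
  have "x \<in> \<Union>P" using assms partition_P by (simp add: partition_on_def)
  moreover have "B = B'" if "B \<in> P" "B' \<in> P" "x \<in> B" "x \<in> B'" for B B'
    using that partition_P by (auto simp: partition_on_def dest: disjointD)
  ultimately show ?thesis by auto
qed

lemma stationary_coding_weight: "stationary_weight P coding_weight"
  unfolding stationary_weight_def
proof (intro conjI allI impI finite_P)
  show "0 \<le> coding_weight l" for l by (simp add: coding_weight_def)
  show "coding_weight [] = 1" by (simp add: coding_weight_def itinerary_set_Nil prob_space)
  fix l assume l: "set l \<subseteq> P"
  then have ls: "set l \<subseteq> sets \<nu>" using P_sets by auto
  have "coding_weight l = measure \<nu> (\<Union>B\<in>P. itinerary_set (l @ [B]))"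
  proof -
    have "itinerary_set l = (\<Union>B\<in>P. itinerary_set (l @ [B]))"
    proof safe
      fix x assume x: "x \<in> itinerary_set l"
      then have "x \<in> space \<nu>" by (simp add: itinerary_set_def)
      then obtain B where "B \<in> P" "(T ^^ length l) x \<in> B" using ex1_block[OF funpow_space] by blast
      then show "x \<in> (\<Union>B\<in>P. itinerary_set (l @ [B]))" using x by (auto simp: itinerary_set_snoc)
    qed (simp add: itinerary_set_snoc)
    then show ?thesis by (simp add: coding_weight_def)
  qed
  also have "\<dots> = (\<Sum>B\<in>P. coding_weight (l @ [B]))"
    unfolding coding_weight_def
  proof (rule finite_measure_finite_Union[OF finite_P])
    show "disjoint_family_on (\<lambda>B. itinerary_set (l @ [B])) P"
      unfolding disjoint_family_on_def itinerary_set_snoc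
    proof (intro ballI impI equals0I)
      fix B B' x assume "B \<in> P" "B' \<in> P" "B \<noteq> B'"
        "x \<in> {x \<in> itinerary_set l. (T ^^ length l) x \<in> B} \<inter> {x \<in> itinerary_set l. (T ^^ length l) x \<in> B'}"
      then show False
        using ex1_block[OF funpow_space, of x "length l"] by (auto simp: itinerary_set_def)
    qed
  qed (use ls P_sets in \<open>auto intro!: itinerary_set_measurable\<close>)
  finally show "(\<Sum>B\<in>P. coding_weight (l @ [B])) = coding_weight l" by simp
  have "coding_weight l = measure \<nu> (T -` itinerary_set l \<inter> space \<nu>)"
    using T_preserving[OF itinerary_set_measurable[OF ls]] by (simp add: coding_weight_def measure_def)
  also have "\<dots> = measure \<nu> (\<Union>B\<in>P. itinerary_set (B # l))"
  proof -
    have "T -` itinerary_set l \<inter> space \<nu> = (\<Union>B\<in>P. itinerary_set (B # l))"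
    proof (intro equalityI subsetI)
      fix x assume x: "x \<in> T -` itinerary_set l \<inter> space \<nu>"
      then obtain B where "B \<in> P" "x \<in> B" using ex1_block[of x] by blast
      then show "x \<in> (\<Union>B\<in>P. itinerary_set (B # l))" using x by (auto simp: itinerary_set_Cons)
    qed (simp add: itinerary_set_Cons)
    then show ?thesis by simp
  qed
  also have "\<dots> = (\<Sum>B\<in>P. coding_weight (B # l))"
    unfolding coding_weight_def
  proof (rule finite_measure_finite_Union[OF finite_P])
    show "disjoint_family_on (\<lambda>B. itinerary_set (B # l)) P"
      unfolding disjoint_family_on_def itinerary_set_Cons using ex1_block by blast
  qed (use ls P_sets in \<open>auto intro!: itinerary_set_measurable\<close>)
  finally show "(\<Sum>B\<in>P. coding_weight (B # l)) = coding_weight l" by simp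
qed

text \<open>Pullbacks of \<open>P\<close> under different iterates of \<open>T\<close> may coincide as partitions, so a choice of one
  block from each member of the refined family is weaker than a list of blocks. The point that a nonempty
  itinerary set contains resolves this: it determines one block in each pullback.\<close>

lemma iterated_partition_eq:
  assumes "1 \<le> n"
  shows "iterated_partition \<nu> T P n = itinerary_set ` words P n - {{}}"
proof -
  define Q where "Q i = pullback_partition \<nu> (T ^^ i) P" for i
  have Q: "D \<in> Q i \<longleftrightarrow> D \<noteq> {} \<and> (\<exists>B\<in>P. D = (T ^^ i) -` B \<inter> space \<nu>)" for D i
    by (auto simp: Q_def pullback_partition_def)
  have I: "itinerary_set l = (\<Inter>i<n. (T ^^ i) -` (l ! i) \<inter> space \<nu>)" if "length l = n" for l
  proof -
    have "0 < n" using assms by simp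
    then show ?thesis using that by (auto simp: itinerary_set_def)
  qed
  have fwd: "X \<in> itinerary_set ` words P n" if X: "X = \<Inter> (f ` Q ` {..<n})" "f \<in> (\<Pi> q\<in>Q ` {..<n}. q)" for X f
  proof -
    have "\<forall>i. \<exists>B. i < n \<longrightarrow> B \<in> P \<and> f (Q i) = (T ^^ i) -` B \<inter> space \<nu>"
      using X(2) Q by (metis PiE Pi_mem imageI lessThan_iff)
    then obtain b where b: "\<And>i. i < n \<Longrightarrow> b i \<in> P \<and> f (Q i) = (T ^^ i) -` b i \<inter> space \<nu>"
      by metis
    have "X = itinerary_set (map b [0..<n])"
      using b by (subst I) (auto simp: X(1))
    moreover have "map b [0..<n] \<in> words P n" using b by (auto simp: words_def)
    ultimately show ?thesis by blast
  qed
  have bwd: "itinerary_set l \<in> (\<lambda>f. \<Inter> (f ` Q ` {..<n})) ` (\<Pi> q\<in>Q ` {..<n}. q)"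
    if l: "l \<in> words P n" "x \<in> itinerary_set l" for l x
  proof -
    have len: "length l = n" and lP: "\<And>i. i < n \<Longrightarrow> l ! i \<in> P" using l by (auto simp: words_def)
    have x: "x \<in> space \<nu>" "\<And>i. i < n \<Longrightarrow> (T ^^ i) x \<in> l ! i"
      using l len by (auto simp: itinerary_set_def)
    define f where "f q = (SOME D. D \<in> q \<and> x \<in> D)" for q
    have fQ: "f (Q i) = (T ^^ i) -` (l ! i) \<inter> space \<nu>" if "i < n" for i
      unfolding f_def
    proof (rule some_equality)
      show "(T ^^ i) -` l ! i \<inter> space \<nu> \<in> Q i \<and> x \<in> (T ^^ i) -` l ! i \<inter> space \<nu>"
        using x that lP by (auto simp: Q)
      fix D assume "D \<in> Q i \<and> x \<in> D"
      then obtain B where "B \<in> P" "D = (T ^^ i) -` B \<inter> space \<nu>" "(T ^^ i) x \<in> B" by (auto simp: Q)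
      moreover from this have "B = l ! i"
        using ex1_block[OF funpow_space[OF x(1)], of i] lP[OF that] x(2)[OF that] by blast
      ultimately show "D = (T ^^ i) -` l ! i \<inter> space \<nu>" by simp
    qed
    have "f \<in> (\<Pi> q\<in>Q ` {..<n}. q)"
    proof (rule Pi_I)
      fix q assume "q \<in> Q ` {..<n}"
      then obtain i where i: "i < n" "q = Q i" by auto
      have "x \<in> (T ^^ i) -` (l ! i) \<inter> space \<nu>" using x i by auto
      then show "f q \<in> q" using i lP unfolding i(2) fQ[OF i(1)] Q by blast
    qed
    moreover have "itinerary_set l = \<Inter> (f ` Q ` {..<n})" by (simp add: I[OF len] fQ image_image)
    ultimately show ?thesis by blast
  qed
  show ?thesis
    unfolding iterated_partition_def common_refinement Q_def[symmetric]
  proof (intro equalityI subsetI)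
    fix X assume "X \<in> (\<Union>f\<in>(\<Pi> q\<in>Q ` {..<n}. q). {\<Inter> (f ` Q ` {..<n})}) - {{}}"
    then obtain f where f: "f \<in> (\<Pi> q\<in>Q ` {..<n}. q)" "X = \<Inter> (f ` Q ` {..<n})" "X \<noteq> {}"
      by blast
    from fwd[OF f(2,1)] f(3) show "X \<in> itinerary_set ` words P n - {{}}" by simp
  next
    fix X assume X: "X \<in> itinerary_set ` words P n - {{}}"
    then obtain l x where l: "l \<in> words P n" "x \<in> itinerary_set l" "X = itinerary_set l" by blast
    from bwd[OF l(1,2)] l(3) X show "X \<in> (\<Union>f\<in>(\<Pi> q\<in>Q ` {..<n}. q). {\<Inter> (f ` Q ` {..<n})}) - {{}}"
      by blast
  qed
qed

lemma partition_entropy_iterated: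
  assumes "1 \<le> n"
  shows "partition_entropy \<nu> (iterated_partition \<nu> T P n) = block_entropy P coding_weight n"
proof -
  let ?W = "{l \<in> words P n. itinerary_set l \<noteq> {}}"
  have img: "itinerary_set ` words P n - {{}} = itinerary_set ` ?W" by auto
  have inj: "inj_on itinerary_set ?W"
  proof (rule inj_onI)
    fix l l' assume l: "l \<in> ?W" "l' \<in> ?W" "itinerary_set l = itinerary_set l'"
    then obtain x where x: "x \<in> itinerary_set l" "x \<in> itinerary_set l'" by auto
    have len: "length l = n" "length l' = n" and P: "\<And>i. i < n \<Longrightarrow> l ! i \<in> P" "\<And>i. i < n \<Longrightarrow> l' ! i \<in> P"
      using l by (auto simp: words_def intro: subsetD[OF _ nth_mem])
    show "l = l'"
    proof (rule nth_equalityI)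
      fix i assume "i < length l"
      then have i: "i < n" using len by simp
      have "x \<in> space \<nu>" "(T ^^ i) x \<in> l ! i" "(T ^^ i) x \<in> l' ! i"
        using x i len by (auto simp: itinerary_set_def)
      then show "l ! i = l' ! i"
        using P(1)[OF i] P(2)[OF i] ex1_block[OF funpow_space, of "x" i] by blast
    qed (use len in simp)
  qed
  have "partition_entropy \<nu> (iterated_partition \<nu> T P n) = (\<Sum>l\<in>?W. eta (coding_weight l))"
    unfolding partition_entropy_def iterated_partition_eq[OF assms] img
    by (simp add: sum.reindex[OF inj] eta_def coding_weight_def sum_negf)
  also have "\<dots> = block_entropy P coding_weight n"
    unfolding block_entropy_def
    by (rule sum.mono_neutral_left) (auto simp: finite_P coding_weight_def)
  finally show ?thesis .
qed

lemma partition_entropy_rate: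
  obtains h where "lim (\<lambda>n. partition_entropy \<nu> (iterated_partition \<nu> T P n) / real n) = h"
    and "(\<lambda>n. block_entropy P coding_weight n / real n) \<longlonglongrightarrow> h"
    and "\<And>n. 1 \<le> n \<Longrightarrow> h \<le> block_entropy P coding_weight n / real n" and "0 \<le> h"
proof -
  obtain h where h: "(\<lambda>n. block_entropy P coding_weight n / real n) \<longlonglongrightarrow> h"
    "\<And>n. 1 \<le> n \<Longrightarrow> h \<le> block_entropy P coding_weight n / real n" "0 \<le> h"
    using block_entropy_rate[OF stationary_coding_weight] by blast
  have "(\<lambda>n. partition_entropy \<nu> (iterated_partition \<nu> T P n) / real n) \<longlonglongrightarrow> h"
    by (rule Lim_transform_eventually[OF h(1)], rule eventually_sequentiallyI[of 1])
      (simp add: partition_entropy_iterated)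
  then show ?thesis using that h limI by blast
qed

end

section \<open>Invariant measures on the full shift\<close>

lemma shift_map_funpow: "(shift_map ^^ i) x = (\<lambda>n. x (n + i))"
  by (induction i arbitrary: x) (auto simp: shift_map_def fun_eq_iff)

lemma space_invariant_measure:
  "\<nu> \<in> invariant_measures M \<Longrightarrow> space \<nu> = full_shift M"
  using sets_eq_imp_space_eq[of \<nu> "restrict_space borel (full_shift M)"]
  by (simp add: invariant_measures_def space_restrict_space)

lemma shift_map_measurable: "(shift_map :: (nat \<Rightarrow> nat) \<Rightarrow> _) \<in> borel_measurable borel"
proof (rule measurable_coordinatewise_then_product)
  show "(\<lambda>x :: nat \<Rightarrow> nat. shift_map x i) \<in> borel_measurable borel" for i
    unfolding shift_map_def by (rule measurable_product_coordinates)
qed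

lemma shift_map_measurable_full:
  assumes "sets \<nu> = sets (restrict_space borel (full_shift M))"
  shows "shift_map \<in> measurable \<nu> \<nu>"
proof -
  have "shift_map \<in> measurable (restrict_space borel (full_shift M)) (restrict_space borel (full_shift M))"
    by (intro measurable_restrict_space2 measurable_restrict_space1 shift_map_measurable)
      (auto simp: space_restrict_space full_shift_def shift_map_def)
  then show ?thesis by (simp cong: measurable_cong_sets add: assms)
qed

lemma invariant_measure_preserving:
  assumes "\<nu> \<in> invariant_measures M"
  shows "measure_preserving \<nu> shift_map"
proof -
  have "prob_space \<nu>" using assms by (simp add: invariant_measures_def)
  moreover have "shift_map \<in> measurable \<nu> \<nu>"
    using assms by (intro shift_map_measurable_full) (simp add: invariant_measures_def)
  moreover have "emeasure \<nu> (shift_map -` B \<inter> space \<nu>) = emeasure \<nu> B" if "B \<in> sets \<nu>" for B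
    using assms that unfolding invariant_measures_def by blast
  ultimately show ?thesis
    by (intro measure_preserving.intro measure_preserving_axioms.intro)
qed

definition cylinder :: "nat \<Rightarrow> nat list \<Rightarrow> (nat \<Rightarrow> nat) set" where
  "cylinder M w = {x \<in> full_shift M. map x [0..<length w] = w}"

definition cylinder_weight :: "nat \<Rightarrow> (nat \<Rightarrow> nat) measure \<Rightarrow> nat list \<Rightarrow> real" where
  "cylinder_weight M \<nu> w = measure \<nu> (cylinder M w)"

text \<open>The partition of the full shift by the first letter. Its coding weights are the cylinder
  weights.\<close>

definition letter_blocks :: "nat \<Rightarrow> (nat \<Rightarrow> nat) set set" where
  "letter_blocks M = (\<lambda>i. cylinder M [i]) ` {1..M}"

lemma map_prefix_eq_iff: "map x [0..<length w] = w \<longleftrightarrow> (\<forall>i<length w. x i = w ! i)"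
  by (simp add: list_eq_iff_nth_eq[of "map x [0..<length w]" w])

lemma letter_blocks_inj: "inj_on (\<lambda>i. cylinder M [i]) {1..M}"
proof (rule inj_onI)
  fix i j assume "i \<in> {1..M}" "j \<in> {1..M}" "cylinder M [i] = cylinder M [j]"
  moreover have "(\<lambda>_. i) \<in> cylinder M [i]" using \<open>i \<in> {1..M}\<close> by (auto simp: cylinder_def full_shift_def)
  ultimately show "i = j" by (auto simp: cylinder_def)
qed

lemma coordinate_level_set_borel: "{x. x i = c} \<in> sets (borel :: (nat \<Rightarrow> nat) measure)"
proof -
  have "(\<lambda>x :: nat \<Rightarrow> nat. x i) -` {c} \<inter> space borel \<in> sets borel"
    by (intro measurable_sets[OF measurable_product_coordinates]) auto
  then show ?thesis by (simp add: vimage_def)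
qed

lemma cylinder_in_restricted_borel: "cylinder M w \<in> sets (restrict_space borel (full_shift M))"
proof -
  have "{x \<in> space borel. \<forall>i\<in>{..<length w}. (x :: nat \<Rightarrow> nat) i = w ! i} \<in> sets borel"
    by (intro sets.sets_Collect_finite_All) (auto simp: coordinate_level_set_borel)
  moreover have "cylinder M w = full_shift M \<inter> {x \<in> space borel. \<forall>i\<in>{..<length w}. x i = w ! i}"
    by (auto simp: cylinder_def map_prefix_eq_iff)
  ultimately show ?thesis by (auto simp: sets_restrict_space)
qed

lemma cylinder_measurable:
  assumes "\<nu> \<in> invariant_measures M"
  shows "cylinder M w \<in> sets \<nu>"
  using assms cylinder_in_restricted_borel by (simp add: invariant_measures_def)

lemma letter_blocks_finite_partition:
  assumes "\<nu> \<in> invariant_measures M"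
  shows "finite_partition \<nu> shift_map (letter_blocks M)"
proof -
  have "partition_on (space \<nu>) (letter_blocks M)"
    unfolding space_invariant_measure[OF assms]
  proof (rule partition_onI)
    show "\<Union> (letter_blocks M) = full_shift M"
      by (auto simp: letter_blocks_def cylinder_def full_shift_def)
    show "disjnt p q" if "p \<in> letter_blocks M" "q \<in> letter_blocks M" "p \<noteq> q" for p q
      using that by (auto simp: letter_blocks_def cylinder_def disjnt_def)
    show "{} \<notin> letter_blocks M"
    proof
      assume "{} \<in> letter_blocks M"
      then obtain i where "i \<in> {1..M}" "cylinder M [i] = {}" by (auto simp: letter_blocks_def)
      moreover have "(\<lambda>_. i) \<in> cylinder M [i]" using \<open>i \<in> {1..M}\<close> by (auto simp: cylinder_def full_shift_def)
      ultimately show False by simp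
    qed
  qed
  then show ?thesis
    using cylinder_measurable[OF assms]
    by (intro finite_partition.intro finite_partition_axioms.intro invariant_measure_preserving[OF assms])
      (auto simp: letter_blocks_def)
qed

lemma coding_weight_letter_blocks:
  assumes "\<nu> \<in> invariant_measures M"
  shows "measure_preserving.coding_weight \<nu> shift_map (map (\<lambda>i. cylinder M [i]) w) = cylinder_weight M \<nu> w"
proof -
  interpret measure_preserving \<nu> shift_map by (rule invariant_measure_preserving[OF assms])
  have "itinerary_set (map (\<lambda>i. cylinder M [i]) w) = cylinder M w"
    by (auto simp: itinerary_set_def cylinder_def space_invariant_measure[OF assms] map_prefix_eq_iff
        shift_map_funpow full_shift_def)
  then show ?thesis by (simp add: coding_weight_def cylinder_weight_def)
qed

lemma stationary_cylinder_weight: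
  assumes "\<nu> \<in> invariant_measures M"
  shows "stationary_weight {1..M} (cylinder_weight M \<nu>)"
proof -
  interpret finite_partition \<nu> shift_map "letter_blocks M" by (rule letter_blocks_finite_partition[OF assms])
  note cw = coding_weight_letter_blocks[OF assms]
  let ?b = "\<lambda>i. cylinder M [i]"
  have st: "stationary_weight (letter_blocks M) coding_weight" by (rule stationary_coding_weight)
  show ?thesis
    unfolding stationary_weight_def
  proof (intro conjI allI impI)
    show "0 \<le> cylinder_weight M \<nu> l" for l by (simp add: cylinder_weight_def)
    show "cylinder_weight M \<nu> [] = 1" using st cw[of "[]"] by (simp add: stationary_weight_def)
    fix l assume "set l \<subseteq> {1..M}"
    then have l: "set (map ?b l) \<subseteq> letter_blocks M" by (auto simp: letter_blocks_def)
    have "(\<Sum>i\<in>{1..M}. cylinder_weight M \<nu> (l @ [i])) = (\<Sum>B\<in>letter_blocks M. coding_weight (map ?b l @ [B]))"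
      unfolding letter_blocks_def sum.reindex[OF letter_blocks_inj] by (simp flip: cw)
    also have "\<dots> = coding_weight (map ?b l)"
      using st l unfolding stationary_weight_def by blast
    finally show "(\<Sum>i\<in>{1..M}. cylinder_weight M \<nu> (l @ [i])) = cylinder_weight M \<nu> l" by (simp only: cw)
    have "(\<Sum>i\<in>{1..M}. cylinder_weight M \<nu> (i # l)) = (\<Sum>B\<in>letter_blocks M. coding_weight (B # map ?b l))"
      unfolding letter_blocks_def sum.reindex[OF letter_blocks_inj] by (simp flip: cw)
    also have "\<dots> = coding_weight (map ?b l)"
      using st l unfolding stationary_weight_def by blast
    finally show "(\<Sum>i\<in>{1..M}. cylinder_weight M \<nu> (i # l)) = cylinder_weight M \<nu> l" by (simp only: cw)
  qed simp
qed

lemma block_entropy_letter_blocks: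
  assumes "\<nu> \<in> invariant_measures M"
  shows "block_entropy (letter_blocks M) (measure_preserving.coding_weight \<nu> shift_map) n =
    block_entropy {1..M} (cylinder_weight M \<nu>) n"
proof -
  let ?b = "\<lambda>i. cylinder M [i]"
  have "bij_betw (map ?b) (words {1..M} n) (words (letter_blocks M) n)"
  proof -
    have "inj_on (map ?b) (words {1..M} n)"
    proof (rule inj_onI)
      fix u v assume uv: "u \<in> words {1..M} n" "v \<in> words {1..M} n" "map ?b u = map ?b v"
      then have "inj_on ?b (set u \<union> set v)"
        by (intro inj_on_subset[OF letter_blocks_inj]) (auto simp: words_def)
      with uv(3) show "u = v" by (rule map_inj_on)
    qed
    moreover have "map ?b ` words {1..M} n = words (letter_blocks M) n"
    proof (intro equalityI subsetI)
      fix l assume l: "l \<in> words (letter_blocks M) n"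
      have "?b (inv_into {1..M} ?b B) = B" if "B \<in> set l" for B
        using l that f_inv_into_f[of B ?b "{1..M}"] by (auto simp: words_def letter_blocks_def)
      then have "l = map ?b (map (inv_into {1..M} ?b) l)" by (simp add: map_idI)
      moreover have "map (inv_into {1..M} ?b) l \<in> words {1..M} n"
        using l by (auto simp: words_def letter_blocks_def intro: inv_into_into)
      ultimately show "l \<in> map ?b ` words {1..M} n" by (rule image_eqI)
    qed (force simp: words_def letter_blocks_def)
    ultimately show ?thesis by (simp add: bij_betw_def)
  qed
  from sum.reindex_bij_betw[OF this, of "\<lambda>l. eta (measure_preserving.coding_weight \<nu> shift_map l)"]
  show ?thesis
    by (simp add: block_entropy_def coding_weight_letter_blocks[OF assms])
qed

lemma metric_entropy_upper:
  fixes B :: ereal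
  assumes "\<And>P. finite P \<Longrightarrow> partition_on (space \<nu>) P \<Longrightarrow> P \<subseteq> sets \<nu> \<Longrightarrow>
    ereal (lim (\<lambda>n. partition_entropy \<nu> (iterated_partition \<nu> T P n) / real n)) \<le> B"
  shows "metric_entropy \<nu> T \<le> B"
  unfolding metric_entropy_def by (intro SUP_least) (use assms in auto)

lemma (in finite_partition) metric_entropy_lower:
  assumes "(\<lambda>n. block_entropy P coding_weight n / real n) \<longlonglongrightarrow> h"
  shows "ereal h \<le> metric_entropy \<nu> T"
proof -
  obtain h' where "lim (\<lambda>n. partition_entropy \<nu> (iterated_partition \<nu> T P n) / real n) = h'"
    and "(\<lambda>n. block_entropy P coding_weight n / real n) \<longlonglongrightarrow> h'"
    using partition_entropy_rate by blast
  with assms have h: "lim (\<lambda>n. partition_entropy \<nu> (iterated_partition \<nu> T P n) / real n) = h"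
    using LIMSEQ_unique by blast
  have "P \<in> {P. finite P \<and> partition_on (space \<nu>) P \<and> P \<subseteq> sets \<nu>}"
    using finite_P partition_P P_sets by simp
  from SUP_upper[OF this, of "\<lambda>P. ereal (lim (\<lambda>n. partition_entropy \<nu> (iterated_partition \<nu> T P n) / real n))"]
  show ?thesis by (simp add: metric_entropy_def h)
qed

lemma (in measure_preserving) metric_entropy_nonneg: "0 \<le> metric_entropy \<nu> T"
proof -
  have "finite_partition \<nu> T {space \<nu>}"
    by (intro finite_partition.intro measure_preserving_axioms finite_partition_axioms.intro)
      (auto simp: not_empty intro: partition_on_space)
  then interpret finite_partition \<nu> T "{space \<nu>}" .
  obtain h where "(\<lambda>n. block_entropy {space \<nu>} coding_weight n / real n) \<longlonglongrightarrow> h" "0 \<le> h"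
    using partition_entropy_rate by blast
  then have "ereal 0 \<le> ereal h" "ereal h \<le> metric_entropy \<nu> T"
    using metric_entropy_lower by simp_all
  then show ?thesis unfolding zero_ereal_def by (rule order_trans)
qed

lemma metric_entropy_ge_block_rate:
  assumes "\<nu> \<in> invariant_measures M"
    and "(\<lambda>n. block_entropy {1..M} (cylinder_weight M \<nu>) n / real n) \<longlonglongrightarrow> h"
  shows "ereal h \<le> metric_entropy \<nu> shift_map"
proof -
  interpret finite_partition \<nu> shift_map "letter_blocks M" by (rule letter_blocks_finite_partition[OF assms(1)])
  show ?thesis
    by (rule metric_entropy_lower) (use assms block_entropy_letter_blocks[OF assms(1)] in simp)
qed

text \<open>At most as many itineraries as there are points in \<open>Q\<close> have positive mass, and each
  contributes at most \<open>1\<close>.\<close>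

lemma (in finite_partition) block_entropy_finite_support:
  assumes O: "finite Q" "measure \<nu> Q = 1" "Q \<in> sets \<nu>"
  shows "block_entropy P coding_weight n \<le> real (card Q)"
proof -
  define W where "W = {l \<in> words P n. itinerary_set l \<inter> Q \<noteq> {}}"
  have sets: "itinerary_set l \<in> sets \<nu>" if "l \<in> words P n" for l
    using that P_sets by (intro itinerary_set_measurable) (auto simp: words_def)
  have zero: "coding_weight l = 0" if "l \<in> words P n - W" for l
  proof -
    have "measure \<nu> (itinerary_set l \<union> Q) = measure \<nu> (itinerary_set l) + measure \<nu> Q"
      using that sets O by (intro finite_measure_Union) (auto simp: W_def)
    then show ?thesis using O(2) prob_le_1[of "itinerary_set l \<union> Q"]
      by (simp add: coding_weight_def measure_nonneg antisym)
  qed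
  have "card W \<le> card Q"
  proof -
    have "\<forall>l\<in>W. \<exists>x. x \<in> itinerary_set l \<inter> Q" by (auto simp: W_def)
    then obtain c where c: "\<And>l. l \<in> W \<Longrightarrow> c l \<in> itinerary_set l \<inter> Q" by metis
    have "inj_on c W"
    proof (rule inj_onI)
      fix l l' assume l: "l \<in> W" "l' \<in> W" "c l = c l'"
      then have len: "length l = n" "length l' = n" and P: "\<And>i. i < n \<Longrightarrow> l ! i \<in> P" "\<And>i. i < n \<Longrightarrow> l' ! i \<in> P"
        by (auto simp: words_def W_def intro: subsetD[OF _ nth_mem])
      have x: "c l \<in> itinerary_set l" "c l \<in> itinerary_set l'" using c l by (metis IntD1)+
      show "l = l'"
      proof (rule nth_equalityI)
        fix i assume "i < length l"
        then have i: "i < n" using len by simp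
        have "c l \<in> space \<nu>" "(T ^^ i) (c l) \<in> l ! i" "(T ^^ i) (c l) \<in> l' ! i"
          using x i len by (auto simp: itinerary_set_def)
        then show "l ! i = l' ! i"
          using P(1)[OF i] P(2)[OF i] ex1_block[OF funpow_space, of "c l" i] by blast
      qed (use len in simp)
    qed
    then show ?thesis using c O(1) by (intro card_inj_on_le[of c]) auto
  qed
  have "block_entropy P coding_weight n = (\<Sum>l\<in>W. eta (coding_weight l))"
    unfolding block_entropy_def
    by (rule sum.mono_neutral_right) (auto simp: finite_P zero W_def[symmetric], auto simp: W_def)
  also have "\<dots> \<le> (\<Sum>l\<in>W. 1)"
    by (intro sum_mono eta_le_1) (auto simp: coding_weight_def)
  also have "\<dots> \<le> real (card Q)" using \<open>card W \<le> card Q\<close> by simp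
  finally show ?thesis .
qed

lemma (in measure_preserving) metric_entropy_finite_support:
  assumes "finite Q" "measure \<nu> Q = 1"
  shows "metric_entropy \<nu> T = 0"
proof (rule antisym[OF metric_entropy_upper metric_entropy_nonneg])
  fix P assume "finite P" "partition_on (space \<nu>) P" "P \<subseteq> sets \<nu>"
  then have "finite_partition \<nu> T P"
    by (intro finite_partition.intro measure_preserving_axioms finite_partition_axioms.intro)
  then interpret finite_partition \<nu> T P .
  have Q: "Q \<in> sets \<nu>" using assms(2) by (metis measure_notin_sets zero_neq_one)
  obtain h where h: "lim (\<lambda>n. partition_entropy \<nu> (iterated_partition \<nu> T P n) / real n) = h"
    "\<And>n. 1 \<le> n \<Longrightarrow> h \<le> block_entropy P coding_weight n / real n"
    using partition_entropy_rate by blast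
  have "h \<le> 0"
  proof (rule LIMSEQ_le_const)
    show "(\<lambda>n. real (card Q) / real n) \<longlonglongrightarrow> 0" by real_asymp
    show "\<exists>N. \<forall>n\<ge>N. h \<le> real (card Q) / real n"
      using h(2) block_entropy_finite_support[OF assms Q]
      by (intro exI[of _ 1]) (meson divide_right_mono of_nat_0_le_iff order_trans)
  qed
  then show "ereal (lim (\<lambda>n. partition_entropy \<nu> (iterated_partition \<nu> T P n) / real n)) \<le> 0"
    by (simp add: h)
qed

lemma supported_on_periodic_orbit_entropy:
  assumes \<nu>: "\<nu> \<in> invariant_measures M" and supp: "supported_on_periodic_orbit M \<nu>"
  shows "metric_entropy \<nu> shift_map = 0"
proof -
  interpret measure_preserving \<nu> shift_map by (rule invariant_measure_preserving[OF \<nu>])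
  obtain x p where x: "1 \<le> p" "(shift_map ^^ p) x = x" "measure \<nu> {(shift_map ^^ k) x | k. True} = 1"
    using supp unfolding supported_on_periodic_orbit_def by blast
  have "(shift_map ^^ k) x \<in> (\<lambda>k. (shift_map ^^ k) x) ` {..<p}" for k
    using funpow_mod_eq[OF x(2), of k] x(1) by (metis imageI lessThan_iff less_le_trans mod_less_divisor zero_less_one)
  then have "finite {(shift_map ^^ k) x | k. True}"
    by (intro finite_subset[OF _ finite_imageI[of "{..<p}" "\<lambda>k. (shift_map ^^ k) x"]]) auto
  then show ?thesis using x(3) by (rule metric_entropy_finite_support)
qed

section \<open>Lyapunov exponents as sums over words\<close>

text \<open>A function of the first \<open>n\<close> coordinates is simple, so its integral is a finite sum over words.\<close>

lemma nn_integral_prefix: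
  assumes \<nu>: "\<nu> \<in> invariant_measures M"
  shows "(\<integral>\<^sup>+ x. F (map x [0..<n]) \<partial>\<nu>) = (\<Sum>w\<in>words {1..M} n. F w * ennreal (cylinder_weight M \<nu> w))"
proof -
  interpret prob_space \<nu> using \<nu> by (simp add: invariant_measures_def)
  have "(\<integral>\<^sup>+ x. F (map x [0..<n]) \<partial>\<nu>) =
      (\<integral>\<^sup>+ x. (\<Sum>w\<in>words {1..M} n. F w * indicator (cylinder M w) x) \<partial>\<nu>)"
  proof (rule nn_integral_cong)
    fix x assume x: "x \<in> space \<nu>"
    then have xf: "x \<in> full_shift M" by (simp add: space_invariant_measure[OF \<nu>])
    then have mem: "map x [0..<n] \<in> words {1..M} n" by (auto simp: words_def full_shift_def)
    have "(\<Sum>w\<in>words {1..M} n. F w * indicator (cylinder M w) x) =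
        (\<Sum>w\<in>words {1..M} n. if w = map x [0..<n] then F (map x [0..<n]) else 0)"
      using xf by (intro sum.cong) (auto simp: words_def cylinder_def indicator_def)
    then show "F (map x [0..<n]) = (\<Sum>w\<in>words {1..M} n. F w * indicator (cylinder M w) x)"
      using mem by simp
  qed
  also have "\<dots> = (\<Sum>w\<in>words {1..M} n. (\<integral>\<^sup>+ x. F w * indicator (cylinder M w) x \<partial>\<nu>))"
    using cylinder_measurable[OF \<nu>] by (intro nn_integral_sum) simp
  also have "\<dots> = (\<Sum>w\<in>words {1..M} n. F w * ennreal (cylinder_weight M \<nu> w))"
    using cylinder_measurable[OF \<nu>]
    by (intro sum.cong) (auto simp: nn_integral_cmult_indicator cylinder_weight_def emeasure_eq_measure)
  finally show ?thesis .
qed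

text \<open>This is the integral that defines the exponent when every word with zero product has mass zero.
  Otherwise the convention \<open>ln 0 = 0\<close> gives it a meaningless value, and the true integral is \<open>- \<infinity>\<close>.\<close>

definition mean_log_norm :: "nat \<Rightarrow> (nat \<Rightarrow> real^'d^'d) \<Rightarrow> (nat list \<Rightarrow> real) \<Rightarrow> nat \<Rightarrow> real" where
  "mean_log_norm M A g n = (\<Sum>w\<in>words {1..M} n. g w * ln (mnorm (word_prod A w)))"

lemma mnorm_pos: "B \<noteq> 0 \<Longrightarrow> 0 < mnorm B"
  using mnorm_nonneg[of B] mnorm_eq_0[of B] by linarith

lemma ereal_integral_log_norm_finite:
  fixes A :: "nat \<Rightarrow> real^'d^'d"
  assumes \<nu>: "\<nu> \<in> invariant_measures M"
    and nz: "\<And>w. w \<in> words {1..M} n \<Longrightarrow> 0 < cylinder_weight M \<nu> w \<Longrightarrow> word_prod A w \<noteq> 0"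
  shows "ereal_integral \<nu> (\<lambda>x. elog (mnorm (word_prod A (map x [0..<n])))) =
    ereal (mean_log_norm M A (cylinder_weight M \<nu>) n)"
proof -
  define f where "f = cylinder_weight M \<nu>"
  define m where "m w = mnorm (word_prod A w)" for w
  have f0: "0 \<le> f w" for w by (simp add: f_def cylinder_weight_def)
  have mp: "f w = 0 \<or> 0 < m w" if "w \<in> words {1..M} n" for w
    using nz[OF that] f0[of w] by (auto simp: f_def m_def intro: mnorm_pos)
  have pos: "e2ennreal (elog (m w)) * ennreal (f w) = ennreal (max 0 (ln (m w)) * f w)"
    and neg: "e2ennreal (- elog (m w)) * ennreal (f w) = ennreal (max 0 (- ln (m w)) * f w)"
    if "w \<in> words {1..M} n" for w
    using mp[OF that] f0[of w]
    by (auto simp: elog_def ennreal_mult' max_def e2ennreal_ereal ennreal_neg)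
  have P: "(\<integral>\<^sup>+ x. e2ennreal (elog (m (map x [0..<n]))) \<partial>\<nu>) = ennreal (\<Sum>w\<in>words {1..M} n. max 0 (ln (m w)) * f w)"
    unfolding nn_integral_prefix[OF \<nu>, of "\<lambda>w. e2ennreal (elog (m w))"] f_def[symmetric]
    using f0 by (subst sum_ennreal[symmetric]) (auto simp: pos)
  have N: "(\<integral>\<^sup>+ x. e2ennreal (- elog (m (map x [0..<n]))) \<partial>\<nu>) = ennreal (\<Sum>w\<in>words {1..M} n. max 0 (- ln (m w)) * f w)"
    unfolding nn_integral_prefix[OF \<nu>, of "\<lambda>w. e2ennreal (- elog (m w))"] f_def[symmetric]
    using f0 by (subst sum_ennreal[symmetric]) (auto simp: neg)
  have "ereal_integral \<nu> (\<lambda>x. elog (m (map x [0..<n]))) =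
     ereal ((\<Sum>w\<in>words {1..M} n. max 0 (ln (m w)) * f w) - (\<Sum>w\<in>words {1..M} n. max 0 (- ln (m w)) * f w))"
    unfolding ereal_integral_def P N using f0 by (simp add: enn2ereal_ennreal sum_nonneg)
  also have "(\<Sum>w\<in>words {1..M} n. max 0 (ln (m w)) * f w) - (\<Sum>w\<in>words {1..M} n. max 0 (- ln (m w)) * f w)
      = mean_log_norm M A f n"
    unfolding mean_log_norm_def sum_subtractf[symmetric] m_def
    by (intro sum.cong) (auto simp: max_def)
  finally show ?thesis by (simp add: m_def f_def)
qed

lemma ereal_integral_log_norm_MInf:
  fixes A :: "nat \<Rightarrow> real^'d^'d"
  assumes \<nu>: "\<nu> \<in> invariant_measures M"
    and w: "w \<in> words {1..M} n" "0 < cylinder_weight M \<nu> w" "word_prod A w = 0"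
  shows "ereal_integral \<nu> (\<lambda>x. elog (mnorm (word_prod A (map x [0..<n])))) = - \<infinity>"
proof -
  let ?F = "\<lambda>w. e2ennreal (- elog (mnorm (word_prod A w))) * ennreal (cylinder_weight M \<nu> w)"
  have "mnorm (word_prod A w) = 0" by (simp only: w(3) mnorm_eq_0)
  then have "?F w = top" using w(2) by (simp add: elog_def ennreal_top_mult)
  moreover have "?F w \<le> (\<Sum>w\<in>words {1..M} n. ?F w)"
    using w(1) by (intro member_le_sum) auto
  ultimately have N: "(\<Sum>w\<in>words {1..M} n. ?F w) = top" by (simp add: top.extremum_unique)
  define r where "r w = max 0 (if mnorm (word_prod A w) \<le> 0 then 0 else ln (mnorm (word_prod A w)))
    * cylinder_weight M \<nu> w" for w
  have r0: "0 \<le> r w" for w by (simp add: r_def cylinder_weight_def)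
  have "e2ennreal (elog (mnorm (word_prod A w))) * ennreal (cylinder_weight M \<nu> w) = ennreal (r w)" for w
    by (auto simp: elog_def r_def ennreal_mult' max_def ennreal_neg e2ennreal_neg cylinder_weight_def)
  then have P: "(\<Sum>w\<in>words {1..M} n. e2ennreal (elog (mnorm (word_prod A w))) * ennreal (cylinder_weight M \<nu> w))
      = ennreal (\<Sum>w\<in>words {1..M} n. r w)"
    using r0 by (simp add: sum_ennreal)
  show ?thesis
    unfolding ereal_integral_def
      nn_integral_prefix[OF \<nu>, of "\<lambda>w. e2ennreal (elog (mnorm (word_prod A w)))"]
      nn_integral_prefix[OF \<nu>, of "\<lambda>w. e2ennreal (- elog (mnorm (word_prod A w)))"] N P
    using r0 by (simp add: enn2ereal_ennreal sum_nonneg)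
qed

lemma mean_log_norm_subadditive:
  fixes A :: "nat \<Rightarrow> real^'d^'d"
  assumes g: "stationary_weight {1..M} g"
    and nz: "\<And>w. set w \<subseteq> {1..M} \<Longrightarrow> 0 < g w \<Longrightarrow> word_prod A w \<noteq> 0"
  shows "mean_log_norm M A g (n + m) \<le> mean_log_norm M A g n + mean_log_norm M A g m"
proof -
  let ?m = "\<lambda>w. mnorm (word_prod A w)" and ?W = "words {1..M}"
  have g0: "0 \<le> g w" for w using g by (simp add: stationary_weight_def)
  have pt: "g (u @ v) * ln (?m (u @ v)) \<le> g (u @ v) * ln (?m u) + g (u @ v) * ln (?m v)"
    if "u \<in> ?W n" "v \<in> ?W m" for u v
  proof (cases "g (u @ v) = 0")
    case False
    then have "word_prod A (u @ v) \<noteq> 0" using that g0[of "u @ v"] by (intro nz) (auto simp: words_def)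
    then have ne: "word_prod A v ** word_prod A u \<noteq> 0" by (simp add: word_prod_append)
    then have "word_prod A v \<noteq> 0" "word_prod A u \<noteq> 0" by auto
    then have p: "0 < ?m u" "0 < ?m v" "0 < ?m (u @ v)" using ne by (auto intro: mnorm_pos simp: word_prod_append)
    have "ln (?m (u @ v)) \<le> ln (?m v * ?m u)"
      using p mnorm_mult_le by (simp add: word_prod_append)
    also have "\<dots> = ln (?m u) + ln (?m v)" using p by (simp add: ln_mult)
    finally show ?thesis using g0[of "u @ v"] by (simp add: mult_left_mono flip: distrib_left)
  qed simp
  have "mean_log_norm M A g (n + m) = (\<Sum>u\<in>?W n. \<Sum>v\<in>?W m. g (u @ v) * ln (?m (u @ v)))"
    by (simp add: mean_log_norm_def sum_words_append)
  also have "\<dots> \<le> (\<Sum>u\<in>?W n. \<Sum>v\<in>?W m. g (u @ v) * ln (?m u) + g (u @ v) * ln (?m v))"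
    by (intro sum_mono pt)
  also have "\<dots> = (\<Sum>u\<in>?W n. (\<Sum>v\<in>?W m. g (u @ v)) * ln (?m u)) + (\<Sum>v\<in>?W m. (\<Sum>u\<in>?W n. g (u @ v)) * ln (?m v))"
    by (simp add: sum.distrib sum_distrib_right) (rule sum.swap)
  also have "\<dots> = mean_log_norm M A g n + mean_log_norm M A g m"
    unfolding mean_log_norm_def
    using stationary_weight_append[OF g] stationary_weight_prepend[OF g]
    by (intro arg_cong2[where f = "(+)"] sum.cong) (auto simp: words_def)
  finally show ?thesis .
qed

lemma lyapunov_exponent_eq_INF:
  fixes A :: "nat \<Rightarrow> real^'d^'d"
  assumes \<nu>: "\<nu> \<in> invariant_measures M"
    and nz: "\<And>w. set w \<subseteq> {1..M} \<Longrightarrow> 0 < cylinder_weight M \<nu> w \<Longrightarrow> word_prod A w \<noteq> 0"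
  shows "lyapunov_exponent A \<nu> = (INF n\<in>{1..}. ereal (mean_log_norm M A (cylinder_weight M \<nu>) n / real n))"
proof -
  let ?u = "mean_log_norm M A (cylinder_weight M \<nu>)"
  have I: "ereal (1 / real n) * ereal_integral \<nu> (\<lambda>x. elog (mnorm (word_prod A (map x [0..<n])))) = ereal (?u n / real n)"
    for n
    using nz by (subst ereal_integral_log_norm_finite[OF \<nu>]) (auto simp: words_def)
  have "(\<lambda>n. ereal (?u n / real n)) \<longlonglongrightarrow> (INF n\<in>{1..}. ereal (?u n / real n))"
    by (intro fekete mean_log_norm_subadditive stationary_cylinder_weight[OF \<nu>] nz)
  then show ?thesis
    unfolding lyapunov_exponent_def I by (rule limI)
qed

text \<open>One word with zero product and positive mass makes the integrals \<open>- \<infinity>\<close> at all larger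
  lengths, since some extension of it has positive mass and its product still vanishes.\<close>

lemma lyapunov_exponent_MInf:
  fixes A :: "nat \<Rightarrow> real^'d^'d"
  assumes \<nu>: "\<nu> \<in> invariant_measures M"
    and w: "set w \<subseteq> {1..M}" "0 < cylinder_weight M \<nu> w" "word_prod A w = 0"
  shows "lyapunov_exponent A \<nu> = - \<infinity>"
proof -
  have st: "stationary_weight {1..M} (cylinder_weight M \<nu>)" by (rule stationary_cylinder_weight[OF \<nu>])
  have "ereal (1 / real n) * ereal_integral \<nu> (\<lambda>x. elog (mnorm (word_prod A (map x [0..<n])))) = - \<infinity>"
    if n: "max 1 (length w) \<le> n" for n
  proof -
    have "0 < (\<Sum>v\<in>words {1..M} (n - length w). cylinder_weight M \<nu> (w @ v))"
      using stationary_weight_append[OF st w(1)] w(2) by simp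
    then obtain v where v: "v \<in> words {1..M} (n - length w)" "0 < cylinder_weight M \<nu> (w @ v)"
      by (metis not_le sum_nonpos)
    have "ereal_integral \<nu> (\<lambda>x. elog (mnorm (word_prod A (map x [0..<n])))) = - \<infinity>"
      by (rule ereal_integral_log_norm_MInf[OF \<nu>, of "w @ v"])
        (use v w n in \<open>auto simp: words_def word_prod_append\<close>)
    then show ?thesis using n by simp
  qed
  then have "(\<lambda>n. ereal (1 / real n) * ereal_integral \<nu> (\<lambda>x. elog (mnorm (word_prod A (map x [0..<n]))))) \<longlonglongrightarrow> - \<infinity>"
    by (intro tendsto_eventually eventually_sequentiallyI[of "max 1 (length w)"])
  then show ?thesis unfolding lyapunov_exponent_def by (rule limI)
qed

lemma lyapunov_exponent_le:
  fixes A :: "nat \<Rightarrow> real^'d^'d"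
  assumes \<nu>: "\<nu> \<in> invariant_measures M" and "1 \<le> n"
    and finite: "lyapunov_exponent A \<nu> \<noteq> - \<infinity>"
  shows "lyapunov_exponent A \<nu> \<le> ereal (mean_log_norm M A (cylinder_weight M \<nu>) n / real n)"
proof -
  have "lyapunov_exponent A \<nu> = (INF n\<in>{1..}. ereal (mean_log_norm M A (cylinder_weight M \<nu>) n / real n))"
    using lyapunov_exponent_MInf[OF \<nu>] finite by (intro lyapunov_exponent_eq_INF[OF \<nu>]) blast
  also have "\<dots> \<le> ereal (mean_log_norm M A (cylinder_weight M \<nu>) n / real n)"
    using assms(2) by (intro INF_lower) auto
  finally show ?thesis .
qed

lemma lyapunov_exponent_not_PInf:
  fixes A :: "nat \<Rightarrow> real^'d^'d"
  assumes \<nu>: "\<nu> \<in> invariant_measures M"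
  shows "lyapunov_exponent A \<nu> \<noteq> \<infinity>"
  using lyapunov_exponent_le[OF \<nu>, of 1 A] by auto

section \<open>Consequences of uniqueness\<close>

lemma mset_rotate: "mset (rotate k w) = mset w"
  by (metis append_take_drop_id mset_append rotate_drop_take union_commute)

lemma sequence_singleton_in_borel: "{y} \<in> sets (borel :: (nat \<Rightarrow> nat) measure)"
proof -
  have "(\<Inter>i. {x. x i = y i}) \<in> sets (borel :: (nat \<Rightarrow> nat) measure)"
    by (intro sets.countable_INT) (auto intro: coordinate_level_set_borel)
  also have "(\<Inter>i. {x. x i = y i}) = {y}" by (auto simp: fun_eq_iff)
  finally show ?thesis .
qed

lemma invariant_measuresI:
  assumes "prob_space \<nu>" "sets \<nu> = sets (restrict_space borel (full_shift M))"
    and "\<And>B. B \<in> sets \<nu> \<Longrightarrow> emeasure \<nu> (shift_map -` B \<inter> space \<nu>) = emeasure \<nu> B"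
  shows "\<nu> \<in> invariant_measures M"
  using assms by (auto simp: invariant_measures_def)

definition fixed_point_measure :: "nat \<Rightarrow> nat \<Rightarrow> (nat \<Rightarrow> nat) measure" where
  "fixed_point_measure M a = return (restrict_space borel (full_shift M)) (\<lambda>_. a)"

lemma fixed_point_measure_invariant:
  assumes a: "a \<in> {1..M}"
  shows "fixed_point_measure M a \<in> invariant_measures M"
proof (rule invariant_measuresI)
  let ?S = "restrict_space (borel :: (nat \<Rightarrow> nat) measure) (full_shift M)"
  have sp: "(\<lambda>_. a) \<in> space ?S" using a by (simp add: space_restrict_space full_shift_def)
  show "prob_space (fixed_point_measure M a)"
    unfolding fixed_point_measure_def by (rule prob_space_return[OF sp])
  show sets: "sets (fixed_point_measure M a) = sets ?S" by (simp add: fixed_point_measure_def)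
  fix B assume B: "B \<in> sets (fixed_point_measure M a)"
  have "shift_map -` B \<inter> space (fixed_point_measure M a) \<in> sets (fixed_point_measure M a)"
    using shift_map_measurable_full[OF sets] B by (rule measurable_sets)
  then show "emeasure (fixed_point_measure M a) (shift_map -` B \<inter> space (fixed_point_measure M a))
      = emeasure (fixed_point_measure M a) B"
    using B sp by (simp add: fixed_point_measure_def indicator_def shift_map_def)
qed

lemma fixed_point_measure_supported:
  assumes a: "a \<in> {1..M}"
  shows "supported_on_periodic_orbit M (fixed_point_measure M a)"
proof -
  let ?x = "\<lambda>_::nat. a"
  note inv = fixed_point_measure_invariant[OF a]
  have fixp: "(shift_map ^^ k) ?x = ?x" for k by (simp add: shift_map_funpow)
  have orbit: "{(shift_map ^^ k) ?x | k. True} = {?x}" by (simp add: fixp)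
  have "{?x} \<in> sets borel" by (rule sequence_singleton_in_borel)
  then have "{?x} \<in> sets (restrict_space borel (full_shift M))"
    using a by (auto simp: sets_restrict_space full_shift_def image_iff intro!: bexI[of _ "{?x}"])
  then have "measure (fixed_point_measure M a) {?x} = 1"
    by (simp add: fixed_point_measure_def measure_def)
  then show ?thesis
    unfolding supported_on_periodic_orbit_def
  proof (intro bexI[of _ ?x] exI[of _ 1] conjI)
    show "measure (fixed_point_measure M a) {(shift_map ^^ k) ?x | k. True} = 1"
      unfolding orbit by fact
  qed (use a fixp[of 1] in \<open>auto simp: full_shift_def\<close>)
qed

lemma fixed_point_measure_neq:
  assumes "a \<in> {1..M}" "b \<in> {1..M}" "a \<noteq> b"
  shows "fixed_point_measure M a \<noteq> fixed_point_measure M b"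
proof
  assume eq: "fixed_point_measure M a = fixed_point_measure M b"
  have "cylinder M [a] \<in> sets (fixed_point_measure M a)"
    by (rule cylinder_measurable[OF fixed_point_measure_invariant[OF assms(1)]])
  then have "cylinder M [a] \<in> sets (restrict_space borel (full_shift M))"
    by (simp add: fixed_point_measure_def)
  then have "emeasure (fixed_point_measure M c) (cylinder M [a]) = indicator (cylinder M [a]) (\<lambda>_. c)" for c
    by (simp add: fixed_point_measure_def)
  from this[of a] this[of b] eq show False
    using assms by (simp add: cylinder_def full_shift_def indicator_def)
qed

definition average_measure :: "'a measure \<Rightarrow> 'a measure \<Rightarrow> 'a measure" where
  "average_measure \<mu> \<nu> = measure_of (space \<mu>) (sets \<mu>) (\<lambda>B. ennreal (1/2) * (emeasure \<mu> B + emeasure \<nu> B))"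

lemma sets_average_measure [simp]: "sets (average_measure \<mu> \<nu>) = sets \<mu>"
  and space_average_measure [simp]: "space (average_measure \<mu> \<nu>) = space \<mu>"
  by (simp_all add: average_measure_def)

lemma emeasure_average_measure:
  assumes "sets \<mu> = sets \<nu>" "B \<in> sets \<mu>"
  shows "emeasure (average_measure \<mu> \<nu>) B = ennreal (1/2) * (emeasure \<mu> B + emeasure \<nu> B)"
  unfolding average_measure_def
proof (rule emeasure_measure_of_sigma)
  show "countably_additive (sets \<mu>) (\<lambda>B. ennreal (1/2) * (emeasure \<mu> B + emeasure \<nu> B))"
    unfolding countably_additive_def
  proof (intro allI impI)
    fix F :: "nat \<Rightarrow> 'a set" assume F: "range F \<subseteq> sets \<mu>" "disjoint_family F" "\<Union> (range F) \<in> sets \<mu>"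
    have "(\<Sum>i. ennreal (1/2) * (emeasure \<mu> (F i) + emeasure \<nu> (F i))) =
        ennreal (1/2) * ((\<Sum>i. emeasure \<mu> (F i)) + (\<Sum>i. emeasure \<nu> (F i)))"
      by (simp add: ennreal_suminf_cmult suminf_add[OF summableI summableI])
    also have "\<dots> = ennreal (1/2) * (emeasure \<mu> (\<Union> (range F)) + emeasure \<nu> (\<Union> (range F)))"
      using F assms(1) by (simp add: suminf_emeasure)
    finally show "(\<Sum>i. ennreal (1/2) * (emeasure \<mu> (F i) + emeasure \<nu> (F i))) =
        ennreal (1/2) * (emeasure \<mu> (\<Union> (range F)) + emeasure \<nu> (\<Union> (range F)))" .
  qed
next
  show "sigma_algebra (space \<mu>) (sets \<mu>)" by (rule sets.sigma_algebra_axioms)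
qed (use assms in \<open>auto simp: positive_def\<close>)

lemma measure_average_measure:
  assumes "finite_measure \<mu>" "finite_measure \<nu>" "sets \<mu> = sets \<nu>" "B \<in> sets \<mu>"
  shows "measure (average_measure \<mu> \<nu>) B = (measure \<mu> B + measure \<nu> B) / 2"
proof -
  have "emeasure (average_measure \<mu> \<nu>) B = ennreal (1/2) * (ennreal (measure \<mu> B) + ennreal (measure \<nu> B))"
    using assms by (simp add: emeasure_average_measure finite_measure.emeasure_eq_measure)
  also have "\<dots> = ennreal ((measure \<mu> B + measure \<nu> B) / 2)"
  proof -
    have "ennreal (measure \<mu> B) + ennreal (measure \<nu> B) = ennreal (measure \<mu> B + measure \<nu> B)"
      by (simp add: ennreal_plus)
    moreover have "ennreal (1/2) * ennreal (measure \<mu> B + measure \<nu> B) = ennreal (1/2 * (measure \<mu> B + measure \<nu> B))"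
      by (rule ennreal_mult'[symmetric]) simp
    ultimately show ?thesis by (simp only: mult_1 times_divide_eq_left)
  qed
  finally show ?thesis by (simp add: measure_def)
qed

lemma average_measure_invariant:
  assumes "\<mu> \<in> invariant_measures M" "\<nu> \<in> invariant_measures M"
  shows "average_measure \<mu> \<nu> \<in> invariant_measures M"
proof (rule invariant_measuresI)
  have S: "sets \<mu> = sets \<nu>" and P: "prob_space \<mu>" "prob_space \<nu>"
    using assms by (auto simp: invariant_measures_def)
  have sp: "space \<mu> = space \<nu>" by (rule sets_eq_imp_space_eq[OF S])
  have spm: "space \<nu> \<in> sets \<mu>" by (simp add: S)
  have "ennreal (1/2) * (1 + 1) = ennreal (1/2) * ennreal 2" by simp
  also have "\<dots> = 1" by (subst ennreal_mult'[symmetric]) auto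
  finally have "ennreal (1/2) * (1 + 1) = 1" .
  then have "emeasure (average_measure \<mu> \<nu>) (space \<nu>) = 1"
    using prob_space.emeasure_space_1[OF P(1)] prob_space.emeasure_space_1[OF P(2)]
    unfolding emeasure_average_measure[OF S spm] by (simp only: sp)
  then show "prob_space (average_measure \<mu> \<nu>)"
    by (intro prob_spaceI) (simp add: sp)
  show "sets (average_measure \<mu> \<nu>) = sets (restrict_space borel (full_shift M))"
    using assms by (simp add: invariant_measures_def)
  fix B assume "B \<in> sets (average_measure \<mu> \<nu>)"
  then have B: "B \<in> sets \<mu>" by simp
  have "shift_map -` B \<inter> space \<mu> \<in> sets \<mu>"
    using measure_preserving.T_measurable[OF invariant_measure_preserving[OF assms(1)]] B
    by (rule measurable_sets)
  then show "emeasure (average_measure \<mu> \<nu>) (shift_map -` B \<inter> space (average_measure \<mu> \<nu>)) =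
      emeasure (average_measure \<mu> \<nu>) B"
    using B S sp measure_preserving.T_preserving[OF invariant_measure_preserving[OF assms(1)], of B]
      measure_preserving.T_preserving[OF invariant_measure_preserving[OF assms(2)], of B]
    by (simp add: emeasure_average_measure[OF S])
qed

text \<open>By concavity of \<open>eta\<close>, the entropy of an average is at least half the entropy of each of its two parts.\<close>

lemma average_measure_entropy:
  assumes \<mu>: "\<mu> \<in> invariant_measures M" and \<nu>: "\<nu> \<in> invariant_measures M"
    and inf: "metric_entropy \<mu> shift_map = \<infinity>"
  shows "metric_entropy (average_measure \<mu> \<nu>) shift_map = \<infinity>"
proof -
  let ?\<rho> = "average_measure \<mu> \<nu>"
  note \<rho> = average_measure_invariant[OF \<mu> \<nu>]
  interpret \<mu>: measure_preserving \<mu> shift_map by (rule invariant_measure_preserving[OF \<mu>])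
  interpret \<nu>: measure_preserving \<nu> shift_map by (rule invariant_measure_preserving[OF \<nu>])
  interpret \<rho>: measure_preserving ?\<rho> shift_map by (rule invariant_measure_preserving[OF \<rho>])
  have S: "sets \<mu> = sets \<nu>" using \<mu> \<nu> by (auto simp: invariant_measures_def)
  have sp: "space \<mu> = space \<nu>" by (rule sets_eq_imp_space_eq[OF S])
  have "metric_entropy \<mu> shift_map \<le> 2 * metric_entropy ?\<rho> shift_map"
  proof (rule metric_entropy_upper)
    fix P assume P: "finite P" "partition_on (space \<mu>) P" "P \<subseteq> sets \<mu>"
    interpret \<mu>P: finite_partition \<mu> shift_map P
      by (intro finite_partition.intro \<mu>.measure_preserving_axioms finite_partition_axioms.intro P)
    interpret \<nu>P: finite_partition \<nu> shift_map P
      by (intro finite_partition.intro \<nu>.measure_preserving_axioms finite_partition_axioms.intro)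
        (use P S sp in auto)
    interpret \<rho>P: finite_partition ?\<rho> shift_map P
      by (intro finite_partition.intro \<rho>.measure_preserving_axioms finite_partition_axioms.intro)
        (use P in auto)
    have it: "\<rho>.itinerary_set l = \<mu>.itinerary_set l" "\<nu>.itinerary_set l = \<mu>.itinerary_set l" for l
      by (simp_all add: \<rho>.itinerary_set_def \<mu>.itinerary_set_def \<nu>.itinerary_set_def sp)
    have "eta (\<mu>.coding_weight l) \<le> 2 * eta (\<rho>.coding_weight l)" if "l \<in> words P n" for l n
    proof -
      have "\<mu>.itinerary_set l \<in> sets \<mu>"
        using that P by (intro \<mu>.itinerary_set_measurable) (auto simp: words_def)
      then have r: "\<rho>.coding_weight l = (\<mu>.coding_weight l + \<nu>.coding_weight l) / 2"
        unfolding \<rho>.coding_weight_def \<mu>.coding_weight_def \<nu>.coding_weight_def it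
        by (intro measure_average_measure \<mu>.finite_measure_axioms \<nu>.finite_measure_axioms S)
      define b where "b i = (if i then \<mu>.coding_weight l else \<nu>.coding_weight l)" for i
      have b0: "0 \<le> b i" "b i \<le> 1" for i
        by (auto simp: b_def \<mu>.coding_weight_def \<nu>.coding_weight_def)
      have "(\<Sum>i\<in>(UNIV :: bool set). eta (b i)) \<le> card (UNIV :: bool set) * eta ((\<Sum>i\<in>UNIV. b i) / card (UNIV :: bool set))"
        by (rule eta_concave_sum) (use b0 in auto)
      then have "eta (b True) + eta (b False) \<le> 2 * eta (\<rho>.coding_weight l)"
        by (simp add: UNIV_bool r b_def add.commute)
      then show ?thesis using eta_nonneg[OF b0, of False] by (simp add: b_def)
    qed
    then have B: "block_entropy P \<mu>.coding_weight n \<le> 2 * block_entropy P \<rho>.coding_weight n" for n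
      unfolding block_entropy_def sum_distrib_left by (intro sum_mono)
    obtain h where h: "lim (\<lambda>n. partition_entropy \<mu> (iterated_partition \<mu> shift_map P n) / real n) = h"
      "(\<lambda>n. block_entropy P \<mu>.coding_weight n / real n) \<longlonglongrightarrow> h"
      using \<mu>P.partition_entropy_rate by blast
    obtain h' where h': "(\<lambda>n. block_entropy P \<rho>.coding_weight n / real n) \<longlonglongrightarrow> h'"
      using \<rho>P.partition_entropy_rate by blast
    have "h \<le> 2 * h'"
    proof (rule LIMSEQ_le[OF h(2) tendsto_mult_left[OF h']])
      show "\<exists>N. \<forall>n\<ge>N. block_entropy P \<mu>.coding_weight n / real n \<le> 2 * (block_entropy P \<rho>.coding_weight n / real n)"
        using B divide_right_mono[OF B] by (auto intro!: exI[of _ 0])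
    qed
    then have "ereal h \<le> 2 * ereal h'" by simp
    also have "\<dots> \<le> 2 * metric_entropy ?\<rho> shift_map"
      by (intro ereal_mult_left_mono \<rho>P.metric_entropy_lower[OF h']) simp
    finally show "ereal (lim (\<lambda>n. partition_entropy \<mu> (iterated_partition \<mu> shift_map P n) / real n))
        \<le> 2 * metric_entropy ?\<rho> shift_map"
      by (simp add: h)
  qed
  then show ?thesis using inf by (cases "metric_entropy ?\<rho> shift_map") auto
qed

locale unique_equilibrium =
  fixes M :: nat and A :: "nat \<Rightarrow> real^'d^'d" and s :: real and \<mu> :: "(nat \<Rightarrow> nat) measure"
  assumes M2: "M \<ge> 2" and s0: "s > 0" and eq: "equilibrium_state M A s \<mu>"
    and unique: "\<And>\<nu>. equilibrium_state M A s \<nu> \<Longrightarrow> \<nu> = \<mu>"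
begin

lemma equilibrium_invariant: "\<mu> \<in> invariant_measures M"
  using eq by (simp add: equilibrium_state_def)

lemma equilibrium_maximal: "\<nu> \<in> invariant_measures M \<Longrightarrow> free_energy A s \<nu> \<le> free_energy A s \<mu>"
  using eq by (auto simp: equilibrium_state_def intro: SUP_upper)

lemma equilibrium_of_ge:
  assumes "\<nu> \<in> invariant_measures M" "free_energy A s \<mu> \<le> free_energy A s \<nu>"
  shows "\<nu> = \<mu>"
proof (rule unique)
  have "free_energy A s \<nu> = free_energy A s \<mu>"
    using assms equilibrium_maximal by (intro antisym)
  then show "equilibrium_state M A s \<nu>" using assms(1) eq by (simp add: equilibrium_state_def)
qed

text \<open>In extended arithmetic \<open>\<infinity> + - \<infinity> = \<infinity>\<close>, so an invariant measure with infinite entropy has infinite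
  free energy and is an equilibrium state. The average of it with a point mass then is another one.
  Uniqueness identifies the two, which makes the measure itself a point mass and its entropy zero.\<close>

lemma unique_equilibrium_entropy_finite: "metric_entropy \<mu> shift_map \<noteq> \<infinity>"
proof
  assume inf: "metric_entropy \<mu> shift_map = \<infinity>"
  let ?\<delta> = "fixed_point_measure M 1"
  have one: "1 \<in> {1..M}" using M2 by simp
  note \<delta> = fixed_point_measure_invariant[OF one]
  note \<mu> = equilibrium_invariant
  have "free_energy A s (average_measure \<mu> ?\<delta>) = \<infinity>"
    unfolding free_energy_def average_measure_entropy[OF \<mu> \<delta> inf] by simp
  then have avg: "average_measure \<mu> ?\<delta> = \<mu>"
    by (intro equilibrium_of_ge average_measure_invariant \<mu> \<delta>) simp
  have S: "sets \<mu> = sets ?\<delta>" using \<mu> \<delta> by (auto simp: invariant_measures_def)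
  have fin: "finite_measure \<mu>" "finite_measure ?\<delta>"
    using \<mu> \<delta> by (auto simp: invariant_measures_def prob_space_def)
  have "measure \<mu> B = measure ?\<delta> B" for B
  proof (cases "B \<in> sets \<mu>")
    case True
    from measure_average_measure[OF fin S True] show ?thesis unfolding avg by (simp add: field_simps)
  qed (use S in \<open>simp add: measure_notin_sets\<close>)
  then have "supported_on_periodic_orbit M \<mu>"
    using fixed_point_measure_supported[OF one] by (simp add: supported_on_periodic_orbit_def)
  then show False using supported_on_periodic_orbit_entropy[OF \<mu>] inf by simp
qed

text \<open>Since the entropy is finite, the exponent \<open>- \<infinity>\<close> would make the maximal free energy
  \<open>- \<infinity>\<close>. Then all invariant measures would be equilibrium states, in
  particular two different point masses.\<close>

lemma unique_equilibrium_lyapunov_finite: "lyapunov_exponent A \<mu> \<noteq> - \<infinity>"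
proof
  assume minf: "lyapunov_exponent A \<mu> = - \<infinity>"
  then have "free_energy A s \<mu> = - \<infinity>"
    using unique_equilibrium_entropy_finite s0 by (cases "metric_entropy \<mu> shift_map") (auto simp: free_energy_def)
  then have all: "\<nu> = \<mu>" if "\<nu> \<in> invariant_measures M" for \<nu>
    using equilibrium_of_ge[OF that] by simp
  have "fixed_point_measure M 1 = fixed_point_measure M 2"
    using all[OF fixed_point_measure_invariant[of 1 M]] all[OF fixed_point_measure_invariant[of 2 M]] M2 by simp
  then show False using fixed_point_measure_neq[of 1 M 2] M2 by simp
qed

lemma unique_equilibrium_charges_nonzero:
  assumes "set w \<subseteq> {1..M}" "word_prod A w = 0"
  shows "cylinder_weight M \<mu> w = 0"
  using lyapunov_exponent_MInf[OF equilibrium_invariant assms(1) _ assms(2)] unique_equilibrium_lyapunov_finite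
  by (metis cylinder_weight_def measure_nonneg less_eq_real_def)

text \<open>Almost every sequence has only rotations of \<open>w\<close> as windows of length \<open>n\<close>. Consecutive
  windows overlap in all but their outer letters. Since both have the same letters with multiplicity, the
  outer letters agree and the sequence is periodic with period \<open>n\<close>.\<close>

lemma unique_equilibrium_periodic:
  assumes n: "1 \<le> n" "length w = n" "set w \<subseteq> {1..M}"
    and words: "\<And>x. length x = n \<Longrightarrow> set x \<subseteq> {1..M} \<Longrightarrow> word_prod A x \<noteq> 0 \<Longrightarrow> \<exists>i. x = rotate i w"
  shows "supported_on_periodic_orbit M \<mu>"
proof -
  note \<mu> = equilibrium_invariant
  interpret measure_preserving \<mu> shift_map by (rule invariant_measure_preserving[OF \<mu>])
  define y where "y i = w ! (i mod n)" for i
  have yper: "y (i + n) = y i" for i by (simp add: y_def)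
  have wy: "w = map y [0..<n]" using n by (intro nth_equalityI) (auto simp: y_def)
  have "y i \<in> set w" for i using n unfolding y_def by (intro nth_mem) simp
  then have yf: "y \<in> full_shift M" using n(3) unfolding full_shift_def by blast
  define Z where "Z i = {x \<in> space \<mu>. map ((shift_map ^^ i) x) [0..<n] \<notin> range (\<lambda>i. rotate i w)}" for i
  have null: "Z i \<in> null_sets \<mu>" for i
  proof (induction i)
    case 0
    let ?W = "{v \<in> words {1..M} n. v \<notin> range (\<lambda>i. rotate i w)}"
    have "Z 0 = (\<Union>v\<in>?W. cylinder M v)"
      by (auto simp: Z_def space_invariant_measure[OF \<mu>] cylinder_def words_def full_shift_def)
    moreover have "cylinder M v \<in> null_sets \<mu>" if "v \<in> ?W" for v
    proof (rule null_setsI[OF _ cylinder_measurable[OF \<mu>]])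
      have "word_prod A v = 0" using words[of v] that by (auto simp: words_def)
      then have "cylinder_weight M \<mu> v = 0"
        using that by (intro unique_equilibrium_charges_nonzero) (auto simp: words_def)
      then show "emeasure \<mu> (cylinder M v) = 0" by (simp add: cylinder_weight_def emeasure_eq_measure)
    qed
    moreover have "countable ?W" by (intro countable_finite) simp
    ultimately show ?case using null_sets_UN'[of ?W "cylinder M" \<mu>] by simp
  next
    case (Suc i)
    have "Z (Suc i) = shift_map -` Z i \<inter> space \<mu>"
      using measurable_space[OF T_measurable] by (auto simp: Z_def funpow_swap1)
    then show ?case using Suc T_preserving[of "Z i"] measurable_sets[OF T_measurable, of "Z i"]
      by (auto simp: null_sets_def)
  qed
  have in_orbit: "\<exists>k. x = (shift_map ^^ k) y" if x: "x \<in> space \<mu>" "x \<notin> (\<Union>i. Z i)" for x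
  proof -
    have win: "\<exists>k. map x [i..<i + n] = rotate k w" for i
    proof -
      have "map ((shift_map ^^ i) x) [0..<n] = map x [i..<i + n]"
        by (rule nth_equalityI) (auto simp: shift_map_funpow add.commute)
      moreover have "x \<notin> Z i" using x by blast
      ultimately show ?thesis using x(1) by (auto simp: Z_def)
    qed
    have xper: "x (i + n) = x i" for i
    proof -
      obtain k where k: "map x [i..<i + n] = rotate k w" using win by blast
      obtain k' where k': "map x [Suc i..<Suc i + n] = rotate k' w" using win by blast
      have "mset (map x [i..<i + n]) = mset (map x [Suc i..<Suc i + n])"
        by (simp only: k k' mset_rotate)
      moreover have "[i..<i + n] = i # [Suc i..<i + n]" using n(1) by (intro upt_conv_Cons) simp
      moreover have "[Suc i..<Suc i + n] = [Suc i..<i + n] @ [i + n]" using n(1) by simp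
      ultimately show ?thesis by simp
    qed
    obtain k where k: "map x [0..<n] = rotate k w" using win[of 0] by auto
    have "x i = y (i + k)" for i
    proof -
      have "x i = x (i mod n)" by (rule periodic_mod[of x, OF xper, symmetric])
      also have "\<dots> = map x [0..<n] ! (i mod n)" using n(1) by simp
      also have "\<dots> = w ! ((k + i mod n) mod n)" unfolding k using n by (simp add: nth_rotate)
      also have "\<dots> = y (i + k)" by (simp add: y_def mod_simps add.commute)
      finally show ?thesis .
    qed
    then show ?thesis by (auto simp: shift_map_funpow fun_eq_iff intro: exI[of _ k])
  qed
  let ?O = "{(shift_map ^^ k) y | k. True}"
  have "?O \<subseteq> space \<mu>" using yf by (auto simp: space_invariant_measure[OF \<mu>] shift_map_funpow full_shift_def)
  have "?O \<in> sets \<mu>"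
  proof -
    have "?O \<in> sets borel" by (rule sets.countable) (auto simp: full_SetCompr_eq sequence_singleton_in_borel)
    then show ?thesis
      using \<mu> \<open>?O \<subseteq> space \<mu>\<close> space_invariant_measure[OF \<mu>]
      by (auto simp: invariant_measures_def sets_restrict_space image_iff intro!: bexI[of _ ?O])
  qed
  moreover have "AE x in \<mu>. x \<in> ?O"
  proof (rule AE_I')
    show "(\<Union>i. Z i) \<in> null_sets \<mu>" using null by (intro null_sets_UN) auto
    show "{x \<in> space \<mu>. x \<notin> ?O} \<subseteq> (\<Union>i. Z i)" using in_orbit by blast
  qed
  ultimately have "measure \<mu> ?O = 1" by (simp add: prob_eq_1)
  moreover have "(shift_map ^^ n) y = y" by (simp add: shift_map_funpow yper)
  ultimately show ?thesis unfolding supported_on_periodic_orbit_def using n(1) yf by blast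
qed

end

section \<open>Measures from stationary weights\<close>

lemma cylinder_empty:
  "\<not> set w \<subseteq> {1..M} \<Longrightarrow> cylinder M w = {}"
proof -
  assume w: "\<not> set w \<subseteq> {1..M}"
  have "set w \<subseteq> {1..M}" if "x \<in> cylinder M w" for x
  proof -
    have "set w = set (map x [0..<length w])" using that by (simp add: cylinder_def)
    also have "\<dots> \<subseteq> range x" by auto
    also have "\<dots> \<subseteq> {1..M}" using that unfolding cylinder_def full_shift_def by blast
    finally show ?thesis .
  qed
  with w show ?thesis by blast
qed

text \<open>Every level set of a coordinate is a finite union of cylinders, so the coordinates are measurable
  for the sigma-algebra that the cylinders generate.\<close>

lemma cylinder_generates:
  "sets (restrict_space borel (full_shift M)) = sigma_sets (full_shift M) (range (cylinder M))"
proof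
  let ?G = "sigma (full_shift M) (range (cylinder M))"
  have sub: "range (cylinder M) \<subseteq> Pow (full_shift M)" by (auto simp: cylinder_def)
  have spG: "space ?G = full_shift M" and setsG: "sets ?G = sigma_sets (full_shift M) (range (cylinder M))"
    using sub by (simp_all add: space_measure_of sets_measure_of)
  have "(\<lambda>x. x) \<in> measurable ?G (restrict_space borel (full_shift M))"
  proof (rule measurable_restrict_space2)
    show "(\<lambda>x. x) \<in> borel_measurable ?G"
    proof (rule measurable_coordinatewise_then_product)
      fix i
      have "{x \<in> full_shift M. x i = c} = (\<Union>w\<in>words {1..M} i. cylinder M (w @ [c]))" for c
      proof (intro equalityI subsetI)
        fix x assume x: "x \<in> {x \<in> full_shift M. x i = c}"
        then have "range x \<subseteq> {1..M}" unfolding full_shift_def by blast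
        then have "map x [0..<i] \<in> words {1..M} i" by (auto simp: words_def)
        moreover have "x \<in> cylinder M (map x [0..<i] @ [c])" using x by (auto simp: cylinder_def)
        ultimately show "x \<in> (\<Union>w\<in>words {1..M} i. cylinder M (w @ [c]))" by blast
      next
        fix x assume "x \<in> (\<Union>w\<in>words {1..M} i. cylinder M (w @ [c]))"
        then obtain w where w: "length w = i" "x \<in> cylinder M (w @ [c])" by (auto simp: words_def)
        then have "x i = (w @ [c]) ! i" unfolding cylinder_def map_prefix_eq_iff by simp
        then show "x \<in> {x \<in> full_shift M. x i = c}" using w by (simp add: cylinder_def nth_append)
      qed
      moreover have "(\<Union>w\<in>words {1..M} i. cylinder M (w @ [c])) \<in> sets ?G" for c
        unfolding setsG[symmetric]
      proof (rule sets.finite_UN)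
        show "cylinder M (w @ [c]) \<in> sets ?G" for w unfolding setsG by (rule sigma_sets.Basic) simp
      qed simp
      ultimately have c: "{x \<in> full_shift M. x i = c} \<in> sets ?G" for c by (simp only:)
      show "(\<lambda>x. x i) \<in> borel_measurable ?G"
      proof (rule measurableI)
        fix B :: "nat set"
        have "(\<lambda>x. x i) -` B \<inter> space ?G = (\<Union>c\<in>B. {x \<in> full_shift M. x i = c})"
          by (auto simp: spG)
        also have "\<dots> \<in> sets ?G" using c by (intro sets.countable_UN') auto
        finally show "(\<lambda>x. x i) -` B \<inter> space ?G \<in> sets ?G" .
      qed simp
    qed
  qed (simp add: spG)
  from measurable_sets[OF this]
  show "sets (restrict_space borel (full_shift M)) \<subseteq> sigma_sets (full_shift M) (range (cylinder M))"
    using sets.sets_into_space[of _ "restrict_space borel (full_shift M)"]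
    by (auto simp: spG setsG space_restrict_space Int_absorb2)
  have "full_shift M = space (restrict_space borel (full_shift M))" by (simp add: space_restrict_space)
  then show "sigma_sets (full_shift M) (range (cylinder M)) \<subseteq> sets (restrict_space borel (full_shift M))"
    using cylinder_in_restricted_borel by (metis image_subsetI sets.sigma_sets_subset)
qed

lemma cylinder_Int_stable: "Int_stable (range (cylinder M))"
proof (rule Int_stableI)
  have *: "\<exists>w. cylinder M u \<inter> cylinder M v = cylinder M w" if le: "length u \<le> length v" for u v
  proof (cases "take (length u) v = u")
    case True
    have "cylinder M v \<subseteq> cylinder M u"
    proof
      fix x assume "x \<in> cylinder M v"
      then have "x \<in> full_shift M" "v = map x [0..<length v]" by (auto simp: cylinder_def)
      then have "take (length u) (map x [0..<length v]) = u" using True by simp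
      then show "x \<in> cylinder M u" using \<open>x \<in> full_shift M\<close> le by (simp add: cylinder_def take_map)
    qed
    then show ?thesis by blast
  next
    case False
    have "cylinder M u \<inter> cylinder M v = {}"
    proof (intro equals0I)
      fix x assume x: "x \<in> cylinder M u \<inter> cylinder M v"
      then have "map x [0..<length v] = v" "map x [0..<length u] = u" by (auto simp: cylinder_def)
      then have "take (length u) v = u" using le by (metis min.absorb1 take_map take_upt add_0)
      then show False using False by simp
    qed
    also have "\<dots> = cylinder M [0]" by (rule cylinder_empty[symmetric]) auto
    finally show ?thesis by blast
  qed
  fix a b assume "a \<in> range (cylinder M)" "b \<in> range (cylinder M)"
  then obtain u v where "a = cylinder M u" "b = cylinder M v" by blast
  then show "a \<inter> b \<in> range (cylinder M)"
    using *[of u v] *[of v u] by (metis Int_commute linear rangeI)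
qed

lemma point_measure_words_take:
  assumes "stationary_weight S g"
  shows "distr (point_measure (words S (n + m)) (\<lambda>w. ennreal (g w))) (count_space (words S n)) (take n)
    = point_measure (words S n) (\<lambda>w. ennreal (g w))"
proof -
  have fin: "finite S" and nn: "\<And>l. 0 \<le> g l" using assms by (auto simp: stationary_weight_def)
  have meas: "take n \<in> measurable (point_measure (words S (n + m)) (\<lambda>w. ennreal (g w))) (count_space (words S n))"
    by (auto simp: measurable_def space_point_measure sets_point_measure words_def dest: in_set_takeD)
  show ?thesis
  proof (rule measure_eqI_finite[of _ "words S n"])
    fix a assume a: "a \<in> words S n"
    have "emeasure (distr (point_measure (words S (n + m)) (\<lambda>w. ennreal (g w))) (count_space (words S n)) (take n)) {a} =
      emeasure (point_measure (words S (n + m)) (\<lambda>w. ennreal (g w))) (take n -` {a} \<inter> words S (n + m))"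
      using a by (subst emeasure_distr[OF meas]) (auto simp: space_point_measure)
    also have "\<dots> = (\<Sum>w\<in>take n -` {a} \<inter> words S (n + m). ennreal (g w))"
      by (rule emeasure_point_measure_finite) (use fin in auto)
    also have "\<dots> = (\<Sum>v\<in>words S m. ennreal (g (a @ v)))"
    proof (rule sum.reindex_bij_betw[symmetric, of "\<lambda>v. a @ v"])
      show "bij_betw ((@) a) (words S m) (take n -` {a} \<inter> words S (n + m))"
      proof (rule bij_betw_byWitness[where f' = "drop n"])
        show "\<forall>l\<in>take n -` {a} \<inter> words S (n + m). a @ drop n l = l"
          by (metis IntD1 append_take_drop_id singletonD vimageE)
        show "drop n ` (take n -` {a} \<inter> words S (n + m)) \<subseteq> words S m"
          by (auto simp: words_def dest: in_set_dropD)
      qed (use a in \<open>auto simp: words_def\<close>)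
    qed
    also have "\<dots> = ennreal (g a)"
      using stationary_weight_append[OF assms, of a m] a nn by (simp add: sum_ennreal words_def)
    also have "\<dots> = emeasure (point_measure (words S n) (\<lambda>w. ennreal (g w))) {a}"
      using a fin by (subst emeasure_point_measure_finite) auto
    finally show "emeasure (distr (point_measure (words S (n + m)) (\<lambda>w. ennreal (g w))) (count_space (words S n)) (take n)) {a}
       = emeasure (point_measure (words S n) (\<lambda>w. ennreal (g w))) {a}" .
  qed (use fin in \<open>auto simp: sets_point_measure\<close>)
qed

lemma point_measure_words_prob:
  assumes "stationary_weight S g"
  shows "prob_space (point_measure (words S n) (\<lambda>w. ennreal (g w)))"
proof (rule prob_spaceI)
  have fin: "finite S" and nn: "\<And>l. 0 \<le> g l" using assms by (auto simp: stationary_weight_def)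
  show "emeasure (point_measure (words S n) (\<lambda>w. ennreal (g w))) (space (point_measure (words S n) (\<lambda>w. ennreal (g w)))) = 1"
    using fin nn stationary_weight_total[OF assms, of n]
    by (simp add: space_point_measure emeasure_point_measure_finite sum_ennreal)
qed

text \<open>The measure is a projective limit (Daniell--Kolmogorov). The limit is taken over sequences in the discrete
  copy of the natural numbers, which is a Polish space, and is then pushed to the full shift by the
  function \<open>clamp\<close>, which only alters letters outside \<open>{1..M}\<close>; these have mass zero.\<close>

theorem stationary_weight_realized:
  assumes g: "stationary_weight {1..M} g" and M: "1 \<le> M"
  obtains \<nu> where "\<nu> \<in> invariant_measures M" "\<And>w. set w \<subseteq> {1..M} \<Longrightarrow> cylinder_weight M \<nu> w = g w"
proof -
  define D where "D n = point_measure (words {1..M} n) (\<lambda>w. ennreal (g w))" for n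
  define \<rho> where "\<rho> J l = (\<lambda>j\<in>J. discrete (l ! j))" for J :: "nat set" and l :: "nat list"
  define N where "N J = Suc (Max (insert 0 J))" for J :: "nat set"
  define PJ where "PJ J = distr (D (N J)) (PiM J (\<lambda>_. borel :: nat discrete measure)) (\<rho> J)" for J
  have spD: "space (D n) = words {1..M} n" and setsD: "sets (D n) = Pow (words {1..M} n)" for n
    by (simp_all add: D_def space_point_measure sets_point_measure)
  have \<rho>m: "\<rho> J \<in> measurable (D n) (PiM J (\<lambda>_. borel))"
    and \<rho>m': "\<rho> J \<in> measurable (count_space (words {1..M} n)) (PiM J (\<lambda>_. borel))" for J n
    by (auto simp: measurable_def \<rho>_def space_PiM spD setsD)
  have N: "finite J \<Longrightarrow> j \<in> J \<Longrightarrow> j < N J" for J j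
    unfolding N_def by (intro le_imp_less_Suc Max_ge) auto
  have extend: "distr (D (n + m)) (PiM J (\<lambda>_. borel)) (\<rho> J) = distr (D n) (PiM J (\<lambda>_. borel)) (\<rho> J)"
    if "\<And>j. j \<in> J \<Longrightarrow> j < n" for J n m
  proof -
    have tm: "take n \<in> measurable (D (n + m)) (count_space (words {1..M} n))"
      by (auto simp: measurable_def spD setsD words_def dest: in_set_takeD)
    have "distr (D n) (PiM J (\<lambda>_. borel)) (\<rho> J) =
        distr (distr (D (n + m)) (count_space (words {1..M} n)) (take n)) (PiM J (\<lambda>_. borel)) (\<rho> J)"
      using point_measure_words_take[OF g] by (simp add: D_def)
    also have "\<dots> = distr (D (n + m)) (PiM J (\<lambda>_. borel)) (\<rho> J \<circ> take n)"
      by (rule distr_distr[OF \<rho>m' tm])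
    also have "\<dots> = distr (D (n + m)) (PiM J (\<lambda>_. borel)) (\<rho> J)"
      by (rule distr_cong) (use that in \<open>auto simp: \<rho>_def fun_eq_iff\<close>)
    finally show ?thesis by simp
  qed
  have PJ: "PJ J = distr (D n) (PiM J (\<lambda>_. borel)) (\<rho> J)"
    if "finite J" "\<And>j. j \<in> J \<Longrightarrow> j < n" for J n
  proof (cases "n \<le> N J")
    case True
    then show ?thesis using extend[of J n "N J - n"] that by (simp add: PJ_def)
  next
    case False
    then show ?thesis using extend[of J "N J" "n - N J"] N that by (simp add: PJ_def)
  qed
  have "projective_family UNIV PJ (\<lambda>_. borel)"
  proof (rule projective_family.intro)
    fix J H :: "nat set" assume JH: "J \<subseteq> H" "finite H"
    then have J: "finite J" "\<And>j. j \<in> J \<Longrightarrow> j < N H" using N finite_subset by blast+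
    have "distr (PJ H) (PiM J (\<lambda>_. borel)) (\<lambda>f. restrict f J) =
       distr (D (N H)) (PiM J (\<lambda>_. borel)) ((\<lambda>f. restrict f J) \<circ> \<rho> H)"
      unfolding PJ_def by (rule distr_distr[OF measurable_restrict_subset[OF JH(1)] \<rho>m])
    also have "\<dots> = distr (D (N H)) (PiM J (\<lambda>_. borel)) (\<rho> J)"
      by (rule distr_cong) (use JH in \<open>auto simp: \<rho>_def fun_eq_iff\<close>)
    also have "\<dots> = PJ J" by (rule PJ[OF J, symmetric])
    finally show "PJ J = distr (PJ H) (PiM J (\<lambda>_. borel)) (\<lambda>f. restrict f J)" by simp
  next
    fix J :: "nat set"
    show "prob_space (PJ J)"
      unfolding PJ_def D_def
      by (rule prob_space.prob_space_distr[OF point_measure_words_prob[OF g] \<rho>m[unfolded D_def]])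
  qed
  then interpret polish_projective UNIV PJ by (rule polish_projective.intro)
  define clamp where "clamp d = (if of_discrete d \<in> {1..M} then of_discrete d else 1)" for d :: "nat discrete"
  let ?S = "restrict_space (borel :: (nat \<Rightarrow> nat) measure) (full_shift M)"
  define \<phi> where "\<phi> x = (\<lambda>i. clamp (x i))" for x :: "nat \<Rightarrow> nat discrete"
  have clampS: "clamp d \<in> {1..M}" for d using M by (auto simp: clamp_def)
  have \<phi>m: "\<phi> \<in> measurable lim ?S"
  proof (rule measurable_restrict_space2)
    show "\<phi> \<in> borel_measurable lim"
    proof (rule measurable_coordinatewise_then_product)
      fix i
      have "clamp \<in> borel_measurable borel"
        by (rule measurableI) (auto intro: borel_open open_discrete)
      moreover have "(\<lambda>x. x i) \<in> measurable lim borel"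
        using measurable_component_singleton[of i UNIV "\<lambda>_. borel :: nat discrete measure"]
        by (simp cong: measurable_cong_sets)
      ultimately show "(\<lambda>x. \<phi> x i) \<in> borel_measurable lim"
        unfolding \<phi>_def by (rule measurable_compose[rotated])
    qed
  qed (use clampS in \<open>auto simp: \<phi>_def full_shift_def\<close>)
  define \<nu> where "\<nu> = distr lim ?S \<phi>"
  have prob: "prob_space \<nu>" unfolding \<nu>_def by (rule P.prob_space_distr[OF \<phi>m])
  have sets\<nu>: "sets \<nu> = sets ?S" by (simp add: \<nu>_def)
  have sp\<nu>: "space \<nu> = full_shift M" by (simp add: \<nu>_def space_restrict_space)
  have cylS: "cylinder M w \<in> sets \<nu>" for w unfolding sets\<nu> cylinder_generates by blast
  have val: "emeasure \<nu> (cylinder M w) = ennreal (g w)" if w: "set w \<subseteq> {1..M}" for w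
  proof -
    define n where "n = length w"
    define X where "X = (\<Pi>\<^sub>E j\<in>{..<n}. {d. clamp d = w ! j})"
    have X: "X \<in> sets (PiM {..<n} (\<lambda>_. borel :: nat discrete measure))"
      unfolding X_def by (intro sets_PiM_I_finite) (auto intro: borel_open open_discrete)
    have "emeasure \<nu> (cylinder M w) = emeasure lim (\<phi> -` cylinder M w \<inter> space lim)"
      unfolding \<nu>_def using cylS by (intro emeasure_distr[OF \<phi>m]) (simp add: sets\<nu>)
    also have "\<phi> -` cylinder M w \<inter> space lim = emb UNIV {..<n} X"
      using clampS by (auto simp: cylinder_def map_prefix_eq_iff \<phi>_def full_shift_def prod_emb_def
          space_PiM X_def n_def PiE_iff)
    also have "emeasure lim \<dots> = emeasure (PJ {..<n}) X"
      by (rule emeasure_lim_emb) (use X in auto)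
    also have "\<dots> = emeasure (distr (D n) (PiM {..<n} (\<lambda>_. borel)) (\<rho> {..<n})) X"
      by (subst PJ[of "{..<n}" n]) auto
    also have "\<dots> = emeasure (D n) (\<rho> {..<n} -` X \<inter> space (D n))"
      by (rule emeasure_distr[OF \<rho>m X])
    also have "\<rho> {..<n} -` X \<inter> space (D n) = {w}"
    proof -
      have "clamp (discrete (l ! j)) = l ! j" if "l \<in> words {1..M} n" "j < n" for l j
      proof -
        have "l ! j \<in> set l" "set l \<subseteq> {1..M}" using that nth_mem[of j l] by (auto simp: words_def)
        then have "l ! j \<in> {1..M}" by blast
        then show ?thesis by (simp add: clamp_def discrete_inverse)
      qed
      then show ?thesis
        using w by (auto simp: \<rho>_def X_def spD n_def PiE_iff words_def list_eq_iff_nth_eq[of _ w])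
    qed
    also have "emeasure (D n) {w} = ennreal (g w)"
      unfolding D_def using w by (subst emeasure_point_measure_finite) (auto simp: words_def n_def finite_lists_length_eq)
    finally show ?thesis .
  qed
  have shm: "shift_map \<in> measurable \<nu> \<nu>" by (rule shift_map_measurable_full[OF sets\<nu>])
  have shift_cyl: "emeasure \<nu> (shift_map -` cylinder M w \<inter> space \<nu>) = emeasure \<nu> (cylinder M w)" for w
  proof (cases "set w \<subseteq> {1..M}")
    case True
    have "shift_map -` cylinder M w \<inter> space \<nu> = (\<Union>i\<in>{1..M}. cylinder M (i # w))"
    proof -
      have "map x [0..<length (i # w)] = i # w \<longleftrightarrow> x 0 = i \<and> map (shift_map x) [0..<length w] = w" for x i
        unfolding map_prefix_eq_iff by (simp add: All_less_Suc2 shift_map_def)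
      then show ?thesis by (auto simp: cylinder_def sp\<nu> full_shift_def shift_map_def[abs_def])
    qed
    also have "emeasure \<nu> \<dots> = (\<Sum>i\<in>{1..M}. emeasure \<nu> (cylinder M (i # w)))"
    proof (rule sum_emeasure[symmetric])
      have "x 0 = i" if "x \<in> cylinder M (i # w)" for x i
        using that unfolding cylinder_def map_prefix_eq_iff by auto
      then show "disjoint_family_on (\<lambda>i. cylinder M (i # w)) {1..M}"
        unfolding disjoint_family_on_def by blast
    qed (use cylS in auto)
    also have "\<dots> = (\<Sum>i\<in>{1..M}. ennreal (g (i # w)))" using True by (intro sum.cong) (auto simp: val)
    also have "\<dots> = ennreal (g w)"
      using g True by (subst sum_ennreal) (auto simp: stationary_weight_def)
    finally show ?thesis using val[OF True] by simp
  qed (simp add: cylinder_empty)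
  have "distr \<nu> \<nu> shift_map = \<nu>"
  proof (rule measure_eqI_generator_eq[OF cylinder_Int_stable, of M "full_shift M" _ _ "\<lambda>_. full_shift M"])
    show "range (cylinder M) \<subseteq> Pow (full_shift M)" by (auto simp: cylinder_def)
    fix X assume "X \<in> range (cylinder M)"
    then show "emeasure (distr \<nu> \<nu> shift_map) X = emeasure \<nu> X"
      using cylS shift_cyl by (auto simp: emeasure_distr[OF shm])
  next
    have "full_shift M = cylinder M []" by (simp add: cylinder_def)
    then show "range (\<lambda>_::nat. full_shift M) \<subseteq> range (cylinder M)" by auto
  next
    interpret d: prob_space "distr \<nu> \<nu> shift_map" by (rule prob_space.prob_space_distr[OF prob shm])
    show "emeasure (distr \<nu> \<nu> shift_map) (full_shift M) \<noteq> \<infinity>" by simp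
  qed (simp_all add: sets\<nu> cylinder_generates)
  then have "emeasure \<nu> (shift_map -` B \<inter> space \<nu>) = emeasure \<nu> B" if "B \<in> sets \<nu>" for B
    using emeasure_distr[OF shm that] by simp
  then have "\<nu> \<in> invariant_measures M" using prob sets\<nu> by (auto simp: invariant_measures_def)
  moreover have "cylinder_weight M \<nu> w = g w" if "set w \<subseteq> {1..M}" for w
    using val[OF that] g by (simp add: cylinder_weight_def measure_def stationary_weight_def)
  ultimately show ?thesis by (rule that)
qed

section \<open>A variational lower bound for the pressure\<close>

text \<open>The window of length \<open>q\<close> at place \<open>t\<close> in the periodic extension of a word \<open>u\<close> of length \<open>N\<close>.\<close>

definition cyclic_window :: "nat \<Rightarrow> nat \<Rightarrow> nat \<Rightarrow> 'b list \<Rightarrow> 'b list" where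
  "cyclic_window N t q u = map (\<lambda>i. u ! ((t + i) mod N)) [0..<q]"

lemma length_cyclic_window [simp]: "length (cyclic_window N t q u) = q"
  by (simp add: cyclic_window_def)

lemma nth_cyclic_window: "i < q \<Longrightarrow> cyclic_window N t q u ! i = u ! ((t + i) mod N)"
  by (simp add: cyclic_window_def)

lemma cyclic_window_words:
  assumes "u \<in> words S N" "1 \<le> N"
  shows "cyclic_window N t q u \<in> words S q"
proof -
  have "u ! (k mod N) \<in> S" for k
  proof -
    have "u ! (k mod N) \<in> set u" using assms by (intro nth_mem) (simp add: words_def)
    moreover have "set u \<subseteq> S" using assms by (simp add: words_def)
    ultimately show ?thesis by blast
  qed
  then show ?thesis by (auto simp: words_def cyclic_window_def)
qed

lemma cyclic_window_snoc: "cyclic_window N t (Suc q) u = cyclic_window N t q u @ [u ! ((t + q) mod N)]"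
  by (simp add: cyclic_window_def)

lemma cyclic_window_Cons: "cyclic_window N t (Suc q) u = u ! (t mod N) # cyclic_window N (Suc t) q u"
  by (rule nth_equalityI) (auto simp: cyclic_window_def nth_Cons' less_Suc_eq_0_disj simp del: upt_Suc)

lemma cyclic_window_period: "cyclic_window N (t + N) q u = cyclic_window N t q u"
proof -
  have "(t + N + i) mod N = (t + i) mod N" for i
    by (metis add.commute add.left_commute mod_add_self2)
  then show ?thesis by (simp add: cyclic_window_def)
qed

lemma cyclic_window_inner:
  assumes "t + q \<le> length u"
  shows "cyclic_window (length u) t q u = take q (drop t u)"
  using assms by (intro nth_equalityI) (auto simp: cyclic_window_def)

locale submultiplicative_weight =
  fixes S :: "'b set" and a :: "'b list \<Rightarrow> real"
  assumes finite_S: "finite S"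
    and nonneg: "0 \<le> a w"
    and submult: "a (u @ v) \<le> a u * a v"
    and a_Nil: "a [] \<le> 1"
begin

definition Z :: "nat \<Rightarrow> real" where
  "Z n = (\<Sum>w\<in>words S n. a w)"

definition law :: "nat \<Rightarrow> 'b list \<Rightarrow> real" where
  "law N u = a u / Z N"

text \<open>Choose a word \<open>u\<close> of length \<open>N\<close> with probability proportional to its weight, extend it periodically, and
  apply a uniformly chosen shift: these are the cylinder masses of the resulting measure. Working
  with periodic extensions makes it exactly invariant, not only up to boundary terms.\<close>

definition periodic_weight :: "nat \<Rightarrow> 'b list \<Rightarrow> real" where
  "periodic_weight N w =
     (\<Sum>t<N. \<Sum>u\<in>{u\<in>words S N. cyclic_window N t (length w) u = w}. law N u) / real N"

lemma Z_nonneg: "0 \<le> Z n"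
  unfolding Z_def by (intro sum_nonneg nonneg)

lemma periodic_weight_nonneg: "0 \<le> periodic_weight N w"
  unfolding periodic_weight_def law_def
  by (intro divide_nonneg_nonneg sum_nonneg nonneg Z_nonneg) auto

lemma exp_bound: "\<exists>C\<ge>0. \<forall>w. set w \<subseteq> S \<longrightarrow> a w \<le> exp (C * real (length w))"
proof -
  define C where "C = (\<Sum>i\<in>S. \<bar>ln (a [i])\<bar>)"
  have C0: "0 \<le> C" unfolding C_def by (intro sum_nonneg) simp
  have one: "a [i] \<le> exp C" if "i \<in> S" for i
  proof (cases "a [i] = 0")
    case False
    then have "0 < a [i]" using nonneg[of "[i]"] by simp
    moreover have "ln (a [i]) \<le> C" unfolding C_def
      using that member_le_sum[of i S "\<lambda>i. \<bar>ln (a [i])\<bar>"] finite_S by force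
    ultimately show ?thesis by (metis exp_le_cancel_iff exp_ln)
  qed simp
  have "a w \<le> exp (C * real (length w))" if "set w \<subseteq> S" for w
    using that
  proof (induction w)
    case Nil then show ?case using a_Nil by simp
  next
    case (Cons i w)
    have "a (i # w) \<le> a [i] * a w" using submult[of "[i]" w] by simp
    also have "\<dots> \<le> exp C * exp (C * real (length w))"
      using Cons one nonneg by (intro mult_mono) auto
    finally show ?case by (simp add: exp_add[symmetric] algebra_simps)
  qed
  then show ?thesis using C0 by blast
qed

text \<open>A version of the logarithm that is bounded below, so that windows across the seam of the
  periodic extension, whose weight may vanish, cost at most \<open>K\<close>.\<close>

definition floored_log :: "real \<Rightarrow> 'b list \<Rightarrow> real" where
  "floored_log K w = (if 0 < a w then max (ln (a w)) (- K) else - K)"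

lemma log_le_floored: "0 < a w \<Longrightarrow> ln (a w) \<le> floored_log K w"
  and floored_ge: "- K \<le> floored_log K w"
  by (auto simp: floored_log_def)

context
  fixes N :: nat
  assumes N: "1 \<le> N" and ZN: "0 < Z N"
begin

lemma law_total: "(\<Sum>u\<in>words S N. law N u) = 1"
  using ZN by (simp add: law_def Z_def flip: sum_divide_distrib)

lemma law_nonneg: "0 \<le> law N u"
  using ZN nonneg by (simp add: law_def)

lemma sum_by_window:
  "(\<Sum>w\<in>words S q. (\<Sum>u\<in>{u\<in>words S N. cyclic_window N t q u = w}. p u)) = (\<Sum>u\<in>words S N. p u :: real)"
  using finite_S N by (intro sum.group) (auto intro: cyclic_window_words)

lemma expectation_by_window:
  "(\<Sum>w\<in>words S q. periodic_weight N w * G w) =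
    (\<Sum>u\<in>words S N. law N u * (\<Sum>t<N. G (cyclic_window N t q u))) / real N"
proof -
  have "(\<Sum>w\<in>words S q. periodic_weight N w * G w) =
     (\<Sum>w\<in>words S q. (\<Sum>t<N. \<Sum>u\<in>{u\<in>words S N. cyclic_window N t q u = w}. law N u * G (cyclic_window N t q u))) / real N"
    unfolding sum_divide_distrib
    by (intro sum.cong) (auto simp: periodic_weight_def words_def sum_distrib_right sum_divide_distrib intro!: sum.cong)
  also have "(\<Sum>w\<in>words S q. (\<Sum>t<N. \<Sum>u\<in>{u\<in>words S N. cyclic_window N t q u = w}. law N u * G (cyclic_window N t q u)))
     = (\<Sum>t<N. \<Sum>u\<in>words S N. law N u * G (cyclic_window N t q u))"
    by (subst sum.swap) (simp only: sum_by_window)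
  also have "\<dots> = (\<Sum>u\<in>words S N. law N u * (\<Sum>t<N. G (cyclic_window N t q u)))"
    by (subst sum.swap) (simp add: sum_distrib_left)
  finally show ?thesis .
qed

lemma stationary_periodic_weight: "stationary_weight S (periodic_weight N)"
  unfolding stationary_weight_def
proof (intro conjI allI impI finite_S periodic_weight_nonneg)
  show "periodic_weight N [] = 1"
  proof -
    have "{u\<in>words S N. cyclic_window N t 0 u = []} = words S N" for t
      by (auto simp: cyclic_window_def)
    then show ?thesis using law_total N by (simp add: periodic_weight_def)
  qed
  fix w assume w: "set w \<subseteq> S"
  define F where "F t = (\<Sum>u\<in>{u\<in>words S N. cyclic_window N t (length w) u = w}. law N u)" for t
  have letter: "u ! (k mod N) \<in> S" if "u \<in> words S N" for u k
    using cyclic_window_words[OF that N, of k 1] by (simp add: cyclic_window_def words_def)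
  have "(\<Sum>i\<in>S. \<Sum>u\<in>{u\<in>words S N. cyclic_window N t (Suc (length w)) u = w @ [i]}. law N u) = F t" for t
  proof -
    have "(\<Sum>i\<in>S. \<Sum>u\<in>{u\<in>words S N. cyclic_window N t (Suc (length w)) u = w @ [i]}. law N u) =
      (\<Sum>i\<in>S. \<Sum>u\<in>{u\<in>{u\<in>words S N. cyclic_window N t (length w) u = w}. u ! ((t + length w) mod N) = i}. law N u)"
      by (intro sum.cong refl) (auto simp: cyclic_window_snoc)
    also have "\<dots> = F t" unfolding F_def
      by (intro sum.group) (use finite_S letter in auto)
    finally show ?thesis .
  qed
  then show "(\<Sum>i\<in>S. periodic_weight N (w @ [i])) = periodic_weight N w"
    unfolding periodic_weight_def sum_divide_distrib[symmetric]
    by (subst sum.swap) (simp add: F_def)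
  have "(\<Sum>i\<in>S. \<Sum>u\<in>{u\<in>words S N. cyclic_window N t (Suc (length w)) u = i # w}. law N u) = F (Suc t)" for t
  proof -
    have "(\<Sum>i\<in>S. \<Sum>u\<in>{u\<in>words S N. cyclic_window N t (Suc (length w)) u = i # w}. law N u) =
      (\<Sum>i\<in>S. \<Sum>u\<in>{u\<in>{u\<in>words S N. cyclic_window N (Suc t) (length w) u = w}. u ! (t mod N) = i}. law N u)"
      by (intro sum.cong refl) (auto simp: cyclic_window_Cons)
    also have "\<dots> = F (Suc t)" unfolding F_def
      by (intro sum.group) (use finite_S letter in auto)
    finally show ?thesis .
  qed
  then have "(\<Sum>i\<in>S. periodic_weight N (i # w)) = (\<Sum>t<N. F (Suc t)) / real N"
    unfolding periodic_weight_def sum_divide_distrib[symmetric]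
    by (subst sum.swap) simp
  also have "(\<Sum>t<N. F (Suc t)) = (\<Sum>t<N. F t)"
  proof -
    have "cyclic_window N N (length w) u = cyclic_window N 0 (length w) u" for u :: "'b list"
      using cyclic_window_period[of N 0 "length w" u] by simp
    then have "F N = F 0" by (simp add: F_def)
    moreover have "F 0 + (\<Sum>t<N. F (Suc t)) = (\<Sum>t<N. F t) + F N"
      by (metis sum.lessThan_Suc sum.lessThan_Suc_shift)
    ultimately show ?thesis by simp
  qed
  finally show "(\<Sum>i\<in>S. periodic_weight N (i # w)) = periodic_weight N w"
    by (simp add: periodic_weight_def F_def)
qed

lemma blocks_determine_word:
  assumes "N = q * m" "1 \<le> q" "j \<le> N" "u \<in> words S N" "v \<in> words S N"
    and eq: "\<And>i. i < m \<Longrightarrow> cyclic_window N (j + i * q) q u = cyclic_window N (j + i * q) q v"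
  shows "u = v"
proof (rule nth_equalityI)
  fix k assume "k < length u"
  then have k: "k < N" using assms by (simp add: words_def)
  define k' where "k' = (k + N - j) mod N"
  have k'N: "k' < N" using N by (simp add: k'_def)
  have "(j + k') mod N = (j + (k + N - j)) mod N" by (simp add: k'_def mod_simps)
  also have "\<dots> = k" using assms(3) k by simp
  finally have jk: "(j + k') mod N = k" .
  have i: "k' div q < m" using k'N assms(1,2) by (simp add: div_less_iff_less_mult mult.commute)
  have r: "k' mod q < q" using assms(2) by simp
  have "j + k' div q * q + k' mod q = j + k'" by (simp add: add.assoc)
  then have jk': "(j + k' div q * q + k' mod q) mod N = k" using jk by metis
  have "cyclic_window N (j + k' div q * q) q w ! (k' mod q) = w ! k" for w :: "'b list"
    unfolding nth_cyclic_window[OF r] jk' ..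
  then show "u ! k = v ! k" using eq[OF i] by metis
qed (use assms in \<open>simp add: words_def\<close>)

lemma sum_offset_blocks:
  assumes "N = q * m"
  shows "(\<Sum>j<q. \<Sum>i<m. F (j + i * q)) = (\<Sum>t<N. F t :: real)"
proof -
  have "(\<Sum>j<q. \<Sum>i<m. F (j + i * q)) = (\<Sum>i<m. \<Sum>j<q. F (j + i * q))" by (rule sum.swap)
  also have "\<dots> = (\<Sum>i<m. sum F {i * q..<i * q + q})"
  proof (rule sum.cong)
    fix i
    have "sum F {i * q..<i * q + q} = sum F {0 + i * q..<q + i * q}" by (simp add: add.commute)
    also have "\<dots> = (\<Sum>j=0..<q. F (j + i * q))" by (rule sum.shift_bounds_nat_ivl)
    finally show "(\<Sum>j<q. F (j + i * q)) = sum F {i * q..<i * q + q}" by (simp add: lessThan_atLeast0)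
  qed simp
  also have "\<dots> = (\<Sum>t<m * q. F t)" by (rule sum.nat_group)
  finally show ?thesis by (simp add: assms mult.commute)
qed

text \<open>For each offset \<open>j < q\<close>, a word of length \<open>q * m\<close> is determined by its \<open>m\<close> cyclic
  blocks that start at the places \<open>j + i * q\<close>. Add up the resulting entropy bounds over all offsets: every window is then
  used exactly once, and concavity replaces the average of the entropies by the entropy of the average.\<close>

lemma law_entropy_le_block_entropy:
  assumes q: "N = q * m" "1 \<le> q"
  shows "real q * (\<Sum>u\<in>words S N. eta (law N u)) \<le> real N * block_entropy S (periodic_weight N) q"
proof -
  let ?p = "\<lambda>u. law N u"
  define E where "E t = law_entropy (words S N) ?p (cyclic_window N t q)" for t
  have "(\<Sum>u\<in>words S N. eta (?p u)) \<le> (\<Sum>i<m. E (j + i * q))" if "j < q" for j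
  proof -
    have jN: "j \<le> N" using that q N by (cases m) auto
    have "inj_on (\<lambda>u. map (\<lambda>i. cyclic_window N (j + i * q) q u) [0..<m]) (words S N)"
    proof (rule inj_onI)
      fix u v assume uv: "u \<in> words S N" "v \<in> words S N"
        "map (\<lambda>i. cyclic_window N (j + i * q) q u) [0..<m] = map (\<lambda>i. cyclic_window N (j + i * q) q v) [0..<m]"
      show "u = v"
        by (rule blocks_determine_word[OF q jN uv(1,2)]) (use uv(3) in auto)
    qed
    then have "(\<Sum>u\<in>words S N. eta (?p u)) =
        law_entropy (words S N) ?p (\<lambda>u. map (\<lambda>i. cyclic_window N (j + i * q) q u) [0..<m])"
      by (rule law_entropy_inj[symmetric])
    also have "\<dots> \<le> (\<Sum>i<m. E (j + i * q))"
      unfolding E_def by (rule law_entropy_list) (use finite_S law_nonneg law_total in auto)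
    finally show ?thesis .
  qed
  then have "(\<Sum>j<q. \<Sum>u\<in>words S N. eta (?p u)) \<le> (\<Sum>j<q. \<Sum>i<m. E (j + i * q))"
    by (intro sum_mono) auto
  then have "real q * (\<Sum>u\<in>words S N. eta (?p u)) \<le> (\<Sum>t<N. E t)"
    by (simp add: sum_offset_blocks[OF q(1)])
  also have "\<dots> = (\<Sum>t<N. \<Sum>w\<in>words S q. eta (\<Sum>u\<in>{u\<in>words S N. cyclic_window N t q u = w}. ?p u))"
    unfolding E_def
    by (intro sum.cong refl law_entropy_superset) (use finite_S N in \<open>auto intro: cyclic_window_words\<close>)
  also have "\<dots> = (\<Sum>w\<in>words S q. \<Sum>t<N. eta (\<Sum>u\<in>{u\<in>words S N. cyclic_window N t q u = w}. ?p u))"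
    by (rule sum.swap)
  also have "\<dots> \<le> (\<Sum>w\<in>words S q. real N * eta (periodic_weight N w))"
  proof (rule sum_mono)
    fix w assume w: "w \<in> words S q"
    have "(\<Sum>t<N. eta (\<Sum>u\<in>{u\<in>words S N. cyclic_window N t q u = w}. ?p u)) \<le>
       real (card {..<N}) * eta ((\<Sum>t<N. \<Sum>u\<in>{u\<in>words S N. cyclic_window N t q u = w}. ?p u) / real (card {..<N}))"
      by (rule eta_concave_sum) (use N law_nonneg in \<open>auto intro!: sum_nonneg simp: lessThan_empty_iff\<close>)
    then show "(\<Sum>t<N. eta (\<Sum>u\<in>{u\<in>words S N. cyclic_window N t q u = w}. ?p u)) \<le> real N * eta (periodic_weight N w)"
      using w by (simp add: periodic_weight_def words_def)
  qed
  finally show ?thesis by (simp add: block_entropy_def sum_distrib_left)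
qed

text \<open>Cut \<open>u\<close> into a prefix of length \<open>j\<close>, all blocks except the last, which wraps around, and a remainder. The prefix and
  the remainder have total length \<open>q\<close> and contribute at most \<open>q * C\<close>.\<close>

lemma log_weight_le_blocks:
  assumes q: "N = q * m" "1 \<le> q" and C: "\<And>w. set w \<subseteq> S \<Longrightarrow> a w \<le> exp (C * real (length w))"
    and u: "u \<in> words S N" "0 < a u" and j: "j < q"
  shows "ln (a u) \<le> (\<Sum>i<m. floored_log K (cyclic_window N (j + i * q) q u)) + K + real q * C"
proof -
  have len: "length u = N" and uS: "set u \<subseteq> S" using u by (auto simp: words_def)
  have m: "1 \<le> m" using q N by (cases m) auto
  have lnC: "ln (a w) \<le> C * real (length w)" if "set w \<subseteq> S" "0 < a w" for w
    using C[OF that(1)] that(2) by (metis exp_gt_zero ln_exp ln_le_cancel_iff)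
  have split: "0 < a x \<and> 0 < a y \<and> ln (a (x @ y)) \<le> ln (a x) + ln (a y)" if "0 < a (x @ y)" for x y
  proof -
    have "0 < a x * a y" using that submult[of x y] by linarith
    then have p: "0 < a x" "0 < a y" using nonneg[of x] nonneg[of y] by (auto simp: zero_less_mult_iff)
    have "ln (a (x @ y)) \<le> ln (a x * a y)" using that submult[of x y] \<open>0 < a x * a y\<close> by simp
    then show ?thesis using p by (simp add: ln_mult)
  qed
  have chain: "0 < a (drop (j + i * q) u) \<and>
      ln (a u) \<le> C * real j + (\<Sum>l<i. floored_log K (cyclic_window N (j + l * q) q u)) + ln (a (drop (j + i * q) u))"
    if "i < m" for i
    using that
  proof (induction i)
    case 0
    have "j \<le> N" using j q m by (cases m) auto
    then have "length (take j u) = j" by (simp add: len)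
    moreover have "set (take j u) \<subseteq> S" using uS set_take_subset[of j u] by blast
    ultimately show ?case
      using split[of "take j u" "drop j u"] lnC[of "take j u"] u(2) by simp
  next
    case (Suc i)
    let ?d = "drop (j + i * q) u" and ?d' = "drop (j + Suc i * q) u" and ?b = "cyclic_window N (j + i * q) q u"
    have "Suc (Suc i) * q \<le> m * q" using Suc.prems by (intro mult_le_mono1) auto
    then have "j + i * q + q \<le> N" using j q(1) by (simp add: mult.commute)
    then have b: "?b = take q ?d" using cyclic_window_inner[of "j + i * q" q u] by (simp add: len)
    have d: "?d = ?b @ ?d'" unfolding b by (metis add.assoc add.commute append_take_drop_id drop_drop mult_Suc)
    have IH: "0 < a ?d" "ln (a u) \<le> C * real j + (\<Sum>l<i. floored_log K (cyclic_window N (j + l * q) q u)) + ln (a ?d)"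
      using Suc by auto
    have s: "0 < a ?b" "0 < a ?d'" "ln (a ?d) \<le> ln (a ?b) + ln (a ?d')"
      using split[of ?b ?d'] IH(1) d by auto
    show ?case using s IH log_le_floored[OF s(1), of K] by (simp add: algebra_simps)
  qed
  define r where "r = drop (j + (m - 1) * q) u"
  have Nm: "N = (m - 1) * q + q" using q(1) m by (cases m) auto
  have "set r \<subseteq> S" using uS set_drop_subset[of _ u] by (auto simp: r_def)
  moreover have "length r = q - j" using Nm j len by (simp add: r_def)
  moreover have c: "0 < a r" "ln (a u) \<le> C * real j + (\<Sum>l<m - 1. floored_log K (cyclic_window N (j + l * q) q u)) + ln (a r)"
    using chain[of "m - 1"] m by (auto simp: r_def)
  ultimately have "ln (a r) \<le> C * real (q - j)" using lnC[of r] by simp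
  then have "ln (a u) \<le> C * real j + (\<Sum>l<m - 1. floored_log K (cyclic_window N (j + l * q) q u)) + C * real (q - j)"
    using c by linarith
  moreover have "C * real j + C * real (q - j) = real q * C" using j by (simp add: of_nat_diff algebra_simps)
  moreover have "(\<Sum>l<m. floored_log K (cyclic_window N (j + l * q) q u)) =
    (\<Sum>l<m - 1. floored_log K (cyclic_window N (j + l * q) q u)) + floored_log K (cyclic_window N (j + (m - 1) * q) q u)"
    using m by (cases m) auto
  moreover note floored_ge[of K "cyclic_window N (j + (m - 1) * q) q u"]
  ultimately show ?thesis by linarith
qed

text \<open>For the probability vector proportional to \<open>a\<close>, the logarithm of the partition function is entropy plus mean
  energy. Both parts are estimated by windows of length \<open>q\<close>. The error does not depend on \<open>N\<close>.\<close>

lemma log_partition_function_le: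
  assumes q: "N = q * m" "1 \<le> q" and C: "\<And>w. set w \<subseteq> S \<Longrightarrow> a w \<le> exp (C * real (length w))"
  shows "real q * ln (Z N) \<le> real N * (block_entropy S (periodic_weight N) q +
      (\<Sum>w\<in>words S q. periodic_weight N w * floored_log K w)) + real q * (K + real q * C)"
proof -
  let ?p = "\<lambda>u. law N u" and ?G = "\<lambda>t u. floored_log K (cyclic_window N t q u)"
  define R where "R = real q * (K + real q * C)"
  have "ln (Z N) = (\<Sum>u\<in>words S N. ?p u * ln (Z N))"
    using law_total by (simp flip: sum_distrib_right)
  also have "\<dots> = (\<Sum>u\<in>words S N. eta (?p u) + ?p u * ln (a u))"
  proof (rule sum.cong)
    fix u
    show "?p u * ln (Z N) = eta (?p u) + ?p u * ln (a u)"
    proof (cases "a u = 0")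
      case False
      then have "0 < a u" using nonneg[of u] by simp
      then have "eta (?p u) = - (?p u * (ln (a u) - ln (Z N)))"
        using ZN by (simp add: eta_def law_def ln_div)
      then show ?thesis by (simp add: algebra_simps)
    qed (simp add: law_def)
  qed simp
  finally have "real q * ln (Z N) = real q * (\<Sum>u\<in>words S N. eta (?p u)) + (\<Sum>u\<in>words S N. ?p u * (real q * ln (a u)))"
    by (simp add: sum.distrib sum_distrib_left algebra_simps)
  also have "(\<Sum>u\<in>words S N. ?p u * (real q * ln (a u))) \<le> (\<Sum>u\<in>words S N. ?p u * ((\<Sum>t<N. ?G t u) + R))"
  proof (rule sum_mono)
    fix u assume u: "u \<in> words S N"
    show "?p u * (real q * ln (a u)) \<le> ?p u * ((\<Sum>t<N. ?G t u) + R)"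
    proof (cases "a u = 0")
      case False
      then have au: "0 < a u" using nonneg[of u] by simp
      have "(\<Sum>j<q. ln (a u)) \<le> (\<Sum>j<q. (\<Sum>i<m. ?G (j + i * q) u) + (K + real q * C))"
        using log_weight_le_blocks[OF q C u au] by (intro sum_mono) (simp add: add.assoc)
      also have "\<dots> = (\<Sum>t<N. ?G t u) + R"
        by (simp add: sum.distrib sum_offset_blocks[OF q(1), of "\<lambda>t. ?G t u"] R_def)
      finally show ?thesis using law_nonneg by (intro mult_left_mono) auto
    qed (simp add: law_def)
  qed
  also have "\<dots> = (\<Sum>u\<in>words S N. ?p u * (\<Sum>t<N. ?G t u)) + R"
    using law_total by (simp add: distrib_left sum.distrib flip: sum_distrib_right)
  also have "(\<Sum>u\<in>words S N. ?p u * (\<Sum>t<N. ?G t u)) = real N * (\<Sum>w\<in>words S q. periodic_weight N w * floored_log K w)"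
    using N by (simp add: expectation_by_window)
  finally show ?thesis
    using law_entropy_le_block_entropy[OF q] by (simp add: R_def algebra_simps)
qed

end

end

lemma convergent_subsequence_of_bounded_functions:
  fixes F :: "nat \<Rightarrow> 'a::countable \<Rightarrow> real"
  assumes "\<And>k w. 0 \<le> F k w" "\<And>k w. F k w \<le> 1"
  shows "\<exists>r f. strict_mono r \<and> (\<forall>w. (\<lambda>k. F (r k) w) \<longlonglongrightarrow> f w)"
proof -
  have "compactin (product_topology (\<lambda>_. euclidean) UNIV) (Pi\<^sub>E (UNIV :: 'a set) (\<lambda>_. {0..1::real}))"
    by (subst compactin_PiE) (auto simp: compactin_euclidean_iff)
  then have "compact (Pi\<^sub>E (UNIV :: 'a set) (\<lambda>_. {0..1::real}))"
    by (simp add: euclidean_product_topology compactin_euclidean_iff)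
  then have "seq_compact (Pi\<^sub>E (UNIV :: 'a set) (\<lambda>_. {0..1::real}))"
    by (rule compact_imp_seq_compact)
  moreover have "\<forall>k. F k \<in> Pi\<^sub>E UNIV (\<lambda>_. {0..1})" using assms by auto
  ultimately obtain f r where fr: "strict_mono r" "(F \<circ> r) \<longlonglongrightarrow> f"
    unfolding seq_compact_def by blast
  have "(\<lambda>k. F (r k) w) \<longlonglongrightarrow> f w" for w
    using continuous_on_tendsto_compose[OF continuous_on_product_coordinates[of w] fr(2)]
    by (simp add: o_def)
  with fr(1) show ?thesis by blast
qed


text \<open>A pointwise limit of the periodic weights. The lengths are factorials so that every \<open>q\<close>
  eventually divides them. Letting \<open>N\<close> tend to infinity removes the error term for fixed \<open>K\<close>. Letting \<open>K\<close> tend to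
  infinity shows first that the limit gives no mass to words of weight zero, and then that the floored
  logarithms may be replaced by true ones.\<close>

lemma variational_lower_bound:
  fixes a :: "nat list \<Rightarrow> real"
  assumes "submultiplicative_weight S a"
    and growth: "\<And>k. k0 \<le> k \<Longrightarrow> 0 < submultiplicative_weight.Z S a (fact k) \<and>
      P * real (fact k) \<le> ln (submultiplicative_weight.Z S a (fact k))"
  obtains f where "stationary_weight S f"
    "\<And>w. set w \<subseteq> S \<Longrightarrow> 0 < f w \<Longrightarrow> 0 < a w"
    "\<And>q. 1 \<le> q \<Longrightarrow> real q * P \<le> block_entropy S f q + (\<Sum>w\<in>words S q. f w * ln (a w))"
proof -
  interpret submultiplicative_weight S a by fact
  define F where "F k = periodic_weight (fact (k0 + k))" for k
  have N1: "1 \<le> (fact (k0 + k) :: nat)" for k by (rule fact_ge_1)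
  have Zpos: "0 < Z (fact (k0 + k))" for k using growth[of "k0 + k"] by simp
  have st: "stationary_weight S (F k)" for k unfolding F_def by (rule stationary_periodic_weight[OF N1 Zpos])
  have F0: "0 \<le> F k w" for k w unfolding F_def by (rule periodic_weight_nonneg)
  have F1: "F k w \<le> 1" for k w
  proof (cases "set w \<subseteq> S")
    case False
    have "cyclic_window (fact (k0 + k)) t (length w) u \<noteq> w" if "u \<in> words S (fact (k0 + k))" for t u
      using cyclic_window_words[OF that N1, of t "length w"] False by (auto simp: words_def)
    then have e: "{u \<in> words S (fact (k0 + k)). cyclic_window (fact (k0 + k)) t (length w) u = w} = {}" for t
      by blast
    show ?thesis unfolding F_def periodic_weight_def e by simp
  qed (use stationary_weight_le_1[OF st] in blast)
  obtain r f where r: "strict_mono r" and f: "\<And>w. (\<lambda>k. F (r k) w) \<longlonglongrightarrow> f w"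
    using convergent_subsequence_of_bounded_functions[of F, OF F0 F1] by blast
  have f0: "0 \<le> f w" for w using F0 by (intro LIMSEQ_le_const[OF f] exI allI impI)
  have stf: "stationary_weight S f"
    unfolding stationary_weight_def
  proof (intro conjI allI impI finite_S f0)
    have "F k [] = 1" for k using st[of k] by (simp add: stationary_weight_def)
    then show "f [] = 1" using f[of "[]"] by (simp add: LIMSEQ_const_iff)
    fix l assume l: "set l \<subseteq> S"
    have "(\<Sum>i\<in>S. F k (l @ [i])) = F k l" "(\<Sum>i\<in>S. F k (i # l)) = F k l" for k
      using st[of k] l by (auto simp: stationary_weight_def)
    moreover have "(\<lambda>k. \<Sum>i\<in>S. F (r k) (l @ [i])) \<longlonglongrightarrow> (\<Sum>i\<in>S. f (l @ [i]))"
      "(\<lambda>k. \<Sum>i\<in>S. F (r k) (i # l)) \<longlonglongrightarrow> (\<Sum>i\<in>S. f (i # l))"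
      by (intro tendsto_sum f)+
    ultimately show "(\<Sum>i\<in>S. f (l @ [i])) = f l" "(\<Sum>i\<in>S. f (i # l)) = f l"
      using f[of l] LIMSEQ_unique by auto
  qed
  obtain C where C0: "0 \<le> C" and C: "\<And>w. set w \<subseteq> S \<Longrightarrow> a w \<le> exp (C * real (length w))"
    using exp_bound by blast
  have floored: "real q * P \<le> block_entropy S f q + (\<Sum>w\<in>words S q. f w * floored_log K w)"
    if q: "1 \<le> q" for q K
  proof -
    define D where "D = real q * (K + real q * C)"
    have ineq: "real q * P \<le> block_entropy S (F k) q + (\<Sum>w\<in>words S q. F k w * floored_log K w) + D / real (fact (k0 + k))"
      if k: "q \<le> k0 + k" for k
    proof -
      let ?N = "fact (k0 + k) :: nat"
      have Npos: "0 < real ?N" using N1[of k] by simp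
      have "q dvd ?N" using q k by (intro dvd_fact)
      then obtain m where m: "?N = q * m" by (rule dvdE)
      have "real q * (P * real ?N) \<le> real q * ln (Z ?N)"
        using growth[of "k0 + k"] by (intro mult_left_mono) auto
      also have "\<dots> \<le> real ?N * (block_entropy S (F k) q + (\<Sum>w\<in>words S q. F k w * floored_log K w)) + D"
        unfolding F_def D_def by (rule log_partition_function_le[OF N1 Zpos m q C])
      finally have "(real q * P) * real ?N \<le>
          (block_entropy S (F k) q + (\<Sum>w\<in>words S q. F k w * floored_log K w) + D / real ?N) * real ?N"
        using Npos by (simp add: algebra_simps)
      then show ?thesis using Npos mult_le_cancel_right_pos by blast
    qed
    have "(\<lambda>k. block_entropy S (F (r k)) q + (\<Sum>w\<in>words S q. F (r k) w * floored_log K w) + D / real (fact (k0 + r k)))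
       \<longlonglongrightarrow> block_entropy S f q + (\<Sum>w\<in>words S q. f w * floored_log K w) + 0"
    proof (intro tendsto_add)
      show "(\<lambda>k. block_entropy S (F (r k)) q) \<longlonglongrightarrow> block_entropy S f q"
        unfolding block_entropy_def
        by (intro tendsto_sum continuous_on_tendsto_compose[OF continuous_eta f])
          (use f0 F0 in auto)
      show "(\<lambda>k. \<Sum>w\<in>words S q. F (r k) w * floored_log K w) \<longlonglongrightarrow> (\<Sum>w\<in>words S q. f w * floored_log K w)"
        by (intro tendsto_intros f)
      have "(\<lambda>k. D / real k) \<longlonglongrightarrow> 0" by real_asymp
      moreover have "filterlim (\<lambda>k. fact (k0 + r k) :: nat) sequentially sequentially"
      proof (rule filterlim_at_top_mono)
        show "filterlim r at_top sequentially" by (rule filterlim_subseq[OF r])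
        show "\<forall>\<^sub>F k in sequentially. r k \<le> fact (k0 + r k)"
          by (intro always_eventually allI order_trans[OF _ fact_ge_self]) simp
      qed
      ultimately show "(\<lambda>k. D / real (fact (k0 + r k))) \<longlonglongrightarrow> 0"
        by (rule filterlim_compose)
    qed
    moreover have "\<exists>n. \<forall>k\<ge>n. real q * P \<le>
      block_entropy S (F (r k)) q + (\<Sum>w\<in>words S q. F (r k) w * floored_log K w) + D / real (fact (k0 + r k))"
    proof (intro exI[of _ q] allI impI ineq)
      fix k assume "q \<le> k"
      then show "q \<le> k0 + r k" using seq_suble[OF r, of k] by linarith
    qed
    ultimately have "real q * P \<le> block_entropy S f q + (\<Sum>w\<in>words S q. f w * floored_log K w) + 0"
      by (rule LIMSEQ_le_const)
    then show ?thesis by simp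
  qed
  have pos: "0 < a w" if w: "set w \<subseteq> S" "0 < f w" for w
  proof (rule ccontr)
    assume "\<not> 0 < a w"
    then have aw: "a w = 0" using nonneg[of w] by simp
    define q where "q = length w"
    have "w \<noteq> []"
    proof
      assume "w = []"
      have "a u = 0" for u using submult[of "[]" u] nonneg[of u] aw \<open>w = []\<close> by simp
      then have "Z n = 0" for n by (simp add: Z_def)
      then show False using Zpos by simp
    qed
    then have q: "1 \<le> q" by (simp add: q_def Suc_leI)
    define B where "B = block_entropy S f q + C * real q - real q * P"
    \<comment> \<open>a word of weight zero and positive mass would contribute \<open>- K * f w\<close> for every \<open>K\<close>\<close>
    have bd: "K * f w \<le> B" if K: "0 \<le> K" for K
    proof -
      have "(\<Sum>v\<in>words S q. f v * floored_log K v) \<le> (\<Sum>v\<in>words S q. f v * (C * real q) - (if v = w then K * f w else 0))"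
      proof (rule sum_mono)
        fix v assume v: "v \<in> words S q"
        have "floored_log K v \<le> C * real q"
        proof (cases "0 < a v")
          case True
          have "a v \<le> exp (C * real q)" using C[of v] v by (simp add: words_def)
          then have "ln (a v) \<le> C * real q" using True by (metis exp_gt_zero ln_exp ln_le_cancel_iff)
          moreover have "- K \<le> C * real q" using K C0 by (meson mult_nonneg_nonneg neg_le_0_iff_le of_nat_0_le_iff order_trans)
          ultimately show ?thesis using True by (simp add: floored_log_def)
        next
          case False
          have "0 \<le> C * real q" using C0 by simp
          then show ?thesis using K False by (simp add: floored_log_def)
        qed
        then have "f v * floored_log K v \<le> f v * (C * real q)" using f0 by (intro mult_left_mono)
        moreover have "floored_log K w = - K" by (simp add: floored_log_def aw)
        moreover have "0 \<le> f w * (C * real q)" using f0 C0 by simp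
        ultimately show "f v * floored_log K v \<le> f v * (C * real q) - (if v = w then K * f w else 0)"
          by (auto simp: mult.commute)
      qed
      also have "\<dots> = (\<Sum>v\<in>words S q. f v) * (C * real q) - (\<Sum>v\<in>words S q. if v = w then K * f w else 0)"
        by (simp add: sum_subtractf sum_distrib_right)
      also have "(\<Sum>v\<in>words S q. if v = w then K * f w else 0) = K * f w"
        using w(1) by (simp add: finite_S q_def words_def finite_lists_length_eq)
      also have "(\<Sum>v\<in>words S q. f v) = 1" by (rule stationary_weight_total[OF stf])
      finally show ?thesis using floored[OF q, of K] by (simp add: B_def)
    qed
    have "B \<ge> 0" using bd[of 0] by simp
    then have "(B + 1) / f w * f w \<le> B" using w(2) by (intro bd) simp
    then show False using w(2) by simp
  qed
  have "real q * P \<le> block_entropy S f q + (\<Sum>w\<in>words S q. f w * ln (a w))" if q: "1 \<le> q" for q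
  proof -
    define K where "K = (\<Sum>w\<in>words S q. \<bar>ln (a w)\<bar>)"
    have "f w * floored_log K w = f w * ln (a w)" if w: "w \<in> words S q" for w
    proof (cases "f w = 0")
      case False
      then have "0 < a w" using pos[of w] f0[of w] w by (simp add: words_def)
      moreover have "\<bar>ln (a w)\<bar> \<le> K" unfolding K_def
        using w finite_S by (intro member_le_sum[of w _ "\<lambda>w. \<bar>ln (a w)\<bar>"]) auto
      ultimately have "0 < a w" "- K \<le> ln (a w)" by linarith+
      then have "floored_log K w = ln (a w)" by (simp add: floored_log_def)
      then show ?thesis by simp
    qed simp
    then have "(\<Sum>w\<in>words S q. f w * floored_log K w) = (\<Sum>w\<in>words S q. f w * ln (a w))"
      by (rule sum.cong[OF refl])
    then show ?thesis using floored[OF q, of K] by simp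
  qed
  with stf pos show ?thesis by (rule that)
qed

section \<open>Zero entropy forces a periodic language\<close>

context submultiplicative_weight
begin

lemma Z_submult: "Z (n + m) \<le> Z n * Z m"
proof -
  have "Z (n + m) = (\<Sum>u\<in>words S n. \<Sum>v\<in>words S m. a (u @ v))"
    by (simp add: Z_def sum_words_append[OF finite_S])
  also have "\<dots> \<le> (\<Sum>u\<in>words S n. \<Sum>v\<in>words S m. a u * a v)" by (intro sum_mono submult)
  also have "\<dots> = Z n * Z m" by (simp add: Z_def sum_product)
  finally show ?thesis .
qed

text \<open>Each product \<open>a u * a v\<close> is dominated by the weight of a word \<open>u @ w @ v\<close> with a short \<open>w\<close>, and words
  longer by at most \<open>k\<close> cost at most the factors \<open>Z j\<close>.\<close>

lemma Z_almost_supermult: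
  assumes c: "0 < c" and quasi: "\<And>u v. \<exists>w. set w \<subseteq> S \<and> length w \<le> k \<and> c * (a u * a v) \<le> a (u @ w @ v)"
  shows "Z n * Z m \<le> (\<Sum>j\<le>k. Z j) / c * Z (n + m)"
proof -
  have pt: "c * (a u * a v) \<le> (\<Sum>j\<le>k. \<Sum>w\<in>words S j. a (u @ w @ v))" for u v
  proof -
    obtain w where w: "set w \<subseteq> S" "length w \<le> k" "c * (a u * a v) \<le> a (u @ w @ v)" using quasi by blast
    have "a (u @ w @ v) \<le> (\<Sum>w\<in>words S (length w). a (u @ w @ v))"
      using w finite_S nonneg
      by (intro member_le_sum[of w _ "\<lambda>w. a (u @ w @ v)"]) (auto simp: words_def finite_lists_length_eq)
    also have "\<dots> \<le> (\<Sum>j\<le>k. \<Sum>w\<in>words S j. a (u @ w @ v))"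
      using w nonneg member_le_sum[of "length w" "{..k}" "\<lambda>j. \<Sum>w\<in>words S j. a (u @ w @ v)"]
      by (auto intro: sum_nonneg)
    finally show ?thesis using w(3) by linarith
  qed
  have "Z n * Z m = (\<Sum>u\<in>words S n. \<Sum>v\<in>words S m. a u * a v)" by (simp add: Z_def sum_product)
  then have "c * (Z n * Z m) = (\<Sum>u\<in>words S n. \<Sum>v\<in>words S m. c * (a u * a v))"
    by (simp add: sum_distrib_left)
  also have "\<dots> \<le> (\<Sum>u\<in>words S n. \<Sum>v\<in>words S m. \<Sum>j\<le>k. \<Sum>w\<in>words S j. a (u @ w @ v))"
    by (intro sum_mono pt)
  also have "\<dots> = (\<Sum>j\<le>k. \<Sum>u\<in>words S n. \<Sum>w\<in>words S j. \<Sum>v\<in>words S m. a (u @ w @ v))"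
  proof -
    have "(\<Sum>u\<in>words S n. \<Sum>v\<in>words S m. \<Sum>j\<le>k. \<Sum>w\<in>words S j. a (u @ w @ v)) =
        (\<Sum>u\<in>words S n. \<Sum>j\<le>k. \<Sum>v\<in>words S m. \<Sum>w\<in>words S j. a (u @ w @ v))"
      by (intro sum.cong refl sum.swap)
    also have "\<dots> = (\<Sum>u\<in>words S n. \<Sum>j\<le>k. \<Sum>w\<in>words S j. \<Sum>v\<in>words S m. a (u @ w @ v))"
      by (intro sum.cong refl sum.swap)
    also have "\<dots> = (\<Sum>j\<le>k. \<Sum>u\<in>words S n. \<Sum>w\<in>words S j. \<Sum>v\<in>words S m. a (u @ w @ v))"
      by (rule sum.swap)
    finally show ?thesis .
  qed
  also have "\<dots> = (\<Sum>j\<le>k. Z (n + (j + m)))"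
    by (simp add: Z_def sum_words_append[OF finite_S])
  also have "\<dots> \<le> (\<Sum>j\<le>k. Z j * Z (n + m))"
  proof (rule sum_mono)
    fix j
    have "n + (j + m) = j + (n + m)" by simp
    then show "Z (n + (j + m)) \<le> Z j * Z (n + m)" using Z_submult[of j "n + m"] by (simp only:)
  qed
  finally have "c * (Z n * Z m) \<le> (\<Sum>j\<le>k. Z j) * Z (n + m)" by (simp add: sum_distrib_right)
  then show ?thesis using c by (simp add: field_simps)
qed

text \<open>A single large value of \<open>Z\<close> forces exponential growth along all multiples of \<open>n\<close>, and therefore
  along the factorials.\<close>

lemma Z_growth:
  assumes pos: "\<And>n. 0 < Z n" and K: "1 \<le> K" "\<And>n m. Z n * Z m \<le> K * Z (n + m)" and Z0: "1 \<le> Z 0" and n: "1 \<le> n"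
  shows "(ln (Z n) - ln K) / real n * real (fact (n + k)) \<le> ln (Z (fact (n + k)))"
proof -
  have pow: "Z n ^ j \<le> K ^ j * Z (n * j)" for j
  proof (induction j)
    case (Suc j)
    have "Z n ^ Suc j \<le> Z n * (K ^ j * Z (n * j))"
      using Suc pos[of n] by (simp add: mult_left_mono)
    also have "\<dots> \<le> K ^ j * (K * Z (n + n * j))"
      using K mult_left_mono[OF K(2)[of n "n * j"], of "K ^ j"] by (simp add: mult_ac)
    finally show ?case by (simp add: mult_ac)
  qed (use Z0 in simp)
  have "n dvd fact (n + k)" using n by (intro dvd_fact) auto
  then obtain j where j: "fact (n + k) = n * j" by (rule dvdE)
  have "ln (Z n ^ j) \<le> ln (K ^ j * Z (n * j))" using pow[of j] pos K by (subst ln_le_cancel_iff) auto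
  then have "real j * ln (Z n) \<le> real j * ln K + ln (Z (n * j))"
    using pos[of n] pos[of "n * j"] K by (simp add: ln_mult ln_realpow)
  then have "real j * (ln (Z n) - ln K) \<le> ln (Z (n * j))" by (simp add: algebra_simps)
  moreover have "(ln (Z n) - ln K) / real n * real (n * j) = real j * (ln (Z n) - ln K)" using n by simp
  ultimately show ?thesis unfolding j by simp
qed

end

definition norm_weight :: "(nat \<Rightarrow> real^'d^'d) \<Rightarrow> real \<Rightarrow> nat list \<Rightarrow> real" where
  "norm_weight A s w = mnorm (word_prod A w) powr s"

locale irreducible_equilibrium = unique_equilibrium M A s \<mu>
  for M :: nat and A :: "nat \<Rightarrow> real^'d^'d" and s :: real and \<mu> :: "(nat \<Rightarrow> nat) measure" +
  assumes irr: "irreducible_tuple M A"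
begin

lemma norm_weight_submultiplicative: "submultiplicative_weight {1..M} (norm_weight A s)"
proof
  fix u v :: "nat list"
  show "0 \<le> norm_weight A s u" by (simp add: norm_weight_def)
  have "norm_weight A s (u @ v) \<le> (mnorm (word_prod A v) * mnorm (word_prod A u)) powr s"
    unfolding norm_weight_def word_prod_append using s0
    by (intro powr_mono2 mnorm_mult_le mnorm_nonneg) auto
  also have "\<dots> = norm_weight A s u * norm_weight A s v"
    by (simp add: norm_weight_def powr_mult mnorm_nonneg mult.commute)
  finally show "norm_weight A s (u @ v) \<le> norm_weight A s u * norm_weight A s v" .
  have "mnorm (mat 1 :: real^'d^'d) \<le> 1" by (rule onorm_le) simp
  then have "norm_weight A s [] \<le> 1 powr s"
    unfolding norm_weight_def using s0 by (intro powr_mono2 mnorm_nonneg) auto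
  then show "norm_weight A s [] \<le> 1" by simp
qed simp

interpretation submultiplicative_weight "{1..M}" "norm_weight A s"
  by (rule norm_weight_submultiplicative)

lemma norm_weight_pos_iff: "0 < norm_weight A s w \<longleftrightarrow> word_prod A w \<noteq> 0"
  using mnorm_nonneg[of "word_prod A w"] mnorm_eq_0[of "word_prod A w"] by (auto simp: norm_weight_def)

text \<open>The limiting weight is the family of cylinder masses of an invariant measure, and its free
  energy competes with that of the equilibrium state.\<close>

lemma growth_rate_le_free_energy:
  assumes growth: "\<And>k. k0 \<le> k \<Longrightarrow> 0 < Z (fact k) \<and> P * real (fact k) \<le> ln (Z (fact k))"
  shows "ereal P \<le> free_energy A s \<mu>"
proof -
  obtain f where f: "stationary_weight {1..M} f"
    and fpos: "\<And>w. set w \<subseteq> {1..M} \<Longrightarrow> 0 < f w \<Longrightarrow> 0 < norm_weight A s w"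
    and fP: "\<And>q. 1 \<le> q \<Longrightarrow> real q * P \<le>
      block_entropy {1..M} f q + (\<Sum>w\<in>words {1..M} q. f w * ln (norm_weight A s w))"
    using variational_lower_bound[OF norm_weight_submultiplicative growth] by blast
  obtain \<nu> where \<nu>: "\<nu> \<in> invariant_measures M" and cw: "\<And>w. set w \<subseteq> {1..M} \<Longrightarrow> cylinder_weight M \<nu> w = f w"
    using stationary_weight_realized[OF f] M2 by auto
  let ?u = "mean_log_norm M A (cylinder_weight M \<nu>)"
  have BE: "block_entropy {1..M} (cylinder_weight M \<nu>) q = block_entropy {1..M} f q" for q
    unfolding block_entropy_def by (intro sum.cong) (auto simp: words_def cw)
  have nz: "word_prod A w \<noteq> 0" if "set w \<subseteq> {1..M}" "0 < cylinder_weight M \<nu> w" for w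
    using fpos[OF that(1)] that cw norm_weight_pos_iff by auto
  have u: "(\<Sum>w\<in>words {1..M} q. f w * ln (norm_weight A s w)) = s * ?u q" for q
    unfolding mean_log_norm_def sum_distrib_left
    by (intro sum.cong) (auto simp: words_def cw norm_weight_def ln_powr)
  obtain h where h: "(\<lambda>n. block_entropy {1..M} f n / real n) \<longlonglongrightarrow> h"
    using block_entropy_rate[OF f] by blast
  have "ereal h \<le> metric_entropy \<nu> shift_map"
    by (rule metric_entropy_ge_block_rate[OF \<nu>]) (use h in \<open>simp only: BE\<close>)
  have lam: "(\<lambda>n. ereal (?u n / real n)) \<longlonglongrightarrow> lyapunov_exponent A \<nu>"
  proof -
    have "lyapunov_exponent A \<nu> = (INF n\<in>{1..}. ereal (?u n / real n))"
      by (rule lyapunov_exponent_eq_INF[OF \<nu>]) (rule nz)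
    moreover have "(\<lambda>n. ereal (?u n / real n)) \<longlonglongrightarrow> (INF n\<in>{1..}. ereal (?u n / real n))"
    proof (rule fekete)
      show "?u (m + n) \<le> ?u m + ?u n" for m n
        by (rule mean_log_norm_subadditive[OF stationary_cylinder_weight[OF \<nu>]]) (rule nz)
    qed
    ultimately show ?thesis by (simp only:)
  qed
  have "(\<lambda>n. ereal (block_entropy {1..M} f n / real n) + ereal s * ereal (?u n / real n))
      \<longlonglongrightarrow> ereal h + ereal s * lyapunov_exponent A \<nu>"
  proof (rule tendsto_add_ereal_general2)
    show "(\<lambda>n. ereal (block_entropy {1..M} f n / real n)) \<longlonglongrightarrow> ereal h" using h by simp
    show "(\<lambda>n. ereal s * ereal (?u n / real n)) \<longlonglongrightarrow> ereal s * lyapunov_exponent A \<nu>"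
      by (rule tendsto_cmult_ereal[OF _ lam]) simp
  qed simp
  then have "ereal P \<le> ereal h + ereal s * lyapunov_exponent A \<nu>"
  proof (rule LIMSEQ_le_const, intro exI[of _ 1] allI impI)
    fix n :: nat assume n: "1 \<le> n"
    have "real n * P / real n \<le> (block_entropy {1..M} f n + s * ?u n) / real n"
      using fP[OF n] unfolding u by (intro divide_right_mono) auto
    then show "ereal P \<le> ereal (block_entropy {1..M} f n / real n) + ereal s * ereal (?u n / real n)"
      using n by (simp add: add_divide_distrib)
  qed
  also have "\<dots> \<le> free_energy A s \<nu>"
    unfolding free_energy_def by (intro add_right_mono) fact
  also have "\<dots> \<le> free_energy A s \<mu>"
    using equilibrium_maximal[OF \<nu>] .
  finally show ?thesis .
qed

text \<open>With \<open>L\<close> the exponent of the equilibrium state, the weights \<open>a w * exp (- s L n)\<close> of words \<open>w\<close> of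
  length \<open>n\<close> satisfy the assumptions of \<open>tight_word_weight\<close>.\<close>

theorem zero_entropy_imp_periodic_language:
  assumes zero: "metric_entropy \<mu> shift_map = 0"
  shows "\<exists>(y :: nat \<Rightarrow> nat) p. 1 \<le> p \<and> (\<forall>i. y i \<in> {1..M}) \<and> (\<forall>i. y (i + p) = y i) \<and>
    (\<forall>w. set w \<subseteq> {1..M} \<longrightarrow> (word_prod A w \<noteq> 0 \<longleftrightarrow> (\<exists>i. w = map y [i..<i + length w])))"
proof -
  note \<mu> = equilibrium_invariant
  have st: "stationary_weight {1..M} (cylinder_weight M \<mu>)" by (rule stationary_cylinder_weight[OF \<mu>])
  have minf: "lyapunov_exponent A \<mu> \<noteq> - \<infinity>"
    by (rule unique_equilibrium_lyapunov_finite)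
  obtain L where L: "lyapunov_exponent A \<mu> = ereal L"
    using minf lyapunov_exponent_not_PInf[OF \<mu>, of A] by (cases "lyapunov_exponent A \<mu>") auto
  have FE: "free_energy A s \<mu> = ereal (s * L)" by (simp add: free_energy_def zero L)
  \<comment> \<open>a mean value is attained or exceeded by some word of positive mass\<close>
  have large: "\<exists>w\<in>words {1..M} n. exp (real n * (s * L)) \<le> norm_weight A s w" for n
  proof (cases "n = 0")
    case True
    have "mnorm (mat 1 :: real^'d^'d) = 1" using onorm_id[where 'a = "real^'d"] by (simp add: id_def[symmetric] matrix_vector_mul_lid[abs_def])
    then show ?thesis using True by (simp add: norm_weight_def)
  next
    case False
    then have n: "1 \<le> n" by simp
    let ?f = "cylinder_weight M \<mu>"
    have "ereal L \<le> ereal (mean_log_norm M A ?f n / real n)"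
      using lyapunov_exponent_le[OF \<mu> n minf] by (simp add: L)
    then have le: "real n * L \<le> mean_log_norm M A ?f n" using n by (simp add: field_simps)
    have "\<exists>w\<in>words {1..M} n. 0 < ?f w \<and> real n * L \<le> ln (mnorm (word_prod A w))"
    proof (rule ccontr)
      assume "\<not> ?thesis"
      then have lt: "ln (mnorm (word_prod A w)) < real n * L" if "w \<in> words {1..M} n" "0 < ?f w" for w
        using that by force
      have f0: "0 \<le> ?f w" for w by (simp add: cylinder_weight_def)
      have "\<exists>w\<in>words {1..M} n. 0 < ?f w"
        using stationary_weight_total[OF st, of n] f0 by (metis less_eq_real_def sum.neutral zero_neq_one)
      then obtain w0 where w0: "w0 \<in> words {1..M} n" "0 < ?f w0" by blast
      have "mean_log_norm M A ?f n < (\<Sum>w\<in>words {1..M} n. ?f w * (real n * L))"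
        unfolding mean_log_norm_def
      proof (rule sum_strict_mono_ex1)
        show "\<forall>w\<in>words {1..M} n. ?f w * ln (mnorm (word_prod A w)) \<le> ?f w * (real n * L)"
          using lt f0 by (metis less_eq_real_def mult_left_mono mult_zero_left)
        show "\<exists>w\<in>words {1..M} n. ?f w * ln (mnorm (word_prod A w)) < ?f w * (real n * L)"
          using w0 lt by (intro bexI[of _ w0]) auto
      qed simp
      also have "\<dots> = real n * L"
        using stationary_weight_total[OF st, of n] by (simp flip: sum_distrib_right)
      finally show False using le by simp
    qed
    then obtain w where w: "w \<in> words {1..M} n" "0 < ?f w" "real n * L \<le> ln (mnorm (word_prod A w))" by blast
    have "word_prod A w \<noteq> 0"
      using unique_equilibrium_charges_nonzero[of w] w by (auto simp: words_def)
    then have m: "0 < mnorm (word_prod A w)" by (rule mnorm_pos)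
    have "real n * (s * L) \<le> s * ln (mnorm (word_prod A w))" using w(3) s0 by simp
    then have "exp (real n * (s * L)) \<le> norm_weight A s w" using m by (simp add: norm_weight_def powr_def)
    then show ?thesis using w(1) by blast
  qed
  have Zpos: "0 < Z n" for n
  proof -
    obtain w where w: "w \<in> words {1..M} n" "exp (real n * (s * L)) \<le> norm_weight A s w" using large by blast
    have "0 < exp (real n * (s * L))" by simp
    also have "\<dots> \<le> norm_weight A s w" by (rule w)
    also have "\<dots> \<le> Z n" unfolding Z_def using w(1) nonneg by (intro member_le_sum) auto
    finally show ?thesis .
  qed
  obtain c k where c: "0 < c" and quasi: "\<And>u v. \<exists>w. set w \<subseteq> {1..M} \<and> length w \<le> k \<and>
       c * (mnorm (word_prod A u) * mnorm (word_prod A v)) \<le> mnorm (word_prod A (u @ w @ v))"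
    using irreducible_quasi_multiplicative[OF irr] by blast
  define c' where "c' = c powr s"
  have c': "0 < c'" using c by (simp add: c'_def)
  have quasi': "\<exists>w. set w \<subseteq> {1..M} \<and> length w \<le> k \<and> c' * (norm_weight A s u * norm_weight A s v) \<le> norm_weight A s (u @ w @ v)" for u v
  proof -
    obtain w where w: "set w \<subseteq> {1..M}" "length w \<le> k"
      "c * (mnorm (word_prod A u) * mnorm (word_prod A v)) \<le> mnorm (word_prod A (u @ w @ v))" using quasi by blast
    have "(c * (mnorm (word_prod A u) * mnorm (word_prod A v))) powr s \<le> norm_weight A s (u @ w @ v)"
      unfolding norm_weight_def using w(3) c s0 by (intro powr_mono2) (auto simp: mnorm_nonneg)
    then have "c' * (norm_weight A s u * norm_weight A s v) \<le> norm_weight A s (u @ w @ v)"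
      using c by (simp add: c'_def norm_weight_def powr_mult mnorm_nonneg)
    then show ?thesis using w by blast
  qed
  define K where "K = max 1 ((\<Sum>j\<le>k. Z j) / c')"
  have K1: "1 \<le> K" by (simp add: K_def)
  have supm: "Z n * Z m \<le> K * Z (n + m)" for n m
  proof -
    have "Z n * Z m \<le> (\<Sum>j\<le>k. Z j) / c' * Z (n + m)" by (rule Z_almost_supermult[OF c' quasi'])
    also have "\<dots> \<le> K * Z (n + m)" by (intro mult_right_mono Z_nonneg) (simp add: K_def)
    finally show ?thesis .
  qed
  have Z0: "1 \<le> Z 0" using large[of 0] unfolding Z_def words_0 by simp
  \<comment> \<open>otherwise \<open>Z\<close> would grow at a rate above \<open>s * L\<close>, which is the largest free energy\<close>
  have Zle: "Z n \<le> K * exp (real n * (s * L))" for n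
  proof (cases "n = 0")
    case True
    have "Z 0 \<le> 1" using a_Nil unfolding Z_def words_0 by simp
    then show ?thesis using K1 True by simp
  next
    case False
    then have n: "1 \<le> n" by simp
    have "ereal ((ln (Z n) - ln K) / real n) \<le> free_energy A s \<mu>"
    proof (rule growth_rate_le_free_energy[of n])
      fix j assume "n \<le> j"
      then obtain i where "j = n + i" by (auto simp: le_iff_add)
      then show "0 < Z (fact j) \<and> (ln (Z n) - ln K) / real n * real (fact j) \<le> ln (Z (fact j))"
        using Z_growth[OF Zpos K1 supm Z0 n, of i] Zpos by simp
    qed
    then have "(ln (Z n) - ln K) / real n \<le> s * L" by (simp add: FE)
    then have "ln (Z n) \<le> ln K + real n * (s * L)" using n by (simp add: field_simps)
    also have "\<dots> = ln (K * exp (real n * (s * L)))" using K1 by (simp add: ln_mult)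
    finally show ?thesis using Zpos[of n] K1 by (subst (asm) ln_le_cancel_iff) auto
  qed
  define b where "b w = norm_weight A s w * exp (- (s * L * real (length w)))" for w
  define d where "d = c' * exp (- (\<bar>s * L\<bar> * real k))"
  have "tight_word_weight {1..M} b d K k"
  proof
    show "0 \<le> b w" for w by (simp add: b_def nonneg)
    show "b (u @ v) \<le> b u * b v" for u v
    proof -
      have "b (u @ v) \<le> norm_weight A s u * norm_weight A s v * exp (- (s * L * real (length (u @ v))))"
        unfolding b_def by (intro mult_right_mono submult) simp
      also have "\<dots> = b u * b v" by (simp add: b_def distrib_left mult_exp_exp)
      finally show ?thesis .
    qed
    show "0 < d" using c' by (simp add: d_def)
    show "\<exists>w. set w \<subseteq> {1..M} \<and> length w \<le> k \<and> d * (b u * b v) \<le> b (u @ w @ v)" for u v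
    proof -
      obtain w where w: "set w \<subseteq> {1..M}" "length w \<le> k"
        "c' * (norm_weight A s u * norm_weight A s v) \<le> norm_weight A s (u @ w @ v)" using quasi' by blast
      have "s * L * real (length w) \<le> \<bar>s * L\<bar> * real k"
        using w(2) by (intro mult_mono) auto
      then have e: "exp (- (\<bar>s * L\<bar> * real k)) \<le> exp (- (s * L * real (length w)))" by simp
      define E where "E = exp (- (s * L * real (length u))) * exp (- (s * L * real (length v)))"
      have E0: "0 \<le> E" by (simp add: E_def)
      have "d * (b u * b v) = (c' * (norm_weight A s u * norm_weight A s v)) * (exp (- (\<bar>s * L\<bar> * real k)) * E)"
        by (simp add: d_def b_def E_def mult_ac)
      also have "\<dots> \<le> norm_weight A s (u @ w @ v) * (exp (- (s * L * real (length w))) * E)"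
        using w(3) e E0 nonneg by (intro mult_mono mult_right_mono) auto
      also have "\<dots> = b (u @ w @ v)"
        by (simp add: b_def E_def exp_add[symmetric] algebra_simps)
      finally show ?thesis using w by blast
    qed
    show "(\<Sum>w\<in>words {1..M} n. b w) \<le> K" for n
    proof -
      have "(\<Sum>w\<in>words {1..M} n. b w) = Z n * exp (- (real n * (s * L)))"
        unfolding Z_def sum_distrib_right by (intro sum.cong) (auto simp: b_def words_def mult_ac)
      also have "\<dots> \<le> K * exp (real n * (s * L)) * exp (- (real n * (s * L)))"
        by (intro mult_right_mono Zle) simp
      also have "\<dots> = K" by (simp add: mult.assoc exp_add[symmetric])
      finally show ?thesis .
    qed
    show "\<exists>w\<in>words {1..M} n. 1 \<le> b w" for n
    proof -
      obtain w where w: "w \<in> words {1..M} n" "exp (real n * (s * L)) \<le> norm_weight A s w" using large by blast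
      have "1 = exp (real n * (s * L)) * exp (- (s * L * real (length w)))"
        using w(1) by (simp add: words_def exp_add[symmetric] mult_ac)
      also have "\<dots> \<le> b w" unfolding b_def by (intro mult_right_mono w) simp
      finally show ?thesis using w(1) by blast
    qed
  qed simp
  then interpret tight: tight_word_weight "{1..M}" b d K k .
  obtain y p where y: "1 \<le> p" "\<forall>i. y i \<in> {1..M}" "\<forall>i. y (i + p) = y i"
    "\<forall>w. set w \<subseteq> {1..M} \<longrightarrow> (0 < b w \<longleftrightarrow> (\<exists>i. w = map y [i..<i + length w]))"
    using tight.positive_words_are_periodic_subwords by (elim exE conjE)
  have "0 < b w \<longleftrightarrow> word_prod A w \<noteq> 0" for w
    using norm_weight_pos_iff[of w] by (simp add: b_def zero_less_mult_iff)
  then have "word_prod A w \<noteq> 0 \<longleftrightarrow> (\<exists>i. w = map y [i..<i + length w])" if "set w \<subseteq> {1..M}" for w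
    using y(4)[rule_format, OF that] by simp
  then show ?thesis using y(1-3) by (intro exI[of _ y] exI[of _ p] conjI allI impI) auto
qed

end


section \<open>The equivalence\<close>

theorem theorem7:
  fixes M :: nat and A :: "nat \<Rightarrow> real^'d^'d" and s :: real and \<mu> :: "(nat \<Rightarrow> nat) measure"
  assumes "M \<ge> 2"
    and "irreducible_tuple M A"
    and "s > 0"
    and "equilibrium_state M A s \<mu>"
    and "\<And>\<nu>. equilibrium_state M A s \<nu> \<Longrightarrow> \<nu> = \<mu>"
  shows "(metric_entropy \<mu> shift_map = 0 \<longleftrightarrow> supported_on_periodic_orbit M \<mu>) \<and>
    (supported_on_periodic_orbit M \<mu> \<longleftrightarrow>
      (\<exists>n r (w :: nat list) (R :: nat \<Rightarrow> (real^'d) set).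
         n \<ge> 1 \<and> r \<ge> 1 \<and> n * r = CARD('d) \<and>
         length w = n \<and> set w \<subseteq> {1..M} \<and>
         direct_sum_decomposition {..<n} R \<and> (\<forall>j<n. dim (R j) = r) \<and>
         (\<forall>i\<in>{1..M}. \<forall>j<n. i \<noteq> w ! j \<longrightarrow> (*v) (A i) ` R j = {0}) \<and>
         (\<forall>j. j + 1 < n \<longrightarrow> (*v) (A (w ! j)) ` R j = R (j + 1)) \<and>
         (*v) (A (w ! (n - 1))) ` R (n - 1) = R 0 \<and>
         (\<forall>i<n. bij_betw ((*v) (word_prod A (rotate i w))) (R i) (R i)) \<and>
         (\<forall>x. length x = n \<and> set x \<subseteq> {1..M} \<longrightarrow>
            (word_prod A x \<noteq> 0 \<longleftrightarrow> (\<exists>i\<in>{1..n}. x = rotate i w)))))"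
proof -
  interpret irreducible_equilibrium M A s \<mu>
    by unfold_locales (fact assms)+
  let ?i = "metric_entropy \<mu> shift_map = 0" and ?ii = "supported_on_periodic_orbit M \<mu>"
  let ?iii = "\<exists>n r (w :: nat list) (R :: nat \<Rightarrow> (real^'d) set).
         n \<ge> 1 \<and> r \<ge> 1 \<and> n * r = CARD('d) \<and>
         length w = n \<and> set w \<subseteq> {1..M} \<and>
         direct_sum_decomposition {..<n} R \<and> (\<forall>j<n. dim (R j) = r) \<and>
         (\<forall>i\<in>{1..M}. \<forall>j<n. i \<noteq> w ! j \<longrightarrow> (*v) (A i) ` R j = {0}) \<and>
         (\<forall>j. j + 1 < n \<longrightarrow> (*v) (A (w ! j)) ` R j = R (j + 1)) \<and>
         (*v) (A (w ! (n - 1))) ` R (n - 1) = R 0 \<and>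
         (\<forall>i<n. bij_betw ((*v) (word_prod A (rotate i w))) (R i) (R i)) \<and>
         (\<forall>x. length x = n \<and> set x \<subseteq> {1..M} \<longrightarrow>
            (word_prod A x \<noteq> 0 \<longleftrightarrow> (\<exists>i\<in>{1..n}. x = rotate i w)))"
  have "?i" if ii: "?ii"
    using supported_on_periodic_orbit_entropy[OF equilibrium_invariant ii] .
  moreover have "?iii" if i: "?i"
  proof -
    obtain y :: "nat \<Rightarrow> nat" and p where y: "1 \<le> p" "\<forall>i. y i \<in> {1..M}" "\<forall>i. y (i + p) = y i"
      "\<forall>w. set w \<subseteq> {1..M} \<longrightarrow> (word_prod A w \<noteq> 0 \<longleftrightarrow> (\<exists>i. w = map y [i..<i + length w]))"
      using zero_entropy_imp_periodic_language[OF i] by (elim exE conjE)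
    show ?thesis
      by (rule periodic_language_decomposition[OF irr y(1) spec[OF y(3)] spec[OF y(2)] y(4)[rule_format]])
  qed
  moreover have "?ii" if iii: "?iii"
  proof -
    from iii obtain n and w :: "nat list" where w: "n \<ge> 1" "length w = n" "set w \<subseteq> {1..M}"
      "\<forall>x. length x = n \<and> set x \<subseteq> {1..M} \<longrightarrow>
            (word_prod A x \<noteq> 0 \<longleftrightarrow> (\<exists>i\<in>{1..n}. x = rotate i w))"
      by (elim exE conjE)
    show ?thesis
    proof (rule unique_equilibrium_periodic[OF w(1-3)])
      fix x assume "length x = n" "set x \<subseteq> {1..M}" "word_prod A x \<noteq> 0"
      then show "\<exists>i. x = rotate i w" using w(4)[rule_format, of x] by blast
    qed
  qed
  ultimately show ?thesis by blast
qed

end
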